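(* Let $n\ge 1$, let $P:M_n(\mathbb{C})\to M_n(\mathbb{C})$ be a completely positive map, let $E_P$ be its GNS-$C^*$-correspondence over $M_n(\mathbb{C})$, and let $d(P)$ be the index of $P$. Then the correspondence $E_P$ is strongly Morita equivalent to the Hilbert space $\mathbb{C}^{d(P)}$, regarded as a $C^*$-correspondence over $\mathbb{C}$.
   Context: A $C^*$-correspondence over a $C^*$-algebra $A$ is a right Hilbert $C^*$-module $E$ over $A$ (inner product conjugate linear in the first variable) together with a $*$-homomorphism $\varphi$ from $A$ into the adjointable operators on $E$, giving the left action $a\cdot\xi=\varphi(a)\xi$. A Hilbert space is a correspondence over $\mathbb{C}$, with left and right action by scalar multiplication. GNS-correspondence: $E_P=M_n(\mathbb{C})\otimes_P M_n(\mathbb{C})$ is the algebraic tensor product of $M_n(\mathbb{C})$ with itself (modulo vectors of length zero), with $M_n(\mathbb{C})$-valued inner product $\langle a_1\otimes b_1,a_2\otimes b_2\rangle=b_1^*P(a_1^*a_2)b_2$ and left and right actions $c\cdot(a\otimes b)\cdot d=ca\otimes bd$. Index: write $P(a)=\sum_{r=1}^N t_r a t_r^*$, $a\in M_n(\mathbb{C})$, with $t_1,\dots,t_N\in M_n(\mathbb{C})$ (possible by Stinespring's theorem). The complex dimension of the linear span of $t_1,\dots,t_N$ depends only on $P$ and is the index $d(P)$. Strong Morita equivalence of correspondences (Muhly--Solel): a correspondence $E$ over $A$ and a correspondence $F$ over $B$ are strongly Morita equivalent if there are an $A$-$B$ equivalence (imprimitivity) bimodule $X$ and an isomorphism of $A$-$B$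 correspondences (a bijective $A$-$B$-bimodule map preserving the $B$-valued inner products) $X\otimes_B F\cong E\otimes_A X$, where the tensor products are the balanced (interior) tensor products of correspondences. *)

theory Defs
  imports
    "HOL-Analysis.Analysis"
    "HOL-Algebra.Module"
    "HOL-Library.Poly_Mapping"
begin

section \<open>Normed spaces on a carrier\<close>

definition complex_ring :: "complex ring" where
  "complex_ring = \<lparr>carrier = UNIV, monoid.mult = (*), one = 1, ring.zero = 0, add = (+)\<rparr>"

text \<open>Complex vector spaces are \<^locale>\<open>Module.module\<close>s over \<^const>\<open>complex_ring\<close>. The
  record type \<open>(complex, 'v) module\<close> also contains the fields \<^const>\<open>monoid.mult\<close> and
  \<^const>\<open>one\<close>. They carry no meaning for Hilbert modules, and the field \<^const>\<open>one\<close> carries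
  none for C*-algebras either, which need not be unital.\<close>

definition lin_span :: "(complex, 'v, 'z) module_scheme \<Rightarrow> 'v set \<Rightarrow> 'v set" where
  "lin_span V S =
    {\<Oplus>\<^bsub>V\<^esub> i \<in> {..<k}. c i \<odot>\<^bsub>V\<^esub> s i | (k::nat) (c :: nat \<Rightarrow> complex) s. s \<in> {..<k} \<rightarrow> S}"

definition norm_Cauchy ::
    "('v, 'z) ring_scheme \<Rightarrow> ('v \<Rightarrow> real) \<Rightarrow> (nat \<Rightarrow> 'v) \<Rightarrow> bool" where
  "norm_Cauchy V \<nu> s \<longleftrightarrow> (\<forall>n. s n \<in> carrier V) \<and>
     (\<forall>\<epsilon>>0. \<exists>N. \<forall>m\<ge>N. \<forall>n\<ge>N. \<nu> (s m \<ominus>\<^bsub>V\<^esub> s n) < \<epsilon>)"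

definition norm_tendsto ::
    "('v, 'z) ring_scheme \<Rightarrow> ('v \<Rightarrow> real) \<Rightarrow> (nat \<Rightarrow> 'v) \<Rightarrow> 'v \<Rightarrow> bool" where
  "norm_tendsto V \<nu> s l \<longleftrightarrow> l \<in> carrier V \<and> (\<lambda>n. \<nu> (s n \<ominus>\<^bsub>V\<^esub> l)) \<longlonglongrightarrow> 0"

definition norm_complete :: "('v, 'z) ring_scheme \<Rightarrow> ('v \<Rightarrow> real) \<Rightarrow> bool" where
  "norm_complete V \<nu> \<longleftrightarrow> (\<forall>s. norm_Cauchy V \<nu> s \<longrightarrow> (\<exists>l. norm_tendsto V \<nu> s l))"

definition norm_dense :: "('v, 'z) ring_scheme \<Rightarrow> ('v \<Rightarrow> real) \<Rightarrow> 'v set \<Rightarrow> bool" where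
  "norm_dense V \<nu> D \<longleftrightarrow> D \<subseteq> carrier V \<and>
     (\<forall>x\<in>carrier V. \<forall>\<epsilon>>0. \<exists>y\<in>D. \<nu> (x \<ominus>\<^bsub>V\<^esub> y) < \<epsilon>)"


section \<open>C*-algebras and completely positive maps\<close>

record 'a star_alg = "(complex, 'a) module" +
  star :: "'a \<Rightarrow> 'a"
  nrm :: "'a \<Rightarrow> real"

locale cstar_algebra =
  fixes A :: "('a, 'z) star_alg_scheme"
  assumes vector_space: "Module.module complex_ring A"
    and mult_closed: "\<lbrakk>a \<in> carrier A; b \<in> carrier A\<rbrakk> \<Longrightarrow> a \<otimes>\<^bsub>A\<^esub> b \<in> carrier A"
    and mult_assoc: "\<lbrakk>a \<in> carrier A; b \<in> carrier A; c \<in> carrier A\<rbrakk>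
      \<Longrightarrow> (a \<otimes>\<^bsub>A\<^esub> b) \<otimes>\<^bsub>A\<^esub> c = a \<otimes>\<^bsub>A\<^esub> (b \<otimes>\<^bsub>A\<^esub> c)"
    and mult_add_left: "\<lbrakk>a \<in> carrier A; b \<in> carrier A; c \<in> carrier A\<rbrakk>
      \<Longrightarrow> (a \<oplus>\<^bsub>A\<^esub> b) \<otimes>\<^bsub>A\<^esub> c = a \<otimes>\<^bsub>A\<^esub> c \<oplus>\<^bsub>A\<^esub> b \<otimes>\<^bsub>A\<^esub> c"
    and mult_add_right: "\<lbrakk>a \<in> carrier A; b \<in> carrier A; c \<in> carrier A\<rbrakk>
      \<Longrightarrow> a \<otimes>\<^bsub>A\<^esub> (b \<oplus>\<^bsub>A\<^esub> c) = a \<otimes>\<^bsub>A\<^esub> b \<oplus>\<^bsub>A\<^esub> a \<otimes>\<^bsub>A\<^esub> c"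
    and mult_smult_left: "\<lbrakk>a \<in> carrier A; b \<in> carrier A\<rbrakk>
      \<Longrightarrow> (z \<odot>\<^bsub>A\<^esub> a) \<otimes>\<^bsub>A\<^esub> b = z \<odot>\<^bsub>A\<^esub> (a \<otimes>\<^bsub>A\<^esub> b)"
    and mult_smult_right: "\<lbrakk>a \<in> carrier A; b \<in> carrier A\<rbrakk>
      \<Longrightarrow> a \<otimes>\<^bsub>A\<^esub> (z \<odot>\<^bsub>A\<^esub> b) = z \<odot>\<^bsub>A\<^esub> (a \<otimes>\<^bsub>A\<^esub> b)"
    and star_closed: "a \<in> carrier A \<Longrightarrow> star A a \<in> carrier A"
    and star_star: "a \<in> carrier A \<Longrightarrow> star A (star A a) = a"
    and star_add: "\<lbrakk>a \<in> carrier A; b \<in> carrier A\<rbrakk>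
      \<Longrightarrow> star A (a \<oplus>\<^bsub>A\<^esub> b) = star A a \<oplus>\<^bsub>A\<^esub> star A b"
    and star_smult: "a \<in> carrier A \<Longrightarrow> star A (z \<odot>\<^bsub>A\<^esub> a) = cnj z \<odot>\<^bsub>A\<^esub> star A a"
    and star_mult: "\<lbrakk>a \<in> carrier A; b \<in> carrier A\<rbrakk>
      \<Longrightarrow> star A (a \<otimes>\<^bsub>A\<^esub> b) = star A b \<otimes>\<^bsub>A\<^esub> star A a"
    and nrm_nonneg: "a \<in> carrier A \<Longrightarrow> 0 \<le> nrm A a"
    and nrm_eq_0: "a \<in> carrier A \<Longrightarrow> nrm A a = 0 \<longleftrightarrow> a = \<zero>\<^bsub>A\<^esub>"
    and nrm_add: "\<lbrakk>a \<in> carrier A; b \<in> carrier A\<rbrakk> \<Longrightarrow> nrm A (a \<oplus>\<^bsub>A\<^esub> b) \<le> nrm A a + nrm A b"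
    and nrm_smult: "a \<in> carrier A \<Longrightarrow> nrm A (z \<odot>\<^bsub>A\<^esub> a) = cmod z * nrm A a"
    and nrm_mult: "\<lbrakk>a \<in> carrier A; b \<in> carrier A\<rbrakk> \<Longrightarrow> nrm A (a \<otimes>\<^bsub>A\<^esub> b) \<le> nrm A a * nrm A b"
    and cstar_identity: "a \<in> carrier A \<Longrightarrow> nrm A (star A a \<otimes>\<^bsub>A\<^esub> a) = (nrm A a)\<^sup>2"
    and complete: "norm_complete A (nrm A)"

definition cstar_positive :: "('a, 'z) star_alg_scheme \<Rightarrow> 'a \<Rightarrow> bool" where
  "cstar_positive A a \<longleftrightarrow> (\<exists>b\<in>carrier A. a = star A b \<otimes>\<^bsub>A\<^esub> b)"

text \<open>Positivity of the matrix \<open>(a i j)\<close>, \<open>i, j < k\<close>, in the C*-algebra of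
  \<open>k \<times> k\<close> matrices over \<open>A\<close>, that is, \<open>a = b\<^sup>* b\<close> with
  \<open>(b\<^sup>*) i l = star A (b l i)\<close>.\<close>

definition matrix_positive ::
    "('a, 'z) star_alg_scheme \<Rightarrow> nat \<Rightarrow> (nat \<Rightarrow> nat \<Rightarrow> 'a) \<Rightarrow> bool" where
  "matrix_positive A k a \<longleftrightarrow>
    (\<exists>b. (\<forall>i<k. \<forall>j<k. b i j \<in> carrier A) \<and>
         (\<forall>i<k. \<forall>j<k. a i j = (\<Oplus>\<^bsub>A\<^esub> l \<in> {..<k}. star A (b l i) \<otimes>\<^bsub>A\<^esub> b l j)))"

definition completely_positive ::
    "('a, 'y) star_alg_scheme \<Rightarrow> ('b, 'z) star_alg_scheme \<Rightarrow> ('a \<Rightarrow> 'b) \<Rightarrow> bool" where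
  "completely_positive A B P \<longleftrightarrow>
     P \<in> carrier A \<rightarrow> carrier B \<and>
     (\<forall>a\<in>carrier A. \<forall>b\<in>carrier A. P (a \<oplus>\<^bsub>A\<^esub> b) = P a \<oplus>\<^bsub>B\<^esub> P b) \<and>
     (\<forall>z. \<forall>a\<in>carrier A. P (z \<odot>\<^bsub>A\<^esub> a) = z \<odot>\<^bsub>B\<^esub> P a) \<and>
     (\<forall>k a. matrix_positive A k a \<longrightarrow> matrix_positive B k (\<lambda>i j. P (a i j)))"


section \<open>C*-correspondences and equivalence bimodules\<close>

record ('b, 'x) hmod = "(complex, 'x) module" +
  ract :: "'x \<Rightarrow> 'b \<Rightarrow> 'x"
  rinner :: "'x \<Rightarrow> 'x \<Rightarrow> 'b"

record ('a, 'b, 'x) corr = "('b, 'x) hmod" +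
  lact :: "'a \<Rightarrow> 'x \<Rightarrow> 'x"

record ('a, 'b, 'x) eq_bimod = "('a, 'b, 'x) corr" +
  linner :: "'x \<Rightarrow> 'x \<Rightarrow> 'a"

definition hnorm :: "('b, 'y) star_alg_scheme \<Rightarrow> ('b, 'x, 'z) hmod_scheme \<Rightarrow> 'x \<Rightarrow> real" where
  "hnorm B E x = sqrt (nrm B (rinner E x x))"

locale hilbert_module =
  B: cstar_algebra B
  for B :: "('b, 'y) star_alg_scheme" +
  fixes E :: "('b, 'x, 'z) hmod_scheme"
  assumes vector_space: "Module.module complex_ring E"
    and ract_closed: "\<lbrakk>x \<in> carrier E; b \<in> carrier B\<rbrakk> \<Longrightarrow> ract E x b \<in> carrier E"
    and ract_add_left: "\<lbrakk>x \<in> carrier E; y \<in> carrier E; b \<in> carrier B\<rbrakk>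
      \<Longrightarrow> ract E (x \<oplus>\<^bsub>E\<^esub> y) b = ract E x b \<oplus>\<^bsub>E\<^esub> ract E y b"
    and ract_add_right: "\<lbrakk>x \<in> carrier E; b \<in> carrier B; c \<in> carrier B\<rbrakk>
      \<Longrightarrow> ract E x (b \<oplus>\<^bsub>B\<^esub> c) = ract E x b \<oplus>\<^bsub>E\<^esub> ract E x c"
    and ract_mult: "\<lbrakk>x \<in> carrier E; b \<in> carrier B; c \<in> carrier B\<rbrakk>
      \<Longrightarrow> ract E x (b \<otimes>\<^bsub>B\<^esub> c) = ract E (ract E x b) c"
    and ract_smult_left: "\<lbrakk>x \<in> carrier E; b \<in> carrier B\<rbrakk>
      \<Longrightarrow> ract E (z \<odot>\<^bsub>E\<^esub> x) b = z \<odot>\<^bsub>E\<^esub> ract E x b"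
    and ract_smult_right: "\<lbrakk>x \<in> carrier E; b \<in> carrier B\<rbrakk>
      \<Longrightarrow> ract E x (z \<odot>\<^bsub>B\<^esub> b) = z \<odot>\<^bsub>E\<^esub> ract E x b"
    and rinner_closed: "\<lbrakk>x \<in> carrier E; y \<in> carrier E\<rbrakk> \<Longrightarrow> rinner E x y \<in> carrier B"
    and rinner_add_right: "\<lbrakk>x \<in> carrier E; y \<in> carrier E; w \<in> carrier E\<rbrakk>
      \<Longrightarrow> rinner E x (y \<oplus>\<^bsub>E\<^esub> w) = rinner E x y \<oplus>\<^bsub>B\<^esub> rinner E x w"
    and rinner_smult_right: "\<lbrakk>x \<in> carrier E; y \<in> carrier E\<rbrakk>
      \<Longrightarrow> rinner E x (z \<odot>\<^bsub>E\<^esub> y) = z \<odot>\<^bsub>B\<^esub> rinner E x y"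
    and rinner_ract: "\<lbrakk>x \<in> carrier E; y \<in> carrier E; b \<in> carrier B\<rbrakk>
      \<Longrightarrow> rinner E x (ract E y b) = rinner E x y \<otimes>\<^bsub>B\<^esub> b"
    and rinner_star: "\<lbrakk>x \<in> carrier E; y \<in> carrier E\<rbrakk>
      \<Longrightarrow> star B (rinner E x y) = rinner E y x"
    and rinner_positive: "x \<in> carrier E \<Longrightarrow> cstar_positive B (rinner E x x)"
    and rinner_definite: "\<lbrakk>x \<in> carrier E; rinner E x x = \<zero>\<^bsub>B\<^esub>\<rbrakk> \<Longrightarrow> x = \<zero>\<^bsub>E\<^esub>"
    and complete: "norm_complete E (hnorm B E)"

definition is_adjoint :: "('b, 'x, 'z) hmod_scheme \<Rightarrow> ('x \<Rightarrow> 'x) \<Rightarrow> ('x \<Rightarrow> 'x) \<Rightarrow> bool" where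
  "is_adjoint E T S \<longleftrightarrow> T \<in> carrier E \<rightarrow> carrier E \<and> S \<in> carrier E \<rightarrow> carrier E \<and>
     (\<forall>x\<in>carrier E. \<forall>y\<in>carrier E. rinner E (T x) y = rinner E x (S y))"

text \<open>The assumptions on \<^const>\<open>lact\<close> say that \<open>a \<mapsto> lact E a\<close> is a
  *-homomorphism from \<open>A\<close> into the adjointable operators on \<open>E\<close>.\<close>

locale correspondence =
  A: cstar_algebra A + hilbert_module B E
  for A :: "('a, 'w) star_alg_scheme"
    and B :: "('b, 'y) star_alg_scheme"
    and E :: "('a, 'b, 'x, 'z) corr_scheme" +
  assumes lact_adjoint: "a \<in> carrier A \<Longrightarrow> is_adjoint E (lact E a) (lact E (star A a))"
    and lact_add: "\<lbrakk>a \<in> carrier A; b \<in> carrier A; x \<in> carrier E\<rbrakk>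
      \<Longrightarrow> lact E (a \<oplus>\<^bsub>A\<^esub> b) x = lact E a x \<oplus>\<^bsub>E\<^esub> lact E b x"
    and lact_smult: "\<lbrakk>a \<in> carrier A; x \<in> carrier E\<rbrakk>
      \<Longrightarrow> lact E (z \<odot>\<^bsub>A\<^esub> a) x = z \<odot>\<^bsub>E\<^esub> lact E a x"
    and lact_mult: "\<lbrakk>a \<in> carrier A; b \<in> carrier A; x \<in> carrier E\<rbrakk>
      \<Longrightarrow> lact E (a \<otimes>\<^bsub>A\<^esub> b) x = lact E a (lact E b x)"

locale equivalence_bimodule =
  correspondence A B X
  for A :: "('a, 'w) star_alg_scheme"
    and B :: "('b, 'y) star_alg_scheme"
    and X :: "('a, 'b, 'x, 'z) eq_bimod_scheme" +
  assumes linner_closed: "\<lbrakk>x \<in> carrier X; y \<in> carrier X\<rbrakk> \<Longrightarrow> linner X x y \<in> carrier A"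
    and linner_add_left: "\<lbrakk>x \<in> carrier X; y \<in> carrier X; w \<in> carrier X\<rbrakk>
      \<Longrightarrow> linner X (x \<oplus>\<^bsub>X\<^esub> y) w = linner X x w \<oplus>\<^bsub>A\<^esub> linner X y w"
    and linner_smult_left: "\<lbrakk>x \<in> carrier X; y \<in> carrier X\<rbrakk>
      \<Longrightarrow> linner X (z \<odot>\<^bsub>X\<^esub> x) y = z \<odot>\<^bsub>A\<^esub> linner X x y"
    and linner_lact: "\<lbrakk>x \<in> carrier X; y \<in> carrier X; a \<in> carrier A\<rbrakk>
      \<Longrightarrow> linner X (lact X a x) y = a \<otimes>\<^bsub>A\<^esub> linner X x y"
    and linner_star: "\<lbrakk>x \<in> carrier X; y \<in> carrier X\<rbrakk>
      \<Longrightarrow> star A (linner X x y) = linner X y x"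
    and linner_positive: "x \<in> carrier X \<Longrightarrow> cstar_positive A (linner X x x)"
    and linner_definite: "\<lbrakk>x \<in> carrier X; linner X x x = \<zero>\<^bsub>A\<^esub>\<rbrakk> \<Longrightarrow> x = \<zero>\<^bsub>X\<^esub>"
    and left_complete: "norm_complete X (\<lambda>x. sqrt (nrm A (linner X x x)))"
    and linner_ract: "\<lbrakk>x \<in> carrier X; y \<in> carrier X; b \<in> carrier B\<rbrakk>
      \<Longrightarrow> linner X (ract X x b) y = linner X x (ract X y (star B b))"
    and linner_rinner: "\<lbrakk>x \<in> carrier X; y \<in> carrier X; w \<in> carrier X\<rbrakk>
      \<Longrightarrow> lact X (linner X x y) w = ract X x (rinner X y w)"
    and left_full: "norm_dense A (nrm A)
      (lin_span A {linner X x y | x y. x \<in> carrier X \<and> y \<in> carrier X})"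
    and right_full: "norm_dense B (nrm B)
      (lin_span B {rinner X x y | x y. x \<in> carrier X \<and> y \<in> carrier X})"

definition corr_isomorphic ::
    "('a, 'w) star_alg_scheme \<Rightarrow> ('b, 'y) star_alg_scheme \<Rightarrow>
     ('a, 'b, 'e, 'u) corr_scheme \<Rightarrow> ('a, 'b, 'f, 'v) corr_scheme \<Rightarrow> bool" where
  "corr_isomorphic A B E F \<longleftrightarrow>
    (\<exists>\<phi>. bij_betw \<phi> (carrier E) (carrier F) \<and>
      (\<forall>x\<in>carrier E. \<forall>y\<in>carrier E. \<phi> (x \<oplus>\<^bsub>E\<^esub> y) = \<phi> x \<oplus>\<^bsub>F\<^esub> \<phi> y) \<and>
      (\<forall>z. \<forall>x\<in>carrier E. \<phi> (z \<odot>\<^bsub>E\<^esub> x) = z \<odot>\<^bsub>F\<^esub> \<phi> x) \<and>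
      (\<forall>a\<in>carrier A. \<forall>x\<in>carrier E. \<phi> (lact E a x) = lact F a (\<phi> x)) \<and>
      (\<forall>x\<in>carrier E. \<forall>b\<in>carrier B. \<phi> (ract E x b) = ract F (\<phi> x) b) \<and>
      (\<forall>x\<in>carrier E. \<forall>y\<in>carrier E. rinner F (\<phi> x) (\<phi> y) = rinner E x y))"


section \<open>Formal sums, separation and completion\<close>

text \<open>Finite formal complex combinations of elements of \<open>S\<close>, with the left and right actions
  \<open>l\<close> and \<open>r\<close> extended linearly and the \<open>B\<close>-valued kernel \<open>\<kappa>\<close> extended sesquilinearly.\<close>

definition formal_map :: "('s \<Rightarrow> 't) \<Rightarrow> ('s \<Rightarrow>\<^sub>0 complex) \<Rightarrow> ('t \<Rightarrow>\<^sub>0 complex)" where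
  "formal_map g v =
    (\<Sum>s\<in>Poly_Mapping.keys v. Poly_Mapping.single (g s) (Poly_Mapping.lookup v s))"

definition formal_sums ::
    "('b, 'y) star_alg_scheme \<Rightarrow> 's set \<Rightarrow> ('a \<Rightarrow> 's \<Rightarrow> 's) \<Rightarrow> ('s \<Rightarrow> 'b \<Rightarrow> 's) \<Rightarrow>
     ('s \<Rightarrow> 's \<Rightarrow> 'b) \<Rightarrow> ('a, 'b, 's \<Rightarrow>\<^sub>0 complex) corr" where
  "formal_sums B S l r \<kappa> =
    \<lparr>carrier = {v. Poly_Mapping.keys v \<subseteq> S},
     monoid.mult = undefined, one = undefined,
     ring.zero = 0, add = (+),
     smult = (\<lambda>z. Poly_Mapping.map ((*) z)),
     ract = (\<lambda>v b. formal_map (\<lambda>s. r s b) v),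
     rinner = (\<lambda>v w. \<Oplus>\<^bsub>B\<^esub> s \<in> Poly_Mapping.keys v. \<Oplus>\<^bsub>B\<^esub> t \<in> Poly_Mapping.keys w.
                 (cnj (Poly_Mapping.lookup v s) * Poly_Mapping.lookup w t) \<odot>\<^bsub>B\<^esub> \<kappa> s t),
     lact = (\<lambda>a. formal_map (l a))\<rparr>"

text \<open>The quotient by the vectors of length zero. The operations are computed on arbitrarily
  chosen representatives.\<close>

definition null_rel ::
    "('b, 'y) star_alg_scheme \<Rightarrow> ('b, 'x, 'z) hmod_scheme \<Rightarrow> ('x \<times> 'x) set" where
  "null_rel B E = {(x, y). x \<in> carrier E \<and> y \<in> carrier E \<and>
     rinner E (x \<ominus>\<^bsub>E\<^esub> y) (x \<ominus>\<^bsub>E\<^esub> y) = \<zero>\<^bsub>B\<^esub>}"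

definition rep :: "'x set \<Rightarrow> 'x" where
  "rep U = (SOME x. x \<in> U)"

definition mod_null ::
    "('b, 'y) star_alg_scheme \<Rightarrow> ('a, 'b, 'x) corr \<Rightarrow> ('a, 'b, 'x set) corr" where
  "mod_null B E =
    \<lparr>carrier = carrier E // null_rel B E,
     monoid.mult = undefined, one = undefined,
     ring.zero = null_rel B E `` {\<zero>\<^bsub>E\<^esub>},
     add = (\<lambda>U V. null_rel B E `` {rep U \<oplus>\<^bsub>E\<^esub> rep V}),
     smult = (\<lambda>z U. null_rel B E `` {z \<odot>\<^bsub>E\<^esub> rep U}),
     ract = (\<lambda>U b. null_rel B E `` {ract E (rep U) b}),
     rinner = (\<lambda>U V. rinner E (rep U) (rep V)),
     lact = (\<lambda>a U. null_rel B E `` {lact E a (rep U)})\<rparr>"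

definition cauchy_sequences ::
    "('b, 'y) star_alg_scheme \<Rightarrow> ('a, 'b, 'x) corr \<Rightarrow> ('a, 'b, nat \<Rightarrow> 'x) corr" where
  "cauchy_sequences B E =
    \<lparr>carrier = {s. norm_Cauchy E (hnorm B E) s},
     monoid.mult = undefined, one = undefined,
     ring.zero = (\<lambda>n. \<zero>\<^bsub>E\<^esub>),
     add = (\<lambda>s t n. s n \<oplus>\<^bsub>E\<^esub> t n),
     smult = (\<lambda>z s n. z \<odot>\<^bsub>E\<^esub> s n),
     ract = (\<lambda>s b n. ract E (s n) b),
     rinner = (\<lambda>s t. THE l. norm_tendsto B (nrm B) (\<lambda>n. rinner E (s n) (t n)) l),
     lact = (\<lambda>a s n. lact E a (s n))\<rparr>"

text \<open>The completion of \<open>E\<close> after dividing out the vectors of length zero.\<close>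

definition completion ::
    "('b, 'y) star_alg_scheme \<Rightarrow> ('a, 'b, 'x) corr \<Rightarrow> ('a, 'b, (nat \<Rightarrow> 'x) set) corr" where
  "completion B E = mod_null B (cauchy_sequences B E)"


section \<open>Interior tensor products and strong Morita equivalence\<close>

text \<open>The formal sum \<open>(x, f)\<close> is the elementary tensor \<open>x \<otimes> f\<close>. The formal sums
  expressing bilinearity and balancedness, such as \<open>(x \<cdot> b, f) - (x, b \<cdot> f)\<close>, have length
  zero, so passing to the separated completion also divides these relations out. Here \<open>C\<close> is
  the C*-algebra acting on \<open>F\<close> from the right.\<close>

definition interior_tensor ::
    "('c, 'y) star_alg_scheme \<Rightarrow> ('a, 'b, 'x, 'u) corr_scheme \<Rightarrow> ('b, 'c, 'f, 'v) corr_scheme \<Rightarrow>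
     ('a, 'c, (nat \<Rightarrow> ('x \<times> 'f \<Rightarrow>\<^sub>0 complex)) set) corr" where
  "interior_tensor C X F = completion C (formal_sums C (carrier X \<times> carrier F)
     (\<lambda>a (x, f). (lact X a x, f))
     (\<lambda>(x, f) c. (x, ract F f c))
     (\<lambda>(x, f) (x', f'). rinner F f (lact F (rinner X x x') f')))"

text \<open>HOL cannot quantify over the type underlying the bimodule \<open>X\<close>, so this type is an
  argument. The relation at any one type implies strong Morita equivalence, since it
  provides an equivalence bimodule \<open>X\<close>.\<close>

definition strongly_morita_equivalent ::
    "'x itself \<Rightarrow> ('a, 'w) star_alg_scheme \<Rightarrow> ('a, 'a, 'e, 'u) corr_scheme \<Rightarrow>
     ('b, 'y) star_alg_scheme \<Rightarrow> ('b, 'b, 'f, 'v) corr_scheme \<Rightarrow> bool" where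
  "strongly_morita_equivalent _ A E B F \<longleftrightarrow>
     correspondence A A E \<and> correspondence B B F \<and>
     (\<exists>X :: ('a, 'b, 'x) eq_bimod. equivalence_bimodule A B X \<and>
        corr_isomorphic A B (interior_tensor B X F) (interior_tensor B E X))"


section \<open>GNS-correspondence and index\<close>

text \<open>As for \<^const>\<open>interior_tensor\<close>, the formal sums expressing bilinearity of \<open>\<otimes>\<close> have
  length zero.\<close>

definition gns_correspondence ::
    "('a, 'z) star_alg_scheme \<Rightarrow> ('a \<Rightarrow> 'a) \<Rightarrow> ('a, 'a, ('a \<times> 'a \<Rightarrow>\<^sub>0 complex) set) corr" where
  "gns_correspondence A P = mod_null A (formal_sums A (carrier A \<times> carrier A)
     (\<lambda>c (a, b). (c \<otimes>\<^bsub>A\<^esub> a, b))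
     (\<lambda>(a, b) d. (a, b \<otimes>\<^bsub>A\<^esub> d))
     (\<lambda>(a1, b1) (a2, b2). star A b1 \<otimes>\<^bsub>A\<^esub> P (star A a1 \<otimes>\<^bsub>A\<^esub> a2) \<otimes>\<^bsub>A\<^esub> b2))"

definition cmat_scale :: "complex \<Rightarrow> complex^'n^'n \<Rightarrow> complex^'n^'n" where
  "cmat_scale z a = (\<chi> i j. z * a $ i $ j)"

definition cmat_adjoint :: "complex^'n^'n \<Rightarrow> complex^'n^'n" where
  "cmat_adjoint a = (\<chi> i j. cnj (a $ j $ i))"

definition matrix_algebra :: "(complex^'n^'n) star_alg" where
  "matrix_algebra =
    \<lparr>carrier = UNIV, monoid.mult = (**), one = mat 1, ring.zero = 0, add = (+),
     smult = cmat_scale, star = cmat_adjoint, nrm = (\<lambda>a. onorm ((*v) a))\<rparr>"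

interpretation cmat: vector_space cmat_scale
  by unfold_locales (simp_all add: cmat_scale_def vec_eq_iff algebra_simps)

definition kraus_decomposition ::
    "(complex^'n^'n \<Rightarrow> complex^'n^'n) \<Rightarrow> nat \<Rightarrow> (nat \<Rightarrow> complex^'n^'n) \<Rightarrow> bool" where
  "kraus_decomposition P N t \<longleftrightarrow> (\<forall>a. P a = (\<Sum>r<N. t r ** a ** cmat_adjoint (t r)))"

definition cp_index :: "(complex^'n^'n \<Rightarrow> complex^'n^'n) \<Rightarrow> nat" where
  "cp_index P = (THE d. \<exists>N t. kraus_decomposition P N t \<and> d = cmat.dim (cmat.span (t ` {..<N})))"

definition complex_algebra :: "complex star_alg" where
  "complex_algebra =
    \<lparr>carrier = UNIV, monoid.mult = (*), one = 1, ring.zero = 0, add = (+),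
     smult = (*), star = cnj, nrm = cmod\<rparr>"

text \<open>The Hilbert space \<open>\<complex>\<^sup>d\<close>, as the sequences vanishing from index \<open>d\<close> on.\<close>

definition hilbert_space :: "nat \<Rightarrow> (complex, complex, nat \<Rightarrow> complex) corr" where
  "hilbert_space d =
    \<lparr>carrier = {v. \<forall>i\<ge>d. v i = 0},
     monoid.mult = undefined, one = undefined,
     ring.zero = (\<lambda>i. 0), add = (\<lambda>v w i. v i + w i),
     smult = (\<lambda>z v i. z * v i),
     ract = (\<lambda>v z i. v i * z),
     rinner = (\<lambda>v w. \<Sum>i<d. cnj (v i) * w i),
     lact = (\<lambda>z v i. z * v i)\<rparr>"

end

theory Submission
  imports Defs
begin

text \<open>Choose a Kraus decomposition \<open>P a = (\<Sum>r<d. t r ** a ** cmat_adjoint (t r))\<close> with linearly independent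
  \<open>t r\<close>. Two Kraus families of the same map have the same span, so \<open>d\<close> is the index. The map
  \<open>a \<otimes> b \<mapsto> (a (t r)\<^sup>* b)\<^sub>r\<close> preserves inner products, and independence of the \<open>t r\<close> makes it onto the \<open>d\<close>-fold
  direct sum of the matrix algebra, so \<open>E\<^sub>P\<close> is this direct sum. With \<open>X\<close> the column vectors as an equivalence
  bimodule, both \<open>X \<otimes> \<complex>\<^sup>d\<close> and \<open>E\<^sub>P \<otimes> X\<close> are identified with the \<open>d\<close>-fold direct sum of \<open>X\<close>, via
  \<open>x \<otimes> f \<mapsto> (f r x)\<^sub>r\<close> and \<open>e \<otimes> x \<mapsto> (e r x)\<^sub>r\<close>.\<close>

section \<open>Gram matrices and linear independence\<close>

text \<open>Gram matrices carry both finite-dimensional steps. Kraus families of \<open>P\<close>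
  are the factorisations of its Choi matrix as a Gram matrix, and an independent one is reached by
  absorbing one dependent vector at a time into the others, an explicit rank-one update in place of
  a spectral decomposition. The same reduction has a second use: positivity in a matrix algebra asks
  for one square factor, so a sum of two positive elements must be compressed to at most
  \<open>CARD('n)\<close> rows before direct sums of Hilbert modules can be formed.

  The correspondences in the statement are quotients and completions whose operations go through
  arbitrary representatives, so their axioms are not checked on them directly. Each is compared with
  a concrete correspondence through a linear surjection that preserves inner products, and the
  axioms are carried back along the induced bijection. The concrete targets are finite-dimensional,
  hence complete, and are already exhausted by the formal sums; therefore completing adds nothing
  new.\<close>

definition indep_family :: "'r set \<Rightarrow> ('r \<Rightarrow> 'i \<Rightarrow> complex) \<Rightarrow> bool" where
  "indep_family R v \<longleftrightarrow> (\<forall>c. (\<forall>i. (\<Sum>r\<in>R. c r * v r i) = 0) \<longrightarrow> (\<forall>r\<in>R. c r = 0))"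

text \<open>Moving every \<open>v r\<close> by a suitable multiple of \<open>w\<close> changes the
  Gram sum by exactly the term of \<open>w\<close>. Applied with \<open>w\<close> a dependent member
  of a larger family, this shortens the family by one without changing its Gram matrix.\<close>

lemma gram_remove:
  fixes v :: "'r \<Rightarrow> 'i \<Rightarrow> complex"
  assumes w: "\<And>i. w i = (\<Sum>r\<in>R. d r * v r i)"
  shows "\<exists>v'. \<forall>i j. (\<Sum>r\<in>R. v' r i * cnj (v' r j)) = (\<Sum>r\<in>R. v r i * cnj (v r j)) + w i * cnj (w j)"
proof -
  define D :: real where "D = (\<Sum>r\<in>R. (cmod (d r))\<^sup>2)"
  have D0: "D \<ge> 0" unfolding D_def by (simp add: sum_nonneg)
  define s where "s = sqrt (1 + D)"
  \<comment> \<open>\<open>m\<close> is the nonnegative solution of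
    \<open>D * x^2 + 2 * x = 1\<close>, written in the form that also covers
    \<open>D = 0\<close>.\<close>
  define m where "m = 1 / (1 + s)"
  have "s\<^sup>2 = 1 + D" using D0 unfolding s_def by (intro real_sqrt_pow2) linarith
  hence s: "D = s\<^sup>2 - 1" by linarith
  have "s \<ge> 0" unfolding s_def using D0 by (intro real_sqrt_ge_zero) linarith
  hence "1 + s \<noteq> 0" by linarith
  hence m1: "m * (1 + s) = 1" unfolding m_def by simp
  have "2 * m + m\<^sup>2 * D = 2 * m + (m * (1 + s)) * (m * (s - 1))"
    by (simp add: s power2_eq_square algebra_simps)
  also have "\<dots> = m + m * s" by (simp only: m1) (simp add: algebra_simps)
  finally have m: "2 * m + m\<^sup>2 * D = 1" using m1 by (simp add: algebra_simps)
  have mc: "2 * complex_of_real m + (complex_of_real m)\<^sup>2 * complex_of_real D = 1"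
    using arg_cong[OF m, of complex_of_real] by simp
  \<comment> \<open>The cross terms of \<open>v'\<close> contribute \<open>2 * m + m\<^sup>2 * D = 1\<close> copies of \<open>w i * cnj (w j)\<close>.\<close>
  define v' where "v' r i = v r i + of_real m * cnj (d r) * w i" for r i
  have "(\<Sum>r\<in>R. v' r i * cnj (v' r j)) = (\<Sum>r\<in>R. v r i * cnj (v r j)) + w i * cnj (w j)" for i j
  proof -
    have Dc: "complex_of_real D = (\<Sum>r\<in>R. d r * cnj (d r))"
      by (simp only: D_def of_real_sum complex_norm_square)
    have "(\<Sum>r\<in>R. v' r i * cnj (v' r j)) = (\<Sum>r\<in>R. v r i * cnj (v r j)
        + of_real m * ((d r * v r i) * cnj (w j)) + of_real m * (w i * cnj (d r * v r j))
        + (of_real m)\<^sup>2 * (w i * cnj (w j)) * (d r * cnj (d r)))"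
      unfolding v'_def by (rule sum.cong) (simp_all add: algebra_simps power2_eq_square)
    also have "\<dots> = (\<Sum>r\<in>R. v r i * cnj (v r j))
        + of_real m * (w i * cnj (w j)) + of_real m * (w i * cnj (w j))
        + (of_real m)\<^sup>2 * (w i * cnj (w j)) * of_real D"
      by (simp only: Dc sum.distrib sum_distrib_left[symmetric] sum_distrib_right[symmetric]
          w[symmetric] cnj_sum[symmetric])
    also have "\<dots> = (\<Sum>r\<in>R. v r i * cnj (v r j)) + (2 * of_real m + (of_real m)\<^sup>2 * of_real D) * (w i * cnj (w j))"
      by (simp add: algebra_simps)
    finally show ?thesis using mc by simp
  qed
  thus ?thesis by blast
qed

text \<open>Every dependence relation lets one member be dropped by \<open>gram_remove\<close>, so
  induction on the number of members ends at an independent family. It is numbered by an initial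
  segment of the naturals because for Kraus families its length becomes the index.\<close>

lemma gram_indep_family:
  fixes v :: "'r \<Rightarrow> 'i \<Rightarrow> complex"
  assumes "finite R"
  shows "\<exists>(N::nat) w. indep_family {..<N} w \<and>
    (\<forall>i j. (\<Sum>r<N. w r i * cnj (w r j)) = (\<Sum>r\<in>R. v r i * cnj (v r j)))"
  using assms
proof (induction "card R" arbitrary: R v)
  case 0
  hence "R = {}" by simp
  thus ?case by (intro exI[of _ 0]) (simp add: indep_family_def)
next
  case (Suc k)
  show ?case
  proof (cases "indep_family R v")
    case True
    obtain h where h: "bij_betw h {..<card R} R"
      using ex_bij_betw_nat_finite[OF Suc.prems] by (auto simp: atLeast0LessThan)
    have "indep_family {..<card R} (\<lambda>r. v (h r))"
      unfolding indep_family_def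
    proof (intro allI impI ballI)
      fix c :: "nat \<Rightarrow> complex" and r assume c: "\<forall>i. (\<Sum>r<card R. c r * v (h r) i) = 0" and r: "r \<in> {..<card R}"
      define g where "g = the_inv_into {..<card R} h"
      have g: "g (h s) = s" if "s < card R" for s
        using h that by (simp add: g_def the_inv_into_f_f bij_betw_def)
      have "(\<Sum>r\<in>R. c (g r) * v r i) = 0" for i
      proof -
        have "(\<Sum>r\<in>R. c (g r) * v r i) = (\<Sum>r<card R. c (g (h r)) * v (h r) i)"
          by (rule sum.reindex_bij_betw[OF h, symmetric])
        also have "\<dots> = 0" using c g by simp
        finally show ?thesis .
      qed
      hence "\<forall>r\<in>R. c (g r) = 0" using True[unfolded indep_family_def, THEN spec, of "\<lambda>r. c (g r)"] by simp
      moreover have "h r \<in> R" using h r by (auto simp: bij_betw_def)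
      ultimately show "c r = 0" using g r by force
    qed
    moreover have "(\<Sum>r<card R. v (h r) i * cnj (v (h r) j)) = (\<Sum>r\<in>R. v r i * cnj (v r j))" for i j
      by (rule sum.reindex_bij_betw[OF h])
    ultimately show ?thesis by blast
  next
    case False
    then obtain c r0 where c: "\<And>i. (\<Sum>r\<in>R. c r * v r i) = 0" and r0: "r0 \<in> R" "c r0 \<noteq> 0"
      unfolding indep_family_def by blast
    have "v r0 i = (\<Sum>r\<in>R - {r0}. (- c r / c r0) * v r i)" for i
    proof -
      have "c r0 * v r0 i + (\<Sum>r\<in>R - {r0}. c r * v r i) = 0"
        using c[of i] sum.remove[OF Suc.prems r0(1), of "\<lambda>r. c r * v r i"] by simp
      hence "v r0 i = - (\<Sum>r\<in>R - {r0}. c r * v r i) / c r0"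
        using r0(2) by (simp add: field_simps eq_neg_iff_add_eq_0)
      also have "\<dots> = (\<Sum>r\<in>R - {r0}. (- c r / c r0) * v r i)"
        by (simp add: sum_divide_distrib sum_negf)
      finally show ?thesis .
    qed
    from gram_remove[where w = "v r0" and v = v, OF this] obtain v' where
      v': "\<And>i j. (\<Sum>r\<in>R - {r0}. v' r i * cnj (v' r j)) = (\<Sum>r\<in>R - {r0}. v r i * cnj (v r j)) + v r0 i * cnj (v r0 j)"
      by blast
    hence v'': "(\<Sum>r\<in>R - {r0}. v' r i * cnj (v' r j)) = (\<Sum>r\<in>R. v r i * cnj (v r j))" for i j
      using sum.remove[OF Suc.prems r0(1), of "\<lambda>r. v r i * cnj (v r j)"] by simp
    have "k = card (R - {r0})" "finite (R - {r0})" using Suc.hyps Suc.prems r0 by auto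
    from Suc.hyps(1)[OF this, of v'] show ?thesis using v'' by simp
  qed
qed

text \<open>The bound makes an independent family fit into the rows of one square matrix, which is
  needed in \<open>cmat_positive_add\<close>.\<close>

lemma indep_family_card_le:
  fixes w :: "nat \<Rightarrow> 'n::finite \<Rightarrow> complex"
  assumes "indep_family {..<N} w"
  shows "N \<le> CARD('n)"
proof -
  define u :: "nat \<Rightarrow> complex^'n" where "u r = (\<chi> i. w r i)" for r
  have indep: "\<forall>r<N. c r = 0" if "(\<Sum>r<N. c r *s u r) = 0" for c
  proof -
    have "(\<Sum>r<N. c r * w r i) = 0" for i
      using arg_cong[OF that, of "\<lambda>x. x $ i"] by (simp add: u_def)
    thus ?thesis using assms unfolding indep_family_def by blast
  qed
  have inj: "inj_on u {..<N}"
  proof (rule inj_onI, rule ccontr)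
    fix r s assume rs: "r \<in> {..<N}" "s \<in> {..<N}" "u r = u s" "r \<noteq> s"
    define c :: "nat \<Rightarrow> complex" where "c q = (if q = r then 1 else if q = s then -1 else 0)" for q
    have "(\<Sum>q<N. c q *s u q) = (\<Sum>q\<in>{r,s}. c q *s u q)"
      by (rule sum.mono_neutral_right) (use rs in \<open>auto simp: c_def\<close>)
    also have "\<dots> = 0" using rs by (simp add: c_def)
    finally show False using indep[of c] rs by (auto simp: c_def)
  qed
  have "vec.independent (u ` {..<N})"
  proof (rule vec.independent_if_scalars_zero)
    fix f x assume f: "(\<Sum>x\<in>u ` {..<N}. f x *s x) = 0" and x: "x \<in> u ` {..<N}"
    have "(\<Sum>r<N. f (u r) *s u r) = 0" using f by (simp add: sum.reindex[OF inj])
    from indep[OF this] x show "f x = 0" by auto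
  qed simp
  hence "card (u ` {..<N}) \<le> vec.dim (u ` {..<N})" using vec.independent_bound_general by blast
  also have "\<dots> \<le> CARD('n)" by (rule dim_subset_UNIV_cart_gen)
  finally show ?thesis by (simp add: card_image[OF inj])
qed

section \<open>Matrix units and linear functionals on matrices\<close>

definition cmat_unit :: "'n \<Rightarrow> 'n \<Rightarrow> complex^'n^'n" where
  "cmat_unit p q = (\<chi> i j. if i = p \<and> j = q then 1 else 0)"

lemma cmat_unit_nth [simp]: "cmat_unit p q $ i $ j = (if i = p \<and> j = q then 1 else 0)"
  by (simp add: cmat_unit_def)

lemma cmat_adjoint_nth [simp]: "cmat_adjoint a $ i $ j = cnj (a $ j $ i)"
  by (simp add: cmat_adjoint_def)

lemma cmat_scale_nth [simp]: "cmat_scale z a $ i $ j = z * a $ i $ j"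
  by (simp add: cmat_scale_def)

lemma cmat_expand: "a = (\<Sum>p\<in>UNIV. \<Sum>q\<in>UNIV. cmat_scale (a $ p $ q) (cmat_unit p q))"
  for a :: "complex^'n^'n"
proof -
  have "(\<Sum>p\<in>UNIV. \<Sum>q\<in>UNIV. cmat_scale (a $ p $ q) (cmat_unit p q)) $ i $ j = a $ i $ j" for i j
  proof -
    have "(\<Sum>q\<in>UNIV. if i = p \<and> j = q then a $ p $ q else 0) = (if i = p then a $ p $ j else 0)" for p
      by (cases "i = p") auto
    moreover have "(\<Sum>p\<in>UNIV. \<Sum>q\<in>UNIV. cmat_scale (a $ p $ q) (cmat_unit p q)) $ i $ j
      = (\<Sum>p\<in>UNIV. \<Sum>q\<in>UNIV. if i = p \<and> j = q then a $ p $ q else 0)"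
      by (simp add: if_distrib cong: if_cong)
    ultimately show ?thesis by simp
  qed
  thus ?thesis by (simp add: vec_eq_iff)
qed

interpretation cmat: vector_space_pair cmat_scale "(*) :: complex \<Rightarrow> complex \<Rightarrow> complex" ..

lemma cmat_functional:
  fixes g :: "complex^'n^'n \<Rightarrow> complex"
  assumes "Vector_Spaces.linear cmat_scale (*) g"
  shows "g a = (\<Sum>p\<in>UNIV. \<Sum>q\<in>UNIV. g (cmat_unit p q) * a $ p $ q)"
proof -
  interpret g: Vector_Spaces.linear cmat_scale "(*)" g by fact
  have "g a = g (\<Sum>p\<in>UNIV. \<Sum>q\<in>UNIV. cmat_scale (a $ p $ q) (cmat_unit p q))"
    using cmat_expand[of a] by simp
  thus ?thesis by (simp add: g.sum g.scale mult.commute)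
qed

text \<open>Double annihilator: a vector outside the span is separated from it by the functional
  with value 1 at \<open>x\<close> and 0 on a basis of the span. Functionals are spelled out by
  coefficients \<open>c p q\<close>, the form in which they can be paired with the Choi
  matrix.\<close>

lemma cmat_functional_in_span:
  fixes x :: "complex^'n^'n"
  assumes "\<And>c. (\<And>s. s \<in> S \<Longrightarrow> (\<Sum>p\<in>UNIV. \<Sum>q\<in>UNIV. c p q * s $ p $ q) = 0) \<Longrightarrow>
      (\<Sum>p\<in>UNIV. \<Sum>q\<in>UNIV. c p q * x $ p $ q) = 0"
  shows "x \<in> cmat.span S"
proof (rule ccontr)
  assume x: "x \<notin> cmat.span S"
  obtain B where B: "B \<subseteq> S" "cmat.independent B" "S \<subseteq> cmat.span B"
    using cmat.maximal_independent_subset by blast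
  have "x \<notin> cmat.span B" using x B(1) cmat.span_mono by blast
  hence "cmat.independent (insert x B)" using B(2) by (simp add: cmat.independent_insert)
  from cmat.linear_independent_extend[OF this, of "\<lambda>y. if y = x then 1 else 0"]
  obtain g where g: "Vector_Spaces.linear cmat_scale (*) g" "\<And>y. y \<in> insert x B \<Longrightarrow> g y = (if y = x then 1 else 0)"
    by blast
  interpret g: Vector_Spaces.linear cmat_scale "(*)" g by (rule g(1))
  have "g y = 0" if "y \<in> B" for y
    using g(2)[of y] that \<open>x \<notin> cmat.span B\<close> cmat.span_base by auto
  hence "g s = 0" if "s \<in> S" for s
    using g.eq_0_on_span[of B s] B(3) that by blast
  hence "(\<Sum>p\<in>UNIV. \<Sum>q\<in>UNIV. g (cmat_unit p q) * x $ p $ q) = 0"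
    by (intro assms) (simp flip: cmat_functional[OF g(1)])
  thus False using g(2)[of x] by (simp flip: cmat_functional[OF g(1)])
qed

section \<open>Kraus decompositions and the index\<close>

lemma finsum_plus:
  fixes f :: "'i \<Rightarrow> 'v::ab_group_add"
  assumes "abelian_monoid G" "carrier G = UNIV" "\<zero>\<^bsub>G\<^esub> = 0" "add G = (+)"
  shows "finsum G f I = sum f I"
proof (cases "finite I")
  case True
  interpret abelian_monoid G by fact
  from True show ?thesis
    by (induction I rule: finite_induct) (simp_all add: assms)
next
  case False
  \<comment> \<open>Over an infinite index set both sums take the default value zero.\<close>
  thus ?thesis by (simp add: finsum_def finprod_def assms)
qed

lemma abelian_group_plus:
  fixes G :: "('v::ab_group_add, 'z) ring_scheme"
  assumes "carrier G = UNIV" "\<zero>\<^bsub>G\<^esub> = 0" "add G = (+)"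
  shows "abelian_group G"
proof (rule abelian_groupI)
  fix x :: 'v
  show "\<exists>y\<in>carrier G. y \<oplus>\<^bsub>G\<^esub> x = \<zero>\<^bsub>G\<^esub>"
    by (rule bexI[of _ "- x"]) (simp_all add: assms)
qed (simp_all add: assms algebra_simps)

lemma matrix_algebra_simps [simp]:
  "carrier matrix_algebra = UNIV" "monoid.mult matrix_algebra = (**)"
  "\<zero>\<^bsub>matrix_algebra\<^esub> = 0" "add matrix_algebra = (+)" "smult matrix_algebra = cmat_scale"
  "star matrix_algebra = cmat_adjoint" "nrm matrix_algebra = (\<lambda>a. onorm ((*v) a))"
  by (simp_all add: matrix_algebra_def)

lemma abelian_group_matrix_algebra: "abelian_group matrix_algebra"
  by (rule abelian_group_plus) simp_all

lemma finsum_matrix_algebra [simp]: "finsum matrix_algebra f I = sum f I"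
  by (rule finsum_plus) (simp_all add: abelian_group.axioms abelian_group_matrix_algebra)

lemma kraus_term_nth:
  "(t ** a ** cmat_adjoint t) $ p $ p' = (\<Sum>q\<in>UNIV. \<Sum>q'\<in>UNIV. a $ q $ q' * (t $ p $ q * cnj (t $ p' $ q')))"
proof -
  have "(t ** a ** cmat_adjoint t) $ p $ p' = (\<Sum>q'\<in>UNIV. \<Sum>q\<in>UNIV. a $ q $ q' * (t $ p $ q * cnj (t $ p' $ q')))"
    by (simp add: matrix_matrix_mult_def sum_distrib_left sum_distrib_right mult_ac)
  thus ?thesis by (subst sum.swap)
qed

lemma sum_nth: "(\<Sum>x\<in>I. f x) $ i $ j = (\<Sum>x\<in>I. f x $ i $ j)"
  by simp

lemma sum_unit_entries:
  fixes f :: "'n::finite \<Rightarrow> 'm::finite \<Rightarrow> complex"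
  shows "(\<Sum>i\<in>UNIV. \<Sum>j\<in>UNIV. (if i = q \<and> j = q' then 1 else 0) * f i j) = f q q'"
proof -
  have "(\<Sum>j\<in>UNIV. (if i = q \<and> j = q' then 1 else 0) * f i j) = (if i = q then f i q' else 0)" for i
    by (cases "i = q") (simp_all add: mult_delta_left)
  thus ?thesis by simp
qed

text \<open>The numbers \<open>P (cmat_unit q q') $ p $ p'\<close>, indexed by the pairs
  \<open>(p, q)\<close> and \<open>(p', q')\<close>, form the Choi matrix of \<open>P\<close>; a
  Kraus family writes it as the Gram matrix of the entry vectors of its members.\<close>

lemma kraus_decomposition_unit:
  assumes "kraus_decomposition P N t"
  shows "P (cmat_unit q q') $ p $ p' = (\<Sum>r<N. t r $ p $ q * cnj (t r $ p' $ q'))"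
proof -
  have "P (cmat_unit q q') $ p $ p' = (\<Sum>r<N. \<Sum>i\<in>UNIV. \<Sum>j\<in>UNIV.
      (if i = q \<and> j = q' then 1 else 0) * (t r $ p $ i * cnj (t r $ p' $ j)))"
    using assms by (simp only: kraus_decomposition_def sum_nth kraus_term_nth cmat_unit_nth)
  also have "\<dots> = (\<Sum>r<N. t r $ p $ q * cnj (t r $ p' $ q'))" by (simp only: sum_unit_entries)
  finally show ?thesis .
qed

text \<open>Converse of \<open>kraus_decomposition_unit\<close>: a linear map is determined by its
  values on matrix units, so every Gram factorisation of the Choi matrix yields a Kraus
  decomposition.\<close>

lemma kraus_decompositionI:
  fixes P :: "complex^'n^'n \<Rightarrow> complex^'n^'n"
  assumes add: "\<And>a b. P (a + b) = P a + P b" and scale: "\<And>z a. P (cmat_scale z a) = cmat_scale z (P a)"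
    and unit: "\<And>p p' q q'. P (cmat_unit q q') $ p $ p' = (\<Sum>r<N. t r $ p $ q * cnj (t r $ p' $ q'))"
  shows "kraus_decomposition P N t"
  unfolding kraus_decomposition_def
proof
  fix a
  interpret P: Vector_Spaces.linear cmat_scale cmat_scale P
    by unfold_locales (simp_all add: add scale)
  have "P a = P (\<Sum>q\<in>UNIV. \<Sum>q'\<in>UNIV. cmat_scale (a $ q $ q') (cmat_unit q q'))"
    using cmat_expand[of a] by simp
  hence Pa: "P a = (\<Sum>q\<in>UNIV. \<Sum>q'\<in>UNIV. cmat_scale (a $ q $ q') (P (cmat_unit q q')))"
    by (simp add: P.sum P.scale)
  have "P a $ p $ p' = (\<Sum>r<N. t r ** a ** cmat_adjoint (t r)) $ p $ p'" for p p'
  proof -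
    have "P a $ p $ p' = (\<Sum>q\<in>UNIV. \<Sum>q'\<in>UNIV. \<Sum>r<N. a $ q $ q' * (t r $ p $ q * cnj (t r $ p' $ q')))"
      unfolding Pa by (simp add: unit sum_distrib_left)
    also have "\<dots> = (\<Sum>q\<in>UNIV. \<Sum>r<N. \<Sum>q'\<in>UNIV. a $ q $ q' * (t r $ p $ q * cnj (t r $ p' $ q')))"
      by (intro sum.cong refl sum.swap)
    also have "\<dots> = (\<Sum>r<N. \<Sum>q\<in>UNIV. \<Sum>q'\<in>UNIV. a $ q $ q' * (t r $ p $ q * cnj (t r $ p' $ q')))"
      by (rule sum.swap)
    finally show ?thesis by (simp only: sum_nth kraus_term_nth)
  qed
  thus "P a = (\<Sum>r<N. t r ** a ** cmat_adjoint (t r))" by (simp add: vec_eq_iff)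
qed

text \<open>Flattening matrices to vectors indexed by pairs makes \<open>indep_family\<close> and
  the Gram lemmas applicable to Kraus operators.\<close>

definition cmat_entries :: "complex^'n^'n \<Rightarrow> 'n \<times> 'n \<Rightarrow> complex" where
  "cmat_entries a = (\<lambda>(p, q). a $ p $ q)"

text \<open>Complete positivity is used only for the positive matrix of matrix units, which gives the
  Choi matrix of \<open>P\<close>.\<close>

lemma indep_kraus_decomposition_exists:
  fixes P :: "complex^'n^'n \<Rightarrow> complex^'n^'n"
  assumes "completely_positive matrix_algebra matrix_algebra P"
  shows "\<exists>N t. kraus_decomposition P N t \<and> indep_family {..<N} (\<lambda>r. cmat_entries (t r))"
proof -
  have add: "P (a + b) = P a + P b" and scale: "P (cmat_scale z a) = cmat_scale z (P a)"
    and pos: "matrix_positive matrix_algebra k m \<Longrightarrow> matrix_positive matrix_algebra k (\<lambda>i j. P (m i j))" for a b z k m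
    using assms unfolding completely_positive_def by auto
  define n where "n = CARD('n)"
  obtain h :: "nat \<Rightarrow> 'n" where h: "bij_betw h {..<n} UNIV"
    using ex_bij_betw_nat_finite[of "UNIV :: 'n set"] by (auto simp: atLeast0LessThan n_def)
  define g where "g = the_inv_into {..<n} h"
  have g: "g q < n" "h (g q) = q" for q
    using h the_inv_into_into[of h "{..<n}" q "{..<n}"] f_the_inv_into_f[of h "{..<n}" q]
    by (auto simp: bij_betw_def g_def)
  have "n > 0" by (simp add: n_def)
  have "matrix_positive matrix_algebra n (\<lambda>i j. cmat_unit (h i) (h j))"
    unfolding matrix_positive_def
  proof (intro exI conjI allI impI)
    fix i j
    \<comment> \<open>Block row \<open>0\<close> of the factor consists of the units
      \<open>cmat_unit (h 0) (h j)\<close> and the other block rows vanish; the adjoint of the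
      \<open>i\<close>-th unit times the \<open>j\<close>-th one is
      \<open>cmat_unit (h i) (h j)\<close>.\<close>
    let ?b = "\<lambda>l j. if l = 0 then cmat_unit (h 0) (h j) else 0 :: complex^'n^'n"
    have "(\<Oplus>\<^bsub>matrix_algebra\<^esub> l \<in> {..<n}. star matrix_algebra (?b l i) \<otimes>\<^bsub>matrix_algebra\<^esub> ?b l j)
      = (\<Sum>l<n. if l = 0 then cmat_adjoint (cmat_unit (h 0) (h i)) ** cmat_unit (h 0) (h j) else 0)"
      unfolding finsum_matrix_algebra matrix_algebra_simps
      by (rule sum.cong) (auto simp: cmat_adjoint_def matrix_matrix_mult_def vec_eq_iff)
    also have "\<dots> = cmat_adjoint (cmat_unit (h 0) (h i)) ** cmat_unit (h 0) (h j)"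
      using \<open>n > 0\<close> by simp
    also have "\<dots> = cmat_unit (h i) (h j)"
    proof -
      have "(\<Sum>k\<in>UNIV. cnj (cmat_unit (h 0) (h i) $ k $ p) * cmat_unit (h 0) (h j) $ k $ q)
        = (\<Sum>k\<in>UNIV. if k = h 0 then (if p = h i \<and> q = h j then 1 else 0) else 0)" for p q
        by (intro sum.cong) auto
      thus ?thesis by (simp add: vec_eq_iff matrix_matrix_mult_def del: cmat_unit_nth) simp
    qed
    finally show "cmat_unit (h i) (h j) = (\<Oplus>\<^bsub>matrix_algebra\<^esub> l \<in> {..<n}.
        star matrix_algebra (?b l i) \<otimes>\<^bsub>matrix_algebra\<^esub> ?b l j)" by simp
  qed simp
  from pos[OF this] obtain b where b: "\<And>i j. i < n \<Longrightarrow> j < n \<Longrightarrow>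
      P (cmat_unit (h i) (h j)) = (\<Sum>l<n. cmat_adjoint (b l i) ** b l j)"
    unfolding matrix_positive_def by auto
  \<comment> \<open>The vectors are the rows of the block factor \<open>b\<close>: \<open>l\<close>
    picks the block row and \<open>k\<close> the row inside it. The conjugation brings
    \<open>b^* b\<close> into the form \<open>v * cnj v\<close> of the Gram lemmas.\<close>
  define v where "v = (\<lambda>(l, k) (p, q). cnj (b l (g q) $ k $ p))"
  have choi: "P (cmat_unit q q') $ p $ p' = (\<Sum>x\<in>{..<n} \<times> UNIV. v x (p, q) * cnj (v x (p', q')))" for p q p' q'
    using b[OF g(1)[of q] g(1)[of q']]
    by (simp add: g v_def matrix_matrix_mult_def sum.cartesian_product case_prod_unfold)
  obtain N :: nat and w where w: "indep_family {..<N} w"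
    "\<And>x y. (\<Sum>r<N. w r x * cnj (w r y)) = (\<Sum>r\<in>{..<n} \<times> UNIV. v r x * cnj (v r y))"
    using gram_indep_family[of "{..<n} \<times> (UNIV :: 'n set)" v] by auto
  define t :: "nat \<Rightarrow> complex^'n^'n" where "t r = (\<chi> p q. w r (p, q))" for r
  have "kraus_decomposition P N t"
    by (rule kraus_decompositionI[OF add scale]) (simp add: choi t_def w(2))
  moreover have "(\<lambda>r. cmat_entries (t r)) = w"
    by (auto simp: fun_eq_iff cmat_entries_def t_def)
  ultimately show ?thesis using w(1) by auto
qed

text \<open>For a functional \<open>c\<close>, the sum of \<open>|c(t r)|^2\<close> over a Kraus
  family is the Choi form of \<open>P\<close> at \<open>c\<close>, hence the same for all Kraus
  families. A functional that kills every \<open>u r\<close> therefore kills every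
  \<open>t r\<close>, and \<open>cmat_functional_in_span\<close> applies.\<close>

lemma kraus_span_subset:
  fixes P :: "complex^'n^'n \<Rightarrow> complex^'n^'n"
  assumes t: "kraus_decomposition P N t" and u: "kraus_decomposition P M u"
  shows "cmat.span (t ` {..<N}) \<subseteq> cmat.span (u ` {..<M})"
proof (rule cmat.span_minimal)
  show "t ` {..<N} \<subseteq> cmat.span (u ` {..<M})"
  proof
    fix x assume "x \<in> t ` {..<N}"
    then obtain r where r: "r < N" "x = t r" by blast
    show "x \<in> cmat.span (u ` {..<M})"
    proof (rule cmat_functional_in_span)
      fix c :: "'n \<Rightarrow> 'n \<Rightarrow> complex"
      assume c: "\<And>s. s \<in> u ` {..<M} \<Longrightarrow> (\<Sum>p\<in>UNIV. \<Sum>q\<in>UNIV. c p q * s $ p $ q) = 0"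
      have gram: "(\<Sum>r<N. (\<Sum>p\<in>UNIV. \<Sum>q\<in>UNIV. c p q * t r $ p $ q) * cnj (\<Sum>p\<in>UNIV. \<Sum>q\<in>UNIV. c p q * t r $ p $ q))
         = (\<Sum>x\<in>UNIV. \<Sum>y\<in>UNIV. c (fst x) (snd x) * cnj (c (fst y) (snd y)) *
              P (cmat_unit (snd x) (snd y)) $ fst x $ fst y)"
        if "kraus_decomposition P N t" for N t
      proof -
        have pairs: "(\<Sum>p\<in>UNIV. \<Sum>q\<in>UNIV. c p q * a $ p $ q) = (\<Sum>x\<in>UNIV. c (fst x) (snd x) * a $ fst x $ snd x)"
          for a :: "complex^'n^'n"
          by (simp add: sum.cartesian_product case_prod_unfold)
        have "(\<Sum>r<N. (\<Sum>p\<in>UNIV. \<Sum>q\<in>UNIV. c p q * t r $ p $ q) * cnj (\<Sum>p\<in>UNIV. \<Sum>q\<in>UNIV. c p q * t r $ p $ q))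
          = (\<Sum>r<N. \<Sum>x\<in>UNIV. \<Sum>y\<in>UNIV. c (fst x) (snd x) * cnj (c (fst y) (snd y)) *
              (t r $ fst x $ snd x * cnj (t r $ fst y $ snd y)))"
          by (simp only: pairs cnj_sum sum_product complex_cnj_mult mult_ac)
        also have "\<dots> = (\<Sum>x\<in>UNIV. \<Sum>r<N. \<Sum>y\<in>UNIV. c (fst x) (snd x) * cnj (c (fst y) (snd y)) *
              (t r $ fst x $ snd x * cnj (t r $ fst y $ snd y)))"
          by (rule sum.swap)
        also have "\<dots> = (\<Sum>x\<in>UNIV. \<Sum>y\<in>UNIV. \<Sum>r<N. c (fst x) (snd x) * cnj (c (fst y) (snd y)) *
              (t r $ fst x $ snd x * cnj (t r $ fst y $ snd y)))"
          by (intro sum.cong refl sum.swap)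
        also have "\<dots> = (\<Sum>x\<in>UNIV. \<Sum>y\<in>UNIV. c (fst x) (snd x) * cnj (c (fst y) (snd y)) *
              P (cmat_unit (snd x) (snd y)) $ fst x $ fst y)"
          by (simp add: kraus_decomposition_unit[OF that] sum_distrib_left)
        finally show ?thesis .
      qed
      have "(\<Sum>r<N. (\<Sum>p\<in>UNIV. \<Sum>q\<in>UNIV. c p q * t r $ p $ q) * cnj (\<Sum>p\<in>UNIV. \<Sum>q\<in>UNIV. c p q * t r $ p $ q)) = 0"
        unfolding gram[OF t] gram[OF u, symmetric] using c by simp
      hence "complex_of_real (\<Sum>r<N. (cmod (\<Sum>p\<in>UNIV. \<Sum>q\<in>UNIV. c p q * t r $ p $ q))\<^sup>2) = 0"
        by (simp only: of_real_sum complex_norm_square)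
      hence "(\<Sum>r<N. (cmod (\<Sum>p\<in>UNIV. \<Sum>q\<in>UNIV. c p q * t r $ p $ q))\<^sup>2) = 0"
        by (simp only: of_real_eq_0_iff)
      hence "(cmod (\<Sum>p\<in>UNIV. \<Sum>q\<in>UNIV. c p q * t r $ p $ q))\<^sup>2 = 0"
        using r(1) by (subst (asm) sum_nonneg_eq_0_iff) auto
      thus "(\<Sum>p\<in>UNIV. \<Sum>q\<in>UNIV. c p q * x $ p $ q) = 0" using r(2) by simp
    qed
  qed
qed (rule cmat.subspace_span)

text \<open>Inclusion of spans in both directions makes the description in \<open>cp_index\<close>
  single-valued.\<close>

lemma cp_index_eq:
  assumes "kraus_decomposition P N t"
  shows "cp_index P = cmat.dim (cmat.span (t ` {..<N}))"
  unfolding cp_index_def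
proof (rule the_equality)
  show "\<exists>N' t'. kraus_decomposition P N' t' \<and>
      cmat.dim (cmat.span (t ` {..<N})) = cmat.dim (cmat.span (t' ` {..<N'}))"
    using assms by blast
next
  fix d assume "\<exists>N' t'. kraus_decomposition P N' t' \<and> d = cmat.dim (cmat.span (t' ` {..<N'}))"
  then obtain N' t' where "kraus_decomposition P N' t'" and d: "d = cmat.dim (cmat.span (t' ` {..<N'}))" by blast
  hence "cmat.span (t ` {..<N}) = cmat.span (t' ` {..<N'})"
    using kraus_span_subset assms by blast
  thus "d = cmat.dim (cmat.span (t ` {..<N}))" using d by simp
qed

section \<open>Independent Kraus families\<close>

lemma indep_family_sum_zero:
  assumes "indep_family {..<N} (\<lambda>r. cmat_entries (t r))" "(\<Sum>r<N. cmat_scale (c r) (t r)) = 0" "r < N"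
  shows "c r = 0"
proof -
  have "(\<Sum>r<N. c r * cmat_entries (t r) x) = 0" for x
    using arg_cong[OF assms(2), of "\<lambda>a. a $ fst x $ snd x"]
    by (simp add: cmat_entries_def case_prod_unfold)
  thus ?thesis using assms(1,3) unfolding indep_family_def by blast
qed

lemma indep_family_cmat:
  fixes t :: "nat \<Rightarrow> complex^'n^'n"
  assumes "indep_family {..<N} (\<lambda>r. cmat_entries (t r))"
  shows "inj_on t {..<N}" "cmat.independent (t ` {..<N})"
proof -
  show inj: "inj_on t {..<N}"
  proof (rule inj_onI, rule ccontr)
    fix r s assume rs: "r \<in> {..<N}" "s \<in> {..<N}" "t r = t s" "r \<noteq> s"
    define c :: "nat \<Rightarrow> complex" where "c q = (if q = r then 1 else if q = s then -1 else 0)" for q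
    have "(\<Sum>q<N. cmat_scale (c q) (t q)) = (\<Sum>q\<in>{r,s}. cmat_scale (c q) (t q))"
      by (rule sum.mono_neutral_right) (use rs in \<open>auto simp: c_def\<close>)
    also have "\<dots> = 0" using rs by (simp add: c_def)
    finally show False using indep_family_sum_zero[OF assms, of c r] rs by (auto simp: c_def)
  qed
  show "cmat.independent (t ` {..<N})"
  proof (rule cmat.independent_if_scalars_zero)
    fix f x assume f: "(\<Sum>x\<in>t ` {..<N}. cmat_scale (f x) x) = 0" and x: "x \<in> t ` {..<N}"
    have "(\<Sum>r<N. cmat_scale (f (t r)) (t r)) = 0" using f by (simp add: sum.reindex[OF inj])
    from indep_family_sum_zero[OF assms this] x show "f x = 0" by auto
  qed simp
qed

lemma cp_index_indep:
  assumes "kraus_decomposition P N t" "indep_family {..<N} (\<lambda>r. cmat_entries (t r))"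
  shows "cp_index P = N"
  using cp_index_eq[OF assms(1)] indep_family_cmat[OF assms(2)]
  by (simp add: cmat.dim_eq_card_independent card_image)

text \<open>This is a functional of the dual basis of the independent \<open>t s\<close>, given by
  coefficients. It later isolates the \<open>r\<close>-th summand of the model of the
  GNS-correspondence.\<close>

lemma indep_family_dual:
  fixes t :: "nat \<Rightarrow> complex^'n^'n"
  assumes "indep_family {..<N} (\<lambda>r. cmat_entries (t r))" "r < N"
  shows "\<exists>c. \<forall>s<N. (\<Sum>p\<in>UNIV. \<Sum>q\<in>UNIV. c p q * t s $ p $ q) = (if s = r then 1 else 0)"
proof -
  note t = indep_family_cmat[OF assms(1)]
  from cmat.linear_independent_extend[OF t(2), of "\<lambda>x. if x = t r then 1 else 0"]
  obtain g where g: "Vector_Spaces.linear cmat_scale (*) g"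
    "\<And>x. x \<in> t ` {..<N} \<Longrightarrow> g x = (if x = t r then 1 else 0)" by blast
  have "(\<Sum>p\<in>UNIV. \<Sum>q\<in>UNIV. g (cmat_unit p q) * t s $ p $ q) = (if s = r then 1 else 0)" if "s < N" for s
    using g(2)[of "t s"] that assms(2) inj_on_eq_iff[OF t(1), of s r]
    by (simp flip: cmat_functional[OF g(1)])
  thus ?thesis by (intro exI[of _ "\<lambda>p q. g (cmat_unit p q)"]) simp
qed

section \<open>Hilbert modules and correspondences\<close>

lemma complex_ring_simps [simp]:
  "carrier complex_ring = UNIV" "monoid.mult complex_ring = (*)" "\<one>\<^bsub>complex_ring\<^esub> = 1"
  "\<zero>\<^bsub>complex_ring\<^esub> = 0" "add complex_ring = (+)"
  by (simp_all add: complex_ring_def)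

lemma cring_complex_ring: "cring complex_ring"
proof (rule cringI)
  show "abelian_group complex_ring"
  proof (rule abelian_groupI)
    fix x :: complex
    show "\<exists>y\<in>carrier complex_ring. y \<oplus>\<^bsub>complex_ring\<^esub> x = \<zero>\<^bsub>complex_ring\<^esub>"
      by (rule bexI[of _ "- x"]) simp_all
  qed (simp_all add: algebra_simps)
  show "Group.comm_monoid complex_ring"
    by (rule comm_monoidI) (simp_all add: algebra_simps)
qed (simp add: algebra_simps)

lemma complex_moduleI:
  fixes M (structure)
  assumes "abelian_group M"
    and "\<And>z x. x \<in> carrier M \<Longrightarrow> z \<odot> x \<in> carrier M"
    and "\<And>z w x. x \<in> carrier M \<Longrightarrow> (z + w) \<odot> x = z \<odot> x \<oplus> w \<odot> x"
    and "\<And>z x y. x \<in> carrier M \<Longrightarrow> y \<in> carrier M \<Longrightarrow> z \<odot> (x \<oplus> y) = z \<odot> x \<oplus> z \<odot> y"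
    and "\<And>z w x. x \<in> carrier M \<Longrightarrow> (z * w) \<odot> x = z \<odot> (w \<odot> x)"
    and "\<And>x. x \<in> carrier M \<Longrightarrow> 1 \<odot> x = x"
  shows "Module.module complex_ring M"
  by (rule moduleI) (use assms cring_complex_ring in auto)

section \<open>Consequences of the axioms of Hilbert modules and correspondences\<close>

sublocale hilbert_module \<subseteq> mod: Module.module complex_ring E
  by (rule vector_space)

sublocale cstar_algebra \<subseteq> mod: Module.module complex_ring A
  by (rule vector_space)

lemma finsum_hom:
  assumes "abelian_monoid G" "abelian_monoid H"
    and "\<And>x. x \<in> carrier G \<Longrightarrow> f x \<in> carrier H" "f \<zero>\<^bsub>G\<^esub> = \<zero>\<^bsub>H\<^esub>"
    and add: "\<And>x y. x \<in> carrier G \<Longrightarrow> y \<in> carrier G \<Longrightarrow> f (x \<oplus>\<^bsub>G\<^esub> y) = f x \<oplus>\<^bsub>H\<^esub> f y"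
    and "x \<in> I \<rightarrow> carrier G"
  shows "f (finsum G x I) = finsum H (\<lambda>i. f (x i)) I"
proof -
  interpret G: abelian_monoid G by fact
  interpret H: abelian_monoid H by fact
  show ?thesis
    using assms(6)
  proof (induction I rule: infinite_finite_induct)
    case (infinite I)
    thus ?case by (simp add: assms(4) G.finsum_infinite H.finsum_infinite)
  next
    case (insert i I)
    have "(\<lambda>i. f (x i)) \<in> I \<rightarrow> carrier H" "f (x i) \<in> carrier H" using insert.prems assms(3) by auto
    moreover have "finsum G x I \<in> carrier G" using insert.prems by (intro G.finsum_closed) auto
    ultimately show ?case using insert by (simp add: add)
  qed (simp add: assms)
qed

lemma group_hom_zero_minus:
  assumes "abelian_group G" "abelian_group H"
    and closed: "\<And>x. x \<in> carrier G \<Longrightarrow> f x \<in> carrier H"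
    and add: "\<And>x y. x \<in> carrier G \<Longrightarrow> y \<in> carrier G \<Longrightarrow> f (x \<oplus>\<^bsub>G\<^esub> y) = f x \<oplus>\<^bsub>H\<^esub> f y"
  shows "f \<zero>\<^bsub>G\<^esub> = \<zero>\<^bsub>H\<^esub>"
    and "x \<in> carrier G \<Longrightarrow> y \<in> carrier G \<Longrightarrow> f (x \<ominus>\<^bsub>G\<^esub> y) = f x \<ominus>\<^bsub>H\<^esub> f y"
proof -
  interpret G: abelian_group G by fact
  interpret H: abelian_group H by fact
  have "f \<zero>\<^bsub>G\<^esub> \<oplus>\<^bsub>H\<^esub> f \<zero>\<^bsub>G\<^esub> = f \<zero>\<^bsub>G\<^esub>"
    using add[of "\<zero>\<^bsub>G\<^esub>" "\<zero>\<^bsub>G\<^esub>"] by simp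
  thus zero: "f \<zero>\<^bsub>G\<^esub> = \<zero>\<^bsub>H\<^esub>"
    using closed[of "\<zero>\<^bsub>G\<^esub>"] by (simp add: H.add.l_cancel_one)
  have "f (\<ominus>\<^bsub>G\<^esub> y) = \<ominus>\<^bsub>H\<^esub> f y" if "y \<in> carrier G" for y
    using that add[of "\<ominus>\<^bsub>G\<^esub> y" y] zero
    by (intro H.minus_equality[symmetric]) (simp_all add: G.l_neg closed)
  thus "x \<in> carrier G \<Longrightarrow> y \<in> carrier G \<Longrightarrow> f (x \<ominus>\<^bsub>G\<^esub> y) = f x \<ominus>\<^bsub>H\<^esub> f y"
    by (simp add: G.minus_eq H.minus_eq add)
qed

context hilbert_module
begin

lemma rinner_zero_right: "x \<in> carrier E \<Longrightarrow> rinner E x \<zero>\<^bsub>E\<^esub> = \<zero>\<^bsub>B\<^esub>"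
  using group_hom_zero_minus(1)[of E B "rinner E x"]
  by (simp add: mod.abelian_group_axioms B.mod.abelian_group_axioms rinner_closed rinner_add_right)

lemma rinner_add_left: "\<lbrakk>x \<in> carrier E; y \<in> carrier E; w \<in> carrier E\<rbrakk>
    \<Longrightarrow> rinner E (x \<oplus>\<^bsub>E\<^esub> y) w = rinner E x w \<oplus>\<^bsub>B\<^esub> rinner E y w"
  using rinner_star[of w "x \<oplus>\<^bsub>E\<^esub> y"] rinner_star[of w x] rinner_star[of w y]
  by (metis B.star_add mod.M.a_closed rinner_add_right rinner_closed)

lemma rinner_smult_left: "\<lbrakk>x \<in> carrier E; y \<in> carrier E\<rbrakk>
    \<Longrightarrow> rinner E (z \<odot>\<^bsub>E\<^esub> x) y = cnj z \<odot>\<^bsub>B\<^esub> rinner E x y"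
  using rinner_star[of y "z \<odot>\<^bsub>E\<^esub> x"] rinner_star[of y x] rinner_smult_right[of y x z]
    B.star_smult[of "rinner E y x" z] by (simp add: rinner_closed)

lemma rinner_zero_left: "x \<in> carrier E \<Longrightarrow> rinner E \<zero>\<^bsub>E\<^esub> x = \<zero>\<^bsub>B\<^esub>"
  using group_hom_zero_minus(1)[of E B "\<lambda>y. rinner E y x"]
  by (simp add: mod.abelian_group_axioms B.mod.abelian_group_axioms rinner_closed rinner_add_left)

lemma rinner_finsum_right:
  "\<lbrakk>x \<in> carrier E; y \<in> I \<rightarrow> carrier E\<rbrakk>
    \<Longrightarrow> rinner E x (finsum E y I) = finsum B (\<lambda>i. rinner E x (y i)) I"
  by (rule finsum_hom) (simp_all add: mod.M.abelian_monoid_axioms B.mod.M.abelian_monoid_axioms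
      rinner_closed rinner_add_right rinner_zero_right)

lemma rinner_finsum_left:
  "\<lbrakk>x \<in> carrier E; y \<in> I \<rightarrow> carrier E\<rbrakk>
    \<Longrightarrow> rinner E (finsum E y I) x = finsum B (\<lambda>i. rinner E (y i) x) I"
  by (rule finsum_hom) (simp_all add: mod.M.abelian_monoid_axioms B.mod.M.abelian_monoid_axioms
      rinner_closed rinner_add_left rinner_zero_left)

lemma ract_zero: "b \<in> carrier B \<Longrightarrow> ract E \<zero>\<^bsub>E\<^esub> b = \<zero>\<^bsub>E\<^esub>"
  using group_hom_zero_minus(1)[of E E "\<lambda>x. ract E x b"]
  by (simp add: mod.abelian_group_axioms ract_closed ract_add_left)

lemma ract_finsum:
  "\<lbrakk>b \<in> carrier B; y \<in> I \<rightarrow> carrier E\<rbrakk>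
    \<Longrightarrow> ract E (finsum E y I) b = finsum E (\<lambda>i. ract E (y i) b) I"
  by (rule finsum_hom) (simp_all add: mod.M.abelian_monoid_axioms
      ract_closed ract_add_left ract_zero)

lemma rinner_diff_eq_zero_iff:
  assumes "x \<in> carrier E" "y \<in> carrier E"
  shows "rinner E (x \<ominus>\<^bsub>E\<^esub> y) (x \<ominus>\<^bsub>E\<^esub> y) = \<zero>\<^bsub>B\<^esub> \<longleftrightarrow> x = y"
proof
  assume "rinner E (x \<ominus>\<^bsub>E\<^esub> y) (x \<ominus>\<^bsub>E\<^esub> y) = \<zero>\<^bsub>B\<^esub>"
  hence "x \<ominus>\<^bsub>E\<^esub> y = \<zero>\<^bsub>E\<^esub>" using assms by (intro rinner_definite) auto
  hence "(x \<ominus>\<^bsub>E\<^esub> y) \<oplus>\<^bsub>E\<^esub> y = y" using assms by simp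
  thus "x = y" using assms by (simp add: mod.M.minus_eq mod.M.a_assoc mod.M.l_neg)
next
  assume "x = y"
  thus "rinner E (x \<ominus>\<^bsub>E\<^esub> y) (x \<ominus>\<^bsub>E\<^esub> y) = \<zero>\<^bsub>B\<^esub>"
    using assms by (simp add: mod.M.minus_eq mod.M.r_neg rinner_zero_right)
qed

end

context correspondence
begin

lemma lact_closed: "\<lbrakk>a \<in> carrier A; x \<in> carrier E\<rbrakk> \<Longrightarrow> lact E a x \<in> carrier E"
  using lact_adjoint[of a] by (auto simp: is_adjoint_def Pi_iff)

lemma rinner_lact: "\<lbrakk>a \<in> carrier A; x \<in> carrier E; y \<in> carrier E\<rbrakk>
    \<Longrightarrow> rinner E (lact E a x) y = rinner E x (lact E (star A a) y)"
  using lact_adjoint[of a] by (auto simp: is_adjoint_def)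

lemma rinner_lact_right: "\<lbrakk>a \<in> carrier A; x \<in> carrier E; y \<in> carrier E\<rbrakk>
    \<Longrightarrow> rinner E x (lact E a y) = rinner E (lact E (star A a) x) y"
  using rinner_lact[of "star A a" x y] by (simp add: A.star_closed A.star_star)

text \<open>Testing on \<open>w = x - y\<close> shows that this difference has length zero.\<close>

lemma rinner_nondegenerate:
  assumes "x \<in> carrier E" "y \<in> carrier E" "\<And>w. w \<in> carrier E \<Longrightarrow> rinner E w x = rinner E w y"
  shows "x = y"
proof -
  let ?d = "x \<ominus>\<^bsub>E\<^esub> y"
  have d: "?d \<in> carrier E" using assms by simp
  have "rinner E ?d x = rinner E ?d (?d \<oplus>\<^bsub>E\<^esub> y)"
    using assms by (simp add: mod.M.minus_eq mod.M.a_assoc mod.M.l_neg)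
  also have "\<dots> = rinner E ?d ?d \<oplus>\<^bsub>B\<^esub> rinner E ?d y"
    using d assms by (simp add: rinner_add_right)
  finally have "rinner E ?d ?d = \<zero>\<^bsub>B\<^esub>"
    using assms(3)[OF d] d assms by (simp add: rinner_closed B.mod.M.add.l_cancel_one')
  thus ?thesis using rinner_diff_eq_zero_iff assms by simp
qed

text \<open>The locale demands linearity of the left action only in the algebra variable. In the
  vector it is automatic for adjointable operators: pairing with an arbitrary vector moves
  \<open>a\<close> to the other side, and \<open>rinner_nondegenerate\<close> concludes.\<close>

lemma lact_add_right: "\<lbrakk>a \<in> carrier A; x \<in> carrier E; y \<in> carrier E\<rbrakk>
    \<Longrightarrow> lact E a (x \<oplus>\<^bsub>E\<^esub> y) = lact E a x \<oplus>\<^bsub>E\<^esub> lact E a y"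
  by (intro rinner_nondegenerate)
    (simp_all add: lact_closed rinner_add_right A.star_closed rinner_lact_right)

lemma lact_smult_right: "\<lbrakk>a \<in> carrier A; x \<in> carrier E\<rbrakk>
    \<Longrightarrow> lact E a (z \<odot>\<^bsub>E\<^esub> x) = z \<odot>\<^bsub>E\<^esub> lact E a x"
  by (intro rinner_nondegenerate)
    (simp_all add: lact_closed rinner_smult_right A.star_closed rinner_lact_right)

lemma lact_zero: "a \<in> carrier A \<Longrightarrow> lact E a \<zero>\<^bsub>E\<^esub> = \<zero>\<^bsub>E\<^esub>"
  using group_hom_zero_minus(1)[of E E "lact E a"]
  by (simp add: mod.abelian_group_axioms lact_closed lact_add_right)

lemma lact_finsum:
  "\<lbrakk>a \<in> carrier A; y \<in> I \<rightarrow> carrier E\<rbrakk>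
    \<Longrightarrow> lact E a (finsum E y I) = finsum E (\<lambda>i. lact E a (y i)) I"
  by (rule finsum_hom) (simp_all add: mod.M.abelian_monoid_axioms
      lact_closed lact_add_right lact_zero)

text \<open>Every axiom is pulled back along the bijection. This serves quotients whose operations
  go through chosen representatives and are awkward to compute with. The zero is treated separately
  because \<open>F\<close> is not yet known to be a group.\<close>

lemma transfer:
  fixes F :: "('a, 'b, 'v, 'u) corr_scheme"
  assumes bij: "bij_betw \<phi> (carrier F) (carrier E)"
    and zero: "\<zero>\<^bsub>F\<^esub> \<in> carrier F" "\<phi> \<zero>\<^bsub>F\<^esub> = \<zero>\<^bsub>E\<^esub>"
    and closed: "\<And>x y. x \<in> carrier F \<Longrightarrow> y \<in> carrier F \<Longrightarrow> x \<oplus>\<^bsub>F\<^esub> y \<in> carrier F"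
      "\<And>z x. x \<in> carrier F \<Longrightarrow> z \<odot>\<^bsub>F\<^esub> x \<in> carrier F"
      "\<And>a x. a \<in> carrier A \<Longrightarrow> x \<in> carrier F \<Longrightarrow> lact F a x \<in> carrier F"
      "\<And>b x. b \<in> carrier B \<Longrightarrow> x \<in> carrier F \<Longrightarrow> ract F x b \<in> carrier F"
    and hom: "\<And>x y. x \<in> carrier F \<Longrightarrow> y \<in> carrier F \<Longrightarrow> \<phi> (x \<oplus>\<^bsub>F\<^esub> y) = \<phi> x \<oplus>\<^bsub>E\<^esub> \<phi> y"
      "\<And>z x. x \<in> carrier F \<Longrightarrow> \<phi> (z \<odot>\<^bsub>F\<^esub> x) = z \<odot>\<^bsub>E\<^esub> \<phi> x"
      "\<And>a x. a \<in> carrier A \<Longrightarrow> x \<in> carrier F \<Longrightarrow> \<phi> (lact F a x) = lact E a (\<phi> x)"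
      "\<And>b x. b \<in> carrier B \<Longrightarrow> x \<in> carrier F \<Longrightarrow> \<phi> (ract F x b) = ract E (\<phi> x) b"
    and iso: "\<And>x y. x \<in> carrier F \<Longrightarrow> y \<in> carrier F \<Longrightarrow> rinner F x y = rinner E (\<phi> x) (\<phi> y)"
  shows "correspondence A B F"
proof -
  have \<phi>: "x \<in> carrier F \<Longrightarrow> \<phi> x \<in> carrier E" for x
    using bij by (auto simp: bij_betw_def)
  have inj: "x \<in> carrier F \<Longrightarrow> y \<in> carrier F \<Longrightarrow> \<phi> x = \<phi> y \<Longrightarrow> x = y" for x y
    using bij by (auto simp: bij_betw_def inj_on_def)
  have surj: "\<exists>x\<in>carrier F. \<phi> x = y" if "y \<in> carrier E" for y
    using bij that unfolding bij_betw_def by (metis imageE)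
  note simps = zero closed hom \<phi>
  have group: "abelian_group F"
  proof (rule abelian_groupI)
    fix x assume x: "x \<in> carrier F"
    then obtain y where y: "y \<in> carrier F" "\<phi> y = \<ominus>\<^bsub>E\<^esub> \<phi> x" using surj[of "\<ominus>\<^bsub>E\<^esub> \<phi> x"] \<phi> by auto
    show "\<exists>y\<in>carrier F. y \<oplus>\<^bsub>F\<^esub> x = \<zero>\<^bsub>F\<^esub>"
      by (rule bexI[of _ y], rule inj) (simp_all add: simps x y mod.M.l_neg)
  next
    fix x y assume xy: "x \<in> carrier F" "y \<in> carrier F"
    show "x \<oplus>\<^bsub>F\<^esub> y = y \<oplus>\<^bsub>F\<^esub> x"
      by (rule inj) (simp_all add: simps xy mod.M.a_comm)
  qed (rule inj; simp add: simps mod.M.a_assoc | simp add: simps)+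
  have module: "Module.module complex_ring F"
    by (rule complex_moduleI[OF group];
        (simp add: simps; fail)?; rule inj;
        simp add: simps mod.smult_l_distr[simplified] mod.smult_r_distr[simplified]
          mod.smult_assoc1[simplified] mod.smult_one[simplified])
  have minus: "\<phi> (x \<ominus>\<^bsub>F\<^esub> y) = \<phi> x \<ominus>\<^bsub>E\<^esub> \<phi> y" "x \<ominus>\<^bsub>F\<^esub> y \<in> carrier F"
    if "x \<in> carrier F" "y \<in> carrier F" for x y
    using group_hom_zero_minus(2)[OF group mod.abelian_group_axioms \<phi> hom(1), of x y] that
      abelian_group.minus_closed[OF group] by auto
  have norm: "hnorm B F x = hnorm B E (\<phi> x)" if "x \<in> carrier F" for x
    using iso that by (simp add: hnorm_def)
  have complete_F: "norm_complete F (hnorm B F)"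
    unfolding norm_complete_def
  proof (intro allI impI)
    fix s assume s: "norm_Cauchy F (hnorm B F) s"
    hence sF: "s n \<in> carrier F" for n by (simp add: norm_Cauchy_def)
    have "norm_Cauchy E (hnorm B E) (\<lambda>n. \<phi> (s n))"
      using s unfolding norm_Cauchy_def by (simp add: norm minus sF \<phi>)
    then obtain l where l: "norm_tendsto E (hnorm B E) (\<lambda>n. \<phi> (s n)) l"
      using complete unfolding norm_complete_def by blast
    then obtain k where k: "k \<in> carrier F" "\<phi> k = l"
      using surj unfolding norm_tendsto_def by blast
    have "norm_tendsto F (hnorm B F) s k"
      using l unfolding norm_tendsto_def by (simp add: norm minus sF k)
    thus "\<exists>l. norm_tendsto F (hnorm B F) s l" by blast
  qed
  show ?thesis
  proof (intro correspondence.intro hilbert_module.intro correspondence_axioms.intro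
      hilbert_module_axioms.intro A.cstar_algebra_axioms B.cstar_algebra_axioms)
    show "x = \<zero>\<^bsub>F\<^esub>" if "x \<in> carrier F" "rinner F x x = \<zero>\<^bsub>B\<^esub>" for x
      using that by (intro inj) (simp_all add: simps iso rinner_definite)
    show "is_adjoint F (lact F a) (lact F (star A a))" if "a \<in> carrier A" for a
      using that by (simp add: is_adjoint_def simps iso rinner_lact A.star_closed)
    show "norm_complete F (hnorm B F)" by (rule complete_F)
    show "Module.module complex_ring F" by (rule module)
  qed (simp_all add: simps iso rinner_closed rinner_add_right rinner_smult_right rinner_ract
      rinner_star rinner_positive
      | rule inj; simp add: simps ract_add_left ract_add_right ract_mult ract_smult_left
         ract_smult_right lact_add lact_smult lact_mult B.mod.M.a_closed B.mult_closed
         A.mult_closed ract_closed lact_closed)+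
qed

end

section \<open>Symmetry and transitivity of isomorphism\<close>

lemma corr_isomorphic_sym:
  assumes "correspondence A B E" "corr_isomorphic A B E F"
  shows "corr_isomorphic A B F E"
proof -
  interpret E: correspondence A B E by fact
  obtain \<phi> where bij: "bij_betw \<phi> (carrier E) (carrier F)"
    and hom0: "\<forall>x\<in>carrier E. \<forall>y\<in>carrier E. \<phi> (x \<oplus>\<^bsub>E\<^esub> y) = \<phi> x \<oplus>\<^bsub>F\<^esub> \<phi> y"
      "\<forall>z. \<forall>x\<in>carrier E. \<phi> (z \<odot>\<^bsub>E\<^esub> x) = z \<odot>\<^bsub>F\<^esub> \<phi> x"
      "\<forall>a\<in>carrier A. \<forall>x\<in>carrier E. \<phi> (lact E a x) = lact F a (\<phi> x)"
      "\<forall>x\<in>carrier E. \<forall>b\<in>carrier B. \<phi> (ract E x b) = ract F (\<phi> x) b"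
      "\<forall>x\<in>carrier E. \<forall>y\<in>carrier E. rinner F (\<phi> x) (\<phi> y) = rinner E x y"
    using assms(2) unfolding corr_isomorphic_def by (elim exE conjE)
  note hom = hom0(1)[rule_format] hom0(2)[rule_format] hom0(3)[rule_format] hom0(4)[rule_format] hom0(5)[rule_format]
  define \<psi> where "\<psi> = the_inv_into (carrier E) \<phi>"
  have inj: "inj_on \<phi> (carrier E)" and img: "\<phi> ` carrier E = carrier F" using bij by (auto simp: bij_betw_def)
  have \<psi>\<phi>: "\<psi> (\<phi> x) = x" if "x \<in> carrier E" for x
    unfolding \<psi>_def using inj that by (rule the_inv_into_f_f)
  have eq: "x \<in> carrier E \<Longrightarrow> \<psi> y = x" if "y = \<phi> x" for x y using \<psi>\<phi> that by simp
  show ?thesis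
    \<comment> \<open>With the carrier of \<open>F\<close> written as an image, every claim concerns
      points \<open>\<phi> x\<close>, where \<open>\<psi>\<close> undoes \<open>\<phi>\<close>; this
      needs the operations of \<open>E\<close> to stay in its carrier.\<close>
    unfolding corr_isomorphic_def img[symmetric] ball_simps
  proof (intro exI[of _ \<psi>] conjI ballI allI)
    show "bij_betw \<psi> (\<phi> ` carrier E) (carrier E)"
      unfolding \<psi>_def img by (rule bij_betw_the_inv_into[OF bij])
  qed (simp_all add: \<psi>\<phi> hom flip: hom(1) hom(2) hom(3) hom(4)
      add: E.lact_closed E.ract_closed)
qed

lemma corr_isomorphic_trans:
  assumes "corr_isomorphic A B E F" "corr_isomorphic A B F G"
  shows "corr_isomorphic A B E G"
proof -
  obtain \<phi> where \<phi>: "bij_betw \<phi> (carrier E) (carrier F)"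
    and h0: "\<forall>x\<in>carrier E. \<forall>y\<in>carrier E. \<phi> (x \<oplus>\<^bsub>E\<^esub> y) = \<phi> x \<oplus>\<^bsub>F\<^esub> \<phi> y"
      "\<forall>z. \<forall>x\<in>carrier E. \<phi> (z \<odot>\<^bsub>E\<^esub> x) = z \<odot>\<^bsub>F\<^esub> \<phi> x"
      "\<forall>a\<in>carrier A. \<forall>x\<in>carrier E. \<phi> (lact E a x) = lact F a (\<phi> x)"
      "\<forall>x\<in>carrier E. \<forall>b\<in>carrier B. \<phi> (ract E x b) = ract F (\<phi> x) b"
      "\<forall>x\<in>carrier E. \<forall>y\<in>carrier E. rinner F (\<phi> x) (\<phi> y) = rinner E x y"
    using assms(1) unfolding corr_isomorphic_def by (elim exE conjE)
  note h = h0(1)[rule_format] h0(2)[rule_format] h0(3)[rule_format] h0(4)[rule_format] h0(5)[rule_format]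
  obtain \<psi> where \<psi>: "bij_betw \<psi> (carrier F) (carrier G)"
    and k0: "\<forall>x\<in>carrier F. \<forall>y\<in>carrier F. \<psi> (x \<oplus>\<^bsub>F\<^esub> y) = \<psi> x \<oplus>\<^bsub>G\<^esub> \<psi> y"
      "\<forall>z. \<forall>x\<in>carrier F. \<psi> (z \<odot>\<^bsub>F\<^esub> x) = z \<odot>\<^bsub>G\<^esub> \<psi> x"
      "\<forall>a\<in>carrier A. \<forall>x\<in>carrier F. \<psi> (lact F a x) = lact G a (\<psi> x)"
      "\<forall>x\<in>carrier F. \<forall>b\<in>carrier B. \<psi> (ract F x b) = ract G (\<psi> x) b"
      "\<forall>x\<in>carrier F. \<forall>y\<in>carrier F. rinner G (\<psi> x) (\<psi> y) = rinner F x y"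
    using assms(2) unfolding corr_isomorphic_def by (elim exE conjE)
  note k = k0(1)[rule_format] k0(2)[rule_format] k0(3)[rule_format] k0(4)[rule_format] k0(5)[rule_format]
  have "\<phi> x \<in> carrier F" if "x \<in> carrier E" for x using \<phi> that by (auto simp: bij_betw_def)
  thus ?thesis
    unfolding corr_isomorphic_def
    by (intro exI[of _ "\<psi> \<circ> \<phi>"] conjI bij_betw_trans[OF \<phi> \<psi>]) (simp_all add: h k)
qed

section \<open>Separation and formal sums\<close>

lemma mod_null_simps [simp]:
  "carrier (mod_null B E) = carrier E // null_rel B E"
  "\<zero>\<^bsub>mod_null B E\<^esub> = null_rel B E `` {\<zero>\<^bsub>E\<^esub>}"
  "U \<oplus>\<^bsub>mod_null B E\<^esub> W = null_rel B E `` {rep U \<oplus>\<^bsub>E\<^esub> rep W}"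
  "z \<odot>\<^bsub>mod_null B E\<^esub> U = null_rel B E `` {z \<odot>\<^bsub>E\<^esub> rep U}"
  "ract (mod_null B E) U b = null_rel B E `` {ract E (rep U) b}"
  "rinner (mod_null B E) U W = rinner E (rep U) (rep W)"
  "lact (mod_null B E) a U = null_rel B E `` {lact E a (rep U)}"
  by (simp_all add: mod_null_def)

lemma formal_sums_simps [simp]:
  "carrier (formal_sums B S l r \<kappa>) = {v. Poly_Mapping.keys v \<subseteq> S}"
  "\<zero>\<^bsub>formal_sums B S l r \<kappa>\<^esub> = 0"
  "v \<oplus>\<^bsub>formal_sums B S l r \<kappa>\<^esub> w = v + w"
  "z \<odot>\<^bsub>formal_sums B S l r \<kappa>\<^esub> v = Poly_Mapping.map ((*) z) v"
  "ract (formal_sums B S l r \<kappa>) v b = formal_map (\<lambda>s. r s b) v"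
  "rinner (formal_sums B S l r \<kappa>) v w =
     (\<Oplus>\<^bsub>B\<^esub> s \<in> Poly_Mapping.keys v. \<Oplus>\<^bsub>B\<^esub> t \<in> Poly_Mapping.keys w.
       (cnj (Poly_Mapping.lookup v s) * Poly_Mapping.lookup w t) \<odot>\<^bsub>B\<^esub> \<kappa> s t)"
  "lact (formal_sums B S l r \<kappa>) a v = formal_map (l a) v"
  by (simp_all add: formal_sums_def)

text \<open>A surjection that preserves inner products identifies exactly the vectors at distance
  zero, so the separation of its domain is isomorphic to its target.\<close>

locale isometric_quotient = correspondence A B H
  for A :: "('a, 'w) star_alg_scheme"
    and B :: "('b, 'y) star_alg_scheme"
    and H :: "('a, 'b, 'h, 'z) corr_scheme" +
  fixes V :: "('a, 'b, 'v) corr"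
    and T :: "'v \<Rightarrow> 'h"
  assumes V_group: "abelian_group V"
    and V_smult_closed: "x \<in> carrier V \<Longrightarrow> z \<odot>\<^bsub>V\<^esub> x \<in> carrier V"
    and V_lact_closed: "\<lbrakk>a \<in> carrier A; x \<in> carrier V\<rbrakk> \<Longrightarrow> lact V a x \<in> carrier V"
    and V_ract_closed: "\<lbrakk>x \<in> carrier V; b \<in> carrier B\<rbrakk> \<Longrightarrow> ract V x b \<in> carrier V"
    and T_closed: "x \<in> carrier V \<Longrightarrow> T x \<in> carrier H"
    and T_surj: "h \<in> carrier H \<Longrightarrow> \<exists>x\<in>carrier V. T x = h"
    and T_add: "\<lbrakk>x \<in> carrier V; y \<in> carrier V\<rbrakk> \<Longrightarrow> T (x \<oplus>\<^bsub>V\<^esub> y) = T x \<oplus>\<^bsub>H\<^esub> T y"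
    and T_smult: "x \<in> carrier V \<Longrightarrow> T (z \<odot>\<^bsub>V\<^esub> x) = z \<odot>\<^bsub>H\<^esub> T x"
    and T_lact: "\<lbrakk>a \<in> carrier A; x \<in> carrier V\<rbrakk> \<Longrightarrow> T (lact V a x) = lact H a (T x)"
    and T_ract: "\<lbrakk>x \<in> carrier V; b \<in> carrier B\<rbrakk> \<Longrightarrow> T (ract V x b) = ract H (T x) b"
    and T_rinner: "\<lbrakk>x \<in> carrier V; y \<in> carrier V\<rbrakk> \<Longrightarrow> rinner V x y = rinner H (T x) (T y)"
begin

sublocale V: abelian_group V
  by (rule V_group)

lemmas T_zero = group_hom_zero_minus(1)[OF V_group mod.abelian_group_axioms T_closed T_add]
lemmas T_minus = group_hom_zero_minus(2)[OF V_group mod.abelian_group_axioms T_closed T_add]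

lemma null_rel_eq: "null_rel B V = {(x, y). x \<in> carrier V \<and> y \<in> carrier V \<and> T x = T y}"
proof -
  have "rinner V (x \<ominus>\<^bsub>V\<^esub> y) (x \<ominus>\<^bsub>V\<^esub> y) = \<zero>\<^bsub>B\<^esub> \<longleftrightarrow> T x = T y"
    if "x \<in> carrier V" "y \<in> carrier V" for x y
    using that by (simp add: T_rinner T_minus T_closed rinner_diff_eq_zero_iff)
  thus ?thesis unfolding null_rel_def by auto
qed

lemma equiv_null_rel: "equiv (carrier V) (null_rel B V)"
  unfolding null_rel_eq by (auto intro!: equivI refl_onI symI transI)

abbreviation proj where "proj x \<equiv> null_rel B V `` {x}"

text \<open>The choice made by \<open>rep\<close> is invisible to \<open>T\<close>, which is
  constant on classes. Through this lemma the operations of the quotient are computed in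
  \<open>H\<close>.\<close>

lemma T_rep_proj: "x \<in> carrier V \<Longrightarrow> T (rep (proj x)) = T x"
proof -
  assume "x \<in> carrier V"
  hence "x \<in> proj x" by (simp add: null_rel_eq)
  hence "rep (proj x) \<in> proj x" unfolding rep_def by (rule someI)
  moreover have "T y = T x" if "y \<in> proj x" for y
    using that by (simp add: null_rel_eq)
  ultimately show "T (rep (proj x)) = T x" by blast
qed

lemma rep_closed: "U \<in> carrier V // null_rel B V \<Longrightarrow> rep U \<in> carrier V"
proof (erule quotientE)
  fix x assume x: "x \<in> carrier V" "U = proj x"
  hence "x \<in> U" by (simp add: null_rel_eq)
  hence "rep U \<in> U" unfolding rep_def by (rule someI)
  thus "rep U \<in> carrier V" by (simp add: null_rel_eq x)
qed

lemma bij_betw_T_rep: "bij_betw (\<lambda>U. T (rep U)) (carrier V // null_rel B V) (carrier H)"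
proof (rule bij_betwI')
  fix U W assume UW: "U \<in> carrier V // null_rel B V" "W \<in> carrier V // null_rel B V"
  then obtain x y where "x \<in> carrier V" "U = proj x" "y \<in> carrier V" "W = proj y"
    by (auto elim!: quotientE)
  thus "T (rep U) = T (rep W) \<longleftrightarrow> U = W"
    by (simp add: T_rep_proj eq_equiv_class_iff[OF equiv_null_rel]) (simp add: null_rel_eq)
next
  show "T (rep U) \<in> carrier H" if "U \<in> carrier V // null_rel B V" for U
    using that by (simp add: T_closed rep_closed)
next
  fix h assume "h \<in> carrier H"
  then obtain x where "x \<in> carrier V" "T x = h" using T_surj by blast
  thus "\<exists>U\<in>carrier V // null_rel B V. h = T (rep U)"
    by (intro bexI[of _ "proj x"]) (simp_all add: T_rep_proj quotientI)
qed

lemma mod_null_isomorphic: "corr_isomorphic A B (mod_null B V) H"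
  unfolding corr_isomorphic_def mod_null_simps
  by (intro exI[of _ "\<lambda>U. T (rep U)"] conjI bij_betw_T_rep)
    (simp_all add: rep_closed T_rep_proj V_smult_closed V_lact_closed V_ract_closed
      T_add T_smult T_lact T_ract T_rinner)

lemma correspondence_mod_null: "correspondence A B (mod_null B V)"
  by (rule transfer[of "\<lambda>U. T (rep U)"])
    (simp_all add: bij_betw_T_rep rep_closed T_rep_proj V_smult_closed V_lact_closed V_ract_closed
      T_add T_smult T_lact T_ract T_rinner T_zero quotientI)

end

text \<open>\<open>\<rho>\<close> gives the value of an elementary tensor in a concrete model
  \<open>H\<close>; the GNS construction and both interior tensor products are instances. The last
  assumption says that these values span \<open>H\<close>, phrased as an induction principle so that
  no explicit finite sums appear.\<close>

locale tensor_realization = correspondence A B H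
  for A :: "('a, 'w) star_alg_scheme"
    and B :: "('b, 'y) star_alg_scheme"
    and H :: "('a, 'b, 'h, 'z) corr_scheme" +
  fixes S :: "'s set"
    and l :: "'a \<Rightarrow> 's \<Rightarrow> 's" and r :: "'s \<Rightarrow> 'b \<Rightarrow> 's" and \<kappa> :: "'s \<Rightarrow> 's \<Rightarrow> 'b"
    and \<rho> :: "'s \<Rightarrow> 'h"
  assumes \<rho>_closed: "s \<in> S \<Longrightarrow> \<rho> s \<in> carrier H"
    and l_closed: "\<lbrakk>a \<in> carrier A; s \<in> S\<rbrakk> \<Longrightarrow> l a s \<in> S"
    and r_closed: "\<lbrakk>s \<in> S; b \<in> carrier B\<rbrakk> \<Longrightarrow> r s b \<in> S"
    and \<rho>_l: "\<lbrakk>a \<in> carrier A; s \<in> S\<rbrakk> \<Longrightarrow> \<rho> (l a s) = lact H a (\<rho> s)"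
    and \<rho>_r: "\<lbrakk>s \<in> S; b \<in> carrier B\<rbrakk> \<Longrightarrow> \<rho> (r s b) = ract H (\<rho> s) b"
    and \<kappa>_eq: "\<lbrakk>s \<in> S; t \<in> S\<rbrakk> \<Longrightarrow> \<kappa> s t = rinner H (\<rho> s) (\<rho> t)"
    and generating: "\<lbrakk>\<And>s. s \<in> S \<Longrightarrow> \<rho> s \<in> D;
      \<And>x y. \<lbrakk>x \<in> D; y \<in> D\<rbrakk> \<Longrightarrow> x \<oplus>\<^bsub>H\<^esub> y \<in> D; \<zero>\<^bsub>H\<^esub> \<in> D;
      \<And>z x. x \<in> D \<Longrightarrow> z \<odot>\<^bsub>H\<^esub> x \<in> D\<rbrakk> \<Longrightarrow> carrier H \<subseteq> D"
begin

abbreviation "V \<equiv> formal_sums B S l r \<kappa>"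

definition T :: "('s \<Rightarrow>\<^sub>0 complex) \<Rightarrow> 'h" where
  "T v = (\<Oplus>\<^bsub>H\<^esub> s \<in> Poly_Mapping.keys v. Poly_Mapping.lookup v s \<odot>\<^bsub>H\<^esub> \<rho> s)"

lemma smult_\<rho>_closed: "s \<in> S \<Longrightarrow> z \<odot>\<^bsub>H\<^esub> \<rho> s \<in> carrier H"
  by (simp add: \<rho>_closed)

lemma T_closed: "Poly_Mapping.keys v \<subseteq> S \<Longrightarrow> T v \<in> carrier H"
  unfolding T_def by (rule mod.M.finsum_closed) (auto simp: smult_\<rho>_closed)

text \<open>Zero coefficients contribute nothing, so several formal sums can be expanded over one
  common finite support.\<close>

lemma T_superset:
  assumes "finite K" "Poly_Mapping.keys v \<subseteq> K" "K \<subseteq> S"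
  shows "T v = (\<Oplus>\<^bsub>H\<^esub> s \<in> K. Poly_Mapping.lookup v s \<odot>\<^bsub>H\<^esub> \<rho> s)"
  unfolding T_def
proof (rule mod.M.add.finprod_mono_neutral_cong_left)
  show "Poly_Mapping.lookup v s \<odot>\<^bsub>H\<^esub> \<rho> s = \<zero>\<^bsub>H\<^esub>" if "s \<in> K - Poly_Mapping.keys v" for s
    using that assms(3) mod.smult_l_null[of "\<rho> s"] by (auto simp: in_keys_iff \<rho>_closed)
qed (use assms in \<open>auto simp: smult_\<rho>_closed\<close>)

lemma T_add:
  assumes "Poly_Mapping.keys v \<subseteq> S" "Poly_Mapping.keys w \<subseteq> S"
  shows "T (v + w) = T v \<oplus>\<^bsub>H\<^esub> T w"
proof -
  let ?K = "Poly_Mapping.keys v \<union> Poly_Mapping.keys w"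
  have K: "?K \<subseteq> S" using assms by blast
  have "T (v + w) = (\<Oplus>\<^bsub>H\<^esub> s \<in> ?K. Poly_Mapping.lookup (v + w) s \<odot>\<^bsub>H\<^esub> \<rho> s)"
    by (rule T_superset) (use K Poly_Mapping.keys_add[of v w] in auto)
  also have "\<dots> = (\<Oplus>\<^bsub>H\<^esub> s \<in> ?K. Poly_Mapping.lookup v s \<odot>\<^bsub>H\<^esub> \<rho> s \<oplus>\<^bsub>H\<^esub> Poly_Mapping.lookup w s \<odot>\<^bsub>H\<^esub> \<rho> s)"
    using K by (intro mod.M.finsum_cong')
      (auto simp: lookup_add mod.smult_l_distr[simplified] \<rho>_closed)
  also have "\<dots> = T v \<oplus>\<^bsub>H\<^esub> T w"
    using K by (subst mod.M.finsum_addf) (auto simp: smult_\<rho>_closed T_superset[of ?K])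
  finally show ?thesis .
qed

lemma lookup_scale: "Poly_Mapping.lookup (Poly_Mapping.map ((*) z) v) s = z * Poly_Mapping.lookup v s"
  for z :: complex
  by (simp add: Poly_Mapping.map.rep_eq when_def)

lemma keys_scale: "Poly_Mapping.keys (Poly_Mapping.map ((*) z) v) \<subseteq> Poly_Mapping.keys v"
  for z :: complex
  by (auto simp: in_keys_iff lookup_scale)

lemma T_scale:
  assumes "Poly_Mapping.keys v \<subseteq> S"
  shows "T (Poly_Mapping.map ((*) z) v) = z \<odot>\<^bsub>H\<^esub> T v"
proof -
  have "T (Poly_Mapping.map ((*) z) v)
    = (\<Oplus>\<^bsub>H\<^esub> s \<in> Poly_Mapping.keys v. Poly_Mapping.lookup (Poly_Mapping.map ((*) z) v) s \<odot>\<^bsub>H\<^esub> \<rho> s)"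
    by (rule T_superset) (use assms keys_scale[of z v] in auto)
  also have "\<dots> = (\<Oplus>\<^bsub>H\<^esub> s \<in> Poly_Mapping.keys v. z \<odot>\<^bsub>H\<^esub> (Poly_Mapping.lookup v s \<odot>\<^bsub>H\<^esub> \<rho> s))"
    using assms by (intro mod.M.finsum_cong')
      (auto simp: lookup_scale mod.smult_assoc1[simplified] \<rho>_closed)
  also have "\<dots> = z \<odot>\<^bsub>H\<^esub> T v"
    unfolding T_def using assms by (subst mod.finsum_smult_ldistr) (auto simp: smult_\<rho>_closed)
  finally show ?thesis .
qed

lemma T_single: "s \<in> S \<Longrightarrow> T (Poly_Mapping.single s z) = z \<odot>\<^bsub>H\<^esub> \<rho> s"
  by (subst T_superset[of "{s}"]) (auto simp: smult_\<rho>_closed)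

lemma keys_formal_map:
  assumes "\<And>s. s \<in> S \<Longrightarrow> g s \<in> S" "Poly_Mapping.keys v \<subseteq> S"
  shows "Poly_Mapping.keys (formal_map g v) \<subseteq> S"
proof -
  have "Poly_Mapping.keys (formal_map g v)
    \<subseteq> (\<Union>s\<in>Poly_Mapping.keys v. Poly_Mapping.keys (Poly_Mapping.single (g s) (Poly_Mapping.lookup v s)))"
    unfolding formal_map_def by (rule Poly_Mapping.keys_sum)
  also have "\<dots> \<subseteq> S" using assms by (auto split: if_splits)
  finally show ?thesis .
qed

text \<open>\<open>g\<close> may send different keys to the same one, where coefficients add up.
  Hence the terms are added one at a time with \<open>T_add\<close> instead of reindexing the sum,
  and the induction carries along the support condition that \<open>T_add\<close> requires.\<close>

lemma T_formal_map:
  assumes g: "\<And>s. s \<in> S \<Longrightarrow> g s \<in> S" and v: "Poly_Mapping.keys v \<subseteq> S"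
  shows "T (formal_map g v) = (\<Oplus>\<^bsub>H\<^esub> s \<in> Poly_Mapping.keys v. Poly_Mapping.lookup v s \<odot>\<^bsub>H\<^esub> \<rho> (g s))"
proof -
  have "T (\<Sum>s\<in>K. Poly_Mapping.single (g s) (Poly_Mapping.lookup v s))
      = (\<Oplus>\<^bsub>H\<^esub> s \<in> K. Poly_Mapping.lookup v s \<odot>\<^bsub>H\<^esub> \<rho> (g s)) \<and>
      Poly_Mapping.keys (\<Sum>s\<in>K. Poly_Mapping.single (g s) (Poly_Mapping.lookup v s)) \<subseteq> S"
    if "finite K" "K \<subseteq> S" for K
    using that
  proof (induction K rule: finite_induct)
    case empty
    show ?case by (simp add: T_def)
  next
    case (insert s K)
    let ?t = "Poly_Mapping.single (g s) (Poly_Mapping.lookup v s)"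
      and ?w = "\<Sum>s\<in>K. Poly_Mapping.single (g s) (Poly_Mapping.lookup v s)"
    have keys: "Poly_Mapping.keys ?t \<subseteq> S" "Poly_Mapping.keys ?w \<subseteq> S"
      using insert g by auto
    have "Poly_Mapping.keys (?t + ?w) \<subseteq> S" using Poly_Mapping.keys_add[of ?t ?w] keys by blast
    moreover have "T (?t + ?w) = Poly_Mapping.lookup v s \<odot>\<^bsub>H\<^esub> \<rho> (g s) \<oplus>\<^bsub>H\<^esub>
        (\<Oplus>\<^bsub>H\<^esub> s \<in> K. Poly_Mapping.lookup v s \<odot>\<^bsub>H\<^esub> \<rho> (g s))"
      using insert g by (subst T_add[OF keys]) (simp add: T_single)
    moreover have "(\<Oplus>\<^bsub>H\<^esub> s \<in> insert s K. Poly_Mapping.lookup v s \<odot>\<^bsub>H\<^esub> \<rho> (g s)) = Poly_Mapping.lookup v s \<odot>\<^bsub>H\<^esub> \<rho> (g s) \<oplus>\<^bsub>H\<^esub>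
        (\<Oplus>\<^bsub>H\<^esub> s \<in> K. Poly_Mapping.lookup v s \<odot>\<^bsub>H\<^esub> \<rho> (g s))"
      using insert g by (intro mod.M.finsum_insert) (auto intro!: smult_\<rho>_closed)
    ultimately show ?case using insert.hyps by simp
  qed
  thus ?thesis unfolding formal_map_def using v by simp
qed

lemma T_lact:
  assumes "a \<in> carrier A" "Poly_Mapping.keys v \<subseteq> S"
  shows "T (formal_map (l a) v) = lact H a (T v)"
proof -
  have "T (formal_map (l a) v) = (\<Oplus>\<^bsub>H\<^esub> s \<in> Poly_Mapping.keys v. Poly_Mapping.lookup v s \<odot>\<^bsub>H\<^esub> \<rho> (l a s))"
    using assms by (intro T_formal_map l_closed)
  also have "\<dots> = (\<Oplus>\<^bsub>H\<^esub> s \<in> Poly_Mapping.keys v. lact H a (Poly_Mapping.lookup v s \<odot>\<^bsub>H\<^esub> \<rho> s))"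
    using assms by (intro mod.M.finsum_cong')
      (auto simp: \<rho>_l lact_smult_right \<rho>_closed lact_closed)
  also have "\<dots> = lact H a (T v)"
    unfolding T_def using assms by (subst lact_finsum) (auto simp: smult_\<rho>_closed)
  finally show ?thesis .
qed

lemma T_ract:
  assumes "b \<in> carrier B" "Poly_Mapping.keys v \<subseteq> S"
  shows "T (formal_map (\<lambda>s. r s b) v) = ract H (T v) b"
proof -
  have "T (formal_map (\<lambda>s. r s b) v) = (\<Oplus>\<^bsub>H\<^esub> s \<in> Poly_Mapping.keys v. Poly_Mapping.lookup v s \<odot>\<^bsub>H\<^esub> \<rho> (r s b))"
    using assms by (intro T_formal_map r_closed)
  also have "\<dots> = (\<Oplus>\<^bsub>H\<^esub> s \<in> Poly_Mapping.keys v. ract H (Poly_Mapping.lookup v s \<odot>\<^bsub>H\<^esub> \<rho> s) b)"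
    using assms by (intro mod.M.finsum_cong')
      (auto simp: \<rho>_r ract_smult_left \<rho>_closed ract_closed)
  also have "\<dots> = ract H (T v) b"
    unfolding T_def using assms by (subst ract_finsum) (auto simp: smult_\<rho>_closed)
  finally show ?thesis .
qed

lemma T_rinner:
  assumes v: "Poly_Mapping.keys v \<subseteq> S" and w: "Poly_Mapping.keys w \<subseteq> S"
  shows "rinner V v w = rinner H (T v) (T w)"
proof -
  have "rinner H (T v) (T w) = (\<Oplus>\<^bsub>B\<^esub> s \<in> Poly_Mapping.keys v.
      rinner H (Poly_Mapping.lookup v s \<odot>\<^bsub>H\<^esub> \<rho> s) (T w))"
    using v T_closed[OF w] unfolding T_def[of v] by (intro rinner_finsum_left) (auto simp: smult_\<rho>_closed)
  also have "\<dots> = (\<Oplus>\<^bsub>B\<^esub> s \<in> Poly_Mapping.keys v. \<Oplus>\<^bsub>B\<^esub> t \<in> Poly_Mapping.keys w.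
      rinner H (Poly_Mapping.lookup v s \<odot>\<^bsub>H\<^esub> \<rho> s) (Poly_Mapping.lookup w t \<odot>\<^bsub>H\<^esub> \<rho> t))"
  proof (rule B.mod.M.finsum_cong')
    show "rinner H (Poly_Mapping.lookup v s \<odot>\<^bsub>H\<^esub> \<rho> s) (T w) = (\<Oplus>\<^bsub>B\<^esub> t \<in> Poly_Mapping.keys w.
      rinner H (Poly_Mapping.lookup v s \<odot>\<^bsub>H\<^esub> \<rho> s) (Poly_Mapping.lookup w t \<odot>\<^bsub>H\<^esub> \<rho> t))"
      if "s \<in> Poly_Mapping.keys v" for s
      using v w that unfolding T_def[of w] by (intro rinner_finsum_right) (auto simp: smult_\<rho>_closed)
  qed (use v w in \<open>auto intro!: B.mod.M.finsum_closed rinner_closed smult_\<rho>_closed\<close>)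
  also have "\<dots> = rinner V v w"
    unfolding formal_sums_simps
  proof (rule B.mod.M.finsum_cong')
    fix s assume s: "s \<in> Poly_Mapping.keys v"
    show "(\<Oplus>\<^bsub>B\<^esub> t \<in> Poly_Mapping.keys w.
        rinner H (Poly_Mapping.lookup v s \<odot>\<^bsub>H\<^esub> \<rho> s) (Poly_Mapping.lookup w t \<odot>\<^bsub>H\<^esub> \<rho> t))
      = (\<Oplus>\<^bsub>B\<^esub> t \<in> Poly_Mapping.keys w. (cnj (Poly_Mapping.lookup v s) * Poly_Mapping.lookup w t) \<odot>\<^bsub>B\<^esub> \<kappa> s t)"
      using s v w by (intro B.mod.M.finsum_cong')
        (auto simp: rinner_smult_left rinner_smult_right \<kappa>_eq \<rho>_closed rinner_closed subset_iff mult.commute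
          simp flip: B.mod.smult_assoc1[simplified])
  qed (use v w in \<open>auto intro!: B.mod.M.finsum_closed rinner_closed \<rho>_closed simp: \<kappa>_eq rinner_closed \<rho>_closed subset_iff\<close>)
  finally show ?thesis ..
qed

sublocale isometric_quotient A B H V T
proof (intro isometric_quotient.intro correspondence_axioms isometric_quotient_axioms.intro)
  show "abelian_group V"
  proof (rule abelian_groupI)
    show "x \<oplus>\<^bsub>V\<^esub> y \<in> carrier V" if "x \<in> carrier V" "y \<in> carrier V" for x y
      using that Poly_Mapping.keys_add[of x y] by auto
    show "\<exists>y\<in>carrier V. y \<oplus>\<^bsub>V\<^esub> x = \<zero>\<^bsub>V\<^esub>" if "x \<in> carrier V" for x
      using that by (intro bexI[of _ "- x"]) (auto simp: in_keys_iff)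
  qed (simp_all add: algebra_simps)
  show "\<exists>v\<in>carrier V. T v = h" if "h \<in> carrier H" for h
  proof -
    \<comment> \<open>The image of \<open>T\<close> is a subspace containing all values of
      \<open>\<rho>\<close>, so \<open>generating\<close> makes it all of \<open>H\<close>.\<close>
    have "carrier H \<subseteq> T ` carrier V"
    proof (rule generating)
      show "\<rho> s \<in> T ` carrier V" if "s \<in> S" for s
        using that by (intro image_eqI[of _ _ "Poly_Mapping.single s 1"])
          (auto simp: T_single \<rho>_closed mod.smult_one[simplified])
    next
      fix x y assume "x \<in> T ` carrier V" "y \<in> T ` carrier V"
      then obtain v w where "x = T v" "y = T w" "Poly_Mapping.keys v \<subseteq> S" "Poly_Mapping.keys w \<subseteq> S" by auto
      thus "x \<oplus>\<^bsub>H\<^esub> y \<in> T ` carrier V"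
        using Poly_Mapping.keys_add[of v w] by (intro image_eqI[of _ _ "v + w"]) (auto simp: T_add)
    next
      fix z x assume "x \<in> T ` carrier V"
      then obtain v where "x = T v" "Poly_Mapping.keys v \<subseteq> S" by auto
      thus "z \<odot>\<^bsub>H\<^esub> x \<in> T ` carrier V"
        using keys_scale[of z v] by (intro image_eqI[of _ _ "Poly_Mapping.map ((*) z) v"]) (auto simp: T_scale)
    next
      show "\<zero>\<^bsub>H\<^esub> \<in> T ` carrier V"
        by (intro image_eqI[of _ _ 0]) (simp_all add: T_def)
    qed
    thus ?thesis using that by blast
  qed
  show "z \<odot>\<^bsub>V\<^esub> x \<in> carrier V" if "x \<in> carrier V" for x z
    using that keys_scale[of z x] by auto
qed (simp_all only: formal_sums_simps mem_Collect_eq keys_formal_map l_closed r_closed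
    T_add T_scale T_lact T_ract T_closed T_rinner[unfolded formal_sums_simps])

end

section \<open>Finite direct sums of a correspondence\<close>

text \<open>Both assumptions hold in every C*-algebra, but in general they rest on the spectral theorem.\<close>

locale monotone_cstar_algebra = cstar_algebra A
  for A :: "('a, 'z) star_alg_scheme" +
  assumes positive_add: "\<lbrakk>cstar_positive A a; cstar_positive A b\<rbrakk> \<Longrightarrow> cstar_positive A (a \<oplus>\<^bsub>A\<^esub> b)"
    and nrm_mono: "\<lbrakk>cstar_positive A a; cstar_positive A b\<rbrakk> \<Longrightarrow> nrm A a \<le> nrm A (a \<oplus>\<^bsub>A\<^esub> b)"

context cstar_algebra
begin

lemma mult_zero_left: "a \<in> carrier A \<Longrightarrow> \<zero>\<^bsub>A\<^esub> \<otimes>\<^bsub>A\<^esub> a = \<zero>\<^bsub>A\<^esub>"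
  using group_hom_zero_minus(1)[of A A "\<lambda>b. b \<otimes>\<^bsub>A\<^esub> a"]
  by (simp add: mod.abelian_group_axioms mult_closed mult_add_left)

lemma star_zero: "star A \<zero>\<^bsub>A\<^esub> = \<zero>\<^bsub>A\<^esub>"
  using group_hom_zero_minus(1)[of A A "star A"]
  by (simp add: mod.abelian_group_axioms star_closed star_add)

lemma mult_finsum_left:
  "\<lbrakk>a \<in> carrier A; f \<in> I \<rightarrow> carrier A\<rbrakk> \<Longrightarrow> finsum A f I \<otimes>\<^bsub>A\<^esub> a = (\<Oplus>\<^bsub>A\<^esub> i \<in> I. f i \<otimes>\<^bsub>A\<^esub> a)"
  by (rule finsum_hom) (simp_all add: mod.M.abelian_monoid_axioms mult_closed mult_add_left mult_zero_left)

lemma star_finsum: "f \<in> I \<rightarrow> carrier A \<Longrightarrow> star A (finsum A f I) = (\<Oplus>\<^bsub>A\<^esub> i \<in> I. star A (f i))"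
  by (rule finsum_hom) (simp_all add: mod.M.abelian_monoid_axioms star_closed star_add star_zero)

lemma positive_zero: "cstar_positive A \<zero>\<^bsub>A\<^esub>"
  unfolding cstar_positive_def
  by (rule bexI[of _ "\<zero>\<^bsub>A\<^esub>"]) (simp_all add: star_zero mult_zero_left)

lemma positive_closed: "cstar_positive A a \<Longrightarrow> a \<in> carrier A"
  by (auto simp: cstar_positive_def star_closed mult_closed)

lemma nrm_finsum_le:
  assumes "finite I" "f \<in> I \<rightarrow> carrier A"
  shows "nrm A (finsum A f I) \<le> (\<Sum>i\<in>I. nrm A (f i))"
  using assms
proof (induction I rule: finite_induct)
  case empty
  show ?case using nrm_eq_0[of "\<zero>\<^bsub>A\<^esub>"] by simp
next
  case (insert i I)
  have "nrm A (finsum A f (insert i I)) = nrm A (f i \<oplus>\<^bsub>A\<^esub> finsum A f I)"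
    using insert by (subst mod.M.finsum_insert) auto
  also have "\<dots> \<le> nrm A (f i) + nrm A (finsum A f I)"
    using insert.prems by (intro nrm_add mod.M.finsum_closed) auto
  finally show ?case using insert by auto
qed

end

context monotone_cstar_algebra
begin

lemma positive_finsum:
  assumes "\<And>i. i \<in> I \<Longrightarrow> cstar_positive A (f i)"
  shows "cstar_positive A (finsum A f I)"
  using assms
proof (induction I rule: infinite_finite_induct)
  case (insert i I)
  hence "f \<in> I \<rightarrow> carrier A" "f i \<in> carrier A" by (auto intro!: positive_closed)
  thus ?case using insert by (simp add: positive_add)
qed (simp_all add: positive_zero mod.M.finsum_infinite)

text \<open>Splitting off the \<open>i\<close>-th term leaves a positive remainder, so
  \<open>nrm_mono\<close> applies. In a direct sum this bounds each coordinate by the norm of the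
  whole tuple.\<close>

lemma nrm_le_finsum:
  assumes "finite I" "i \<in> I" "\<And>i. i \<in> I \<Longrightarrow> cstar_positive A (f i)"
  shows "nrm A (f i) \<le> nrm A (finsum A f I)"
proof -
  have "finsum A f (insert i (I - {i})) = f i \<oplus>\<^bsub>A\<^esub> finsum A f (I - {i})"
    using assms by (intro mod.M.finsum_insert) (auto intro!: positive_closed)
  moreover have "nrm A (f i) \<le> nrm A (f i \<oplus>\<^bsub>A\<^esub> finsum A f (I - {i}))"
    using assms by (intro nrm_mono positive_finsum) auto
  ultimately show ?thesis using assms(2) by (simp add: insert_absorb)
qed

end

lemma a_minus_cong:
  assumes "carrier G = carrier H" "add G = add H" "\<zero>\<^bsub>G\<^esub> = \<zero>\<^bsub>H\<^esub>"
  shows "x \<ominus>\<^bsub>G\<^esub> y = x \<ominus>\<^bsub>H\<^esub> y"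
  using assms by (simp add: a_minus_def a_inv_def m_inv_def)

text \<open>Its amplifications are the free modules over \<open>A\<close>: over matrices they are
  the model of the GNS-correspondence, over the complex numbers they are the Hilbert spaces of the
  theorem.\<close>

definition identity_corr :: "('a, 'z) star_alg_scheme \<Rightarrow> ('a, 'a, 'a) corr" where
  "identity_corr A =
    \<lparr>carrier = carrier A, monoid.mult = undefined, one = undefined, ring.zero = \<zero>\<^bsub>A\<^esub>, add = add A,
     smult = smult A, ract = monoid.mult A, rinner = (\<lambda>a b. star A a \<otimes>\<^bsub>A\<^esub> b), lact = monoid.mult A\<rparr>"

lemma identity_corr_simps [simp]:
  "carrier (identity_corr A) = carrier A" "\<zero>\<^bsub>identity_corr A\<^esub> = \<zero>\<^bsub>A\<^esub>" "add (identity_corr A) = add A"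
  "smult (identity_corr A) = smult A" "ract (identity_corr A) = monoid.mult A"
  "rinner (identity_corr A) a b = star A a \<otimes>\<^bsub>A\<^esub> b" "lact (identity_corr A) = monoid.mult A"
  by (simp_all add: identity_corr_def)

text \<open>By the C*-identity the module norm is the norm of the algebra, which yields definiteness
  and completeness.\<close>

lemma (in cstar_algebra) correspondence_identity: "correspondence A A (identity_corr A)"
proof (intro correspondence.intro hilbert_module.intro correspondence_axioms.intro
      hilbert_module_axioms.intro cstar_algebra_axioms)
  show "Module.module complex_ring (identity_corr A)"
  proof (rule complex_moduleI)
    show "abelian_group (identity_corr A)"
    proof (rule abelian_groupI)
      show "\<exists>y\<in>carrier (identity_corr A). y \<oplus>\<^bsub>identity_corr A\<^esub> x = \<zero>\<^bsub>identity_corr A\<^esub>"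
        if "x \<in> carrier (identity_corr A)" for x
        using that by (intro bexI[of _ "\<ominus>\<^bsub>A\<^esub> x"]) (simp_all add: mod.M.l_neg)
    qed (simp_all add: mod.M.a_ac)
  qed (simp_all add: mod.smult_l_distr[simplified] mod.smult_r_distr[simplified]
          mod.smult_assoc1[simplified] mod.smult_one[simplified])
  have norm: "hnorm A (identity_corr A) x = nrm A x" if "x \<in> carrier A" for x
    using that by (simp add: hnorm_def cstar_identity nrm_nonneg)
  have minus: "x \<ominus>\<^bsub>identity_corr A\<^esub> y = x \<ominus>\<^bsub>A\<^esub> y" for x y
    by (rule a_minus_cong) simp_all
  show "norm_complete (identity_corr A) (hnorm A (identity_corr A))"
    using complete unfolding norm_complete_def norm_Cauchy_def norm_tendsto_def
    by (auto simp: minus norm cong: conj_cong)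
  show "x = \<zero>\<^bsub>identity_corr A\<^esub>"
    if "x \<in> carrier (identity_corr A)" "rinner (identity_corr A) x x = \<zero>\<^bsub>A\<^esub>" for x
    using that cstar_identity[of x] nrm_eq_0[of x] nrm_eq_0[of "\<zero>\<^bsub>A\<^esub>"] by simp
  show "cstar_positive A (rinner (identity_corr A) x x)" if "x \<in> carrier (identity_corr A)" for x
    using that by (auto simp: cstar_positive_def)
  show "is_adjoint (identity_corr A) (lact (identity_corr A) a) (lact (identity_corr A) (star A a))"
    if "a \<in> carrier A" for a
    using that by (simp add: is_adjoint_def star_closed star_mult mult_closed mult_assoc)
qed (simp_all add: mult_closed mult_assoc mult_add_left mult_add_right mult_smult_left mult_smult_right
      star_closed star_mult star_star)

text \<open>Tuples are sequences padded with zeros, so equal tuples are equal functions; the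
  encoding agrees with that of \<open>hilbert_space\<close>.\<close>

definition amplification ::
    "nat \<Rightarrow> ('b, 'y) star_alg_scheme \<Rightarrow> ('a, 'b, 'x, 'z) corr_scheme \<Rightarrow> ('a, 'b, nat \<Rightarrow> 'x) corr" where
  "amplification d B E =
    \<lparr>carrier = {v. (\<forall>i. v i \<in> carrier E) \<and> (\<forall>i\<ge>d. v i = \<zero>\<^bsub>E\<^esub>)},
     monoid.mult = undefined, one = undefined,
     ring.zero = (\<lambda>i. \<zero>\<^bsub>E\<^esub>), add = (\<lambda>v w i. v i \<oplus>\<^bsub>E\<^esub> w i),
     smult = (\<lambda>z v i. z \<odot>\<^bsub>E\<^esub> v i),
     ract = (\<lambda>v b i. ract E (v i) b),
     rinner = (\<lambda>v w. \<Oplus>\<^bsub>B\<^esub> i \<in> {..<d}. rinner E (v i) (w i)),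
     lact = (\<lambda>a v i. lact E a (v i))\<rparr>"

lemma amplification_simps [simp]:
  "carrier (amplification d B E) = {v. (\<forall>i. v i \<in> carrier E) \<and> (\<forall>i\<ge>d. v i = \<zero>\<^bsub>E\<^esub>)}"
  "\<zero>\<^bsub>amplification d B E\<^esub> = (\<lambda>i. \<zero>\<^bsub>E\<^esub>)"
  "v \<oplus>\<^bsub>amplification d B E\<^esub> w = (\<lambda>i. v i \<oplus>\<^bsub>E\<^esub> w i)"
  "z \<odot>\<^bsub>amplification d B E\<^esub> v = (\<lambda>i. z \<odot>\<^bsub>E\<^esub> v i)"
  "ract (amplification d B E) v b = (\<lambda>i. ract E (v i) b)"
  "rinner (amplification d B E) v w = (\<Oplus>\<^bsub>B\<^esub> i \<in> {..<d}. rinner E (v i) (w i))"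
  "lact (amplification d B E) a v = (\<lambda>i. lact E a (v i))"
  by (simp_all add: amplification_def)

section \<open>Norm, convergence and completeness of finite direct sums\<close>

locale amplifiable = correspondence A B E + B: monotone_cstar_algebra B
  for A :: "('a, 'w) star_alg_scheme"
    and B :: "('b, 'y) star_alg_scheme"
    and E :: "('a, 'b, 'x, 'z) corr_scheme"
begin

abbreviation "amp d \<equiv> amplification d B E"

lemma abelian_group_amplification: "abelian_group (amp d)"
proof (rule abelian_groupI)
  show "\<exists>y\<in>carrier (amp d). y \<oplus>\<^bsub>amp d\<^esub> x = \<zero>\<^bsub>amp d\<^esub>" if "x \<in> carrier (amp d)" for x
    using that by (intro bexI[of _ "\<lambda>i. \<ominus>\<^bsub>E\<^esub> x i"]) (simp_all add: mod.M.l_neg)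
qed (auto simp: mod.M.a_ac)

lemma amplification_minus:
  assumes "x \<in> carrier (amp d)" "y \<in> carrier (amp d)"
  shows "x \<ominus>\<^bsub>amp d\<^esub> y = (\<lambda>i. x i \<ominus>\<^bsub>E\<^esub> y i)"
proof
  interpret D: abelian_group "amp d" by (rule abelian_group_amplification)
  show "(x \<ominus>\<^bsub>amp d\<^esub> y) i = x i \<ominus>\<^bsub>E\<^esub> y i" for i
    using group_hom_zero_minus(2)[OF D.abelian_group_axioms mod.abelian_group_axioms, of "\<lambda>v. v i"] assms
    by simp
qed

lemma hnorm_nonneg: "x \<in> carrier E \<Longrightarrow> 0 \<le> hnorm B E x"
  by (simp add: hnorm_def B.nrm_nonneg rinner_closed)

text \<open>The norm of a tuple is in general neither the maximum nor the Euclidean norm of the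
  coordinate norms. This bound and \<open>hnorm_amplification_le\<close> enclose it between the two,
  which reduces convergence to the coordinates.\<close>

lemma hnorm_le_amplification:
  assumes "x \<in> carrier (amp d)" "i < d"
  shows "hnorm B E (x i) \<le> hnorm B (amp d) x"
  unfolding hnorm_def amplification_simps
  using assms B.nrm_le_finsum[of "{..<d}" i "\<lambda>i. rinner E (x i) (x i)"]
  by (simp add: rinner_positive)

lemma hnorm_amplification_le:
  assumes "x \<in> carrier (amp d)"
  shows "hnorm B (amp d) x \<le> sqrt (\<Sum>i<d. (hnorm B E (x i))\<^sup>2)"
  unfolding hnorm_def amplification_simps
  using assms B.nrm_finsum_le[of "{..<d}" "\<lambda>i. rinner E (x i) (x i)"]
  by (simp add: rinner_closed B.nrm_nonneg)

lemma norm_tendsto_amplification: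
  assumes s: "\<And>n. s n \<in> carrier (amp d)" and l: "l \<in> carrier (amp d)"
  shows "norm_tendsto (amp d) (hnorm B (amp d)) s l \<longleftrightarrow>
    (\<forall>i<d. norm_tendsto E (hnorm B E) (\<lambda>n. s n i) (l i))"
proof (intro iffI allI impI)
  interpret D: abelian_group "amp d" by (rule abelian_group_amplification)
  have minus: "s n \<ominus>\<^bsub>amp d\<^esub> l = (\<lambda>i. s n i \<ominus>\<^bsub>E\<^esub> l i)" for n
    by (rule amplification_minus[OF s l])
  have closed: "s n i \<in> carrier E" "l i \<in> carrier E" for n i using s l by auto
  have minus_closed: "s n \<ominus>\<^bsub>amp d\<^esub> l \<in> carrier (amp d)" for n
    by (rule D.minus_closed[OF s l])
  {
    fix i assume lim: "norm_tendsto (amp d) (hnorm B (amp d)) s l" and i: "i < d"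
    have "(\<lambda>n. hnorm B E (s n i \<ominus>\<^bsub>E\<^esub> l i)) \<longlonglongrightarrow> 0"
    proof (rule Lim_null_comparison)
      show "(\<lambda>n. hnorm B (amp d) (s n \<ominus>\<^bsub>amp d\<^esub> l)) \<longlonglongrightarrow> 0"
        using lim by (simp add: norm_tendsto_def)
      show "\<forall>\<^sub>F n in sequentially. norm (hnorm B E (s n i \<ominus>\<^bsub>E\<^esub> l i)) \<le> hnorm B (amp d) (s n \<ominus>\<^bsub>amp d\<^esub> l)"
        using hnorm_le_amplification[OF minus_closed i] by (simp add: minus hnorm_nonneg closed)
    qed
    thus "norm_tendsto E (hnorm B E) (\<lambda>n. s n i) (l i)" by (simp add: norm_tendsto_def closed)
  }
  assume lim: "\<forall>i<d. norm_tendsto E (hnorm B E) (\<lambda>n. s n i) (l i)"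
  have "(\<lambda>n. sqrt (\<Sum>i<d. (hnorm B E (s n i \<ominus>\<^bsub>E\<^esub> l i))\<^sup>2)) \<longlonglongrightarrow> sqrt (\<Sum>i<d. 0\<^sup>2)"
    using lim by (intro tendsto_intros) (auto simp: norm_tendsto_def)
  hence "(\<lambda>n. sqrt (\<Sum>i<d. (hnorm B E (s n i \<ominus>\<^bsub>E\<^esub> l i))\<^sup>2)) \<longlonglongrightarrow> 0" by simp
  moreover have "hnorm B (amp d) (s n \<ominus>\<^bsub>amp d\<^esub> l) \<ge> 0" for n
    using minus_closed[of n] unfolding hnorm_def
    by (auto intro!: B.nrm_nonneg B.mod.M.finsum_closed simp: rinner_closed)
  ultimately have "(\<lambda>n. hnorm B (amp d) (s n \<ominus>\<^bsub>amp d\<^esub> l)) \<longlonglongrightarrow> 0"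
    using hnorm_amplification_le[OF minus_closed]
    by (intro Lim_null_comparison[of "\<lambda>n. hnorm B (amp d) (s n \<ominus>\<^bsub>amp d\<^esub> l)"
          "\<lambda>n. sqrt (\<Sum>i<d. (hnorm B E (s n i \<ominus>\<^bsub>E\<^esub> l i))\<^sup>2)"]) (simp_all add: minus)
  thus "norm_tendsto (amp d) (hnorm B (amp d)) s l" using l by (simp add: norm_tendsto_def)
qed

lemma norm_Cauchy_amplification:
  assumes "norm_Cauchy (amp d) (hnorm B (amp d)) s" "i < d"
  shows "norm_Cauchy E (hnorm B E) (\<lambda>n. s n i)"
proof -
  interpret D: abelian_group "amp d" by (rule abelian_group_amplification)
  have s: "s n \<in> carrier (amp d)" for n using assms(1) unfolding norm_Cauchy_def by blast
  have minus: "s m \<ominus>\<^bsub>amp d\<^esub> s n = (\<lambda>i. s m i \<ominus>\<^bsub>E\<^esub> s n i)" for m n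
    by (rule amplification_minus[OF s s])
  have le: "hnorm B E (s m i \<ominus>\<^bsub>E\<^esub> s n i) \<le> hnorm B (amp d) (s m \<ominus>\<^bsub>amp d\<^esub> s n)" for m n
    using hnorm_le_amplification[OF D.minus_closed[OF s s] assms(2), of m n] by (simp add: minus)
  show ?thesis
    unfolding norm_Cauchy_def
  proof (intro conjI allI impI)
    show "s n i \<in> carrier E" for n using s by auto
    fix e :: real assume "e > 0"
    then obtain N where "\<And>m n. m \<ge> N \<Longrightarrow> n \<ge> N \<Longrightarrow> hnorm B (amp d) (s m \<ominus>\<^bsub>amp d\<^esub> s n) < e"
      using assms(1) unfolding norm_Cauchy_def by blast
    thus "\<exists>N. \<forall>m\<ge>N. \<forall>n\<ge>N. hnorm B E (s m i \<ominus>\<^bsub>E\<^esub> s n i) < e"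
      using le by (meson le_less_trans)
  qed
qed

lemma norm_Cauchy_amplificationI:
  assumes s: "\<And>n. s n \<in> carrier (amp d)"
    and Cauchy: "\<And>i. i < d \<Longrightarrow> norm_Cauchy E (hnorm B E) (\<lambda>n. s n i)"
  shows "norm_Cauchy (amp d) (hnorm B (amp d)) s"
  unfolding norm_Cauchy_def
proof (intro conjI allI impI s)
  interpret D: abelian_group "amp d" by (rule abelian_group_amplification)
  fix e :: real assume "e > 0"
  \<comment> \<open>Dividing by \<open>d + 1\<close> covers \<open>d = 0\<close> and keeps the final
    inequality strict.\<close>
  hence e: "e / (real d + 1) > 0" by simp
  have "\<forall>i\<in>{..<d}. \<exists>N. \<forall>m\<ge>N. \<forall>n\<ge>N. hnorm B E (s m i \<ominus>\<^bsub>E\<^esub> s n i) < e / (real d + 1)"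
    using Cauchy e unfolding norm_Cauchy_def by blast
  then obtain N where N: "\<forall>i\<in>{..<d}. \<forall>m\<ge>N i. \<forall>n\<ge>N i. hnorm B E (s m i \<ominus>\<^bsub>E\<^esub> s n i) < e / (real d + 1)"
    by (rule bchoice[THEN exE])
  \<comment> \<open>The sum of the thresholds \<open>N i\<close> dominates each of them.\<close>
  have "hnorm B (amp d) (s m \<ominus>\<^bsub>amp d\<^esub> s n) < e" if mn: "m \<ge> (\<Sum>i<d. N i)" "n \<ge> (\<Sum>i<d. N i)" for m n
  proof -
    have closed: "s m i \<ominus>\<^bsub>E\<^esub> s n i \<in> carrier E" for i using s by auto
    have "hnorm B (amp d) (s m \<ominus>\<^bsub>amp d\<^esub> s n) \<le> L2_set (\<lambda>i. hnorm B E (s m i \<ominus>\<^bsub>E\<^esub> s n i)) {..<d}"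
      using hnorm_amplification_le[OF D.minus_closed[OF s s], of m n]
      by (simp add: amplification_minus[OF s s] L2_set_def)
    also have "\<dots> \<le> (\<Sum>i<d. hnorm B E (s m i \<ominus>\<^bsub>E\<^esub> s n i))"
      by (rule L2_set_le_sum) (simp add: hnorm_nonneg closed)
    also have "\<dots> \<le> (\<Sum>i<d. e / (real d + 1))"
    proof (rule sum_mono)
      fix i assume i: "i \<in> {..<d}"
      hence "N i \<le> (\<Sum>i<d. N i)" by (intro member_le_sum) auto
      hence "m \<ge> N i" "n \<ge> N i" using mn by linarith+
      thus "hnorm B E (s m i \<ominus>\<^bsub>E\<^esub> s n i) \<le> e / (real d + 1)" using N i by (simp add: less_imp_le)
    qed
    also have "\<dots> < e" using \<open>e > 0\<close> by (simp add: field_simps)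
    finally show ?thesis .
  qed
  thus "\<exists>N. \<forall>m\<ge>N. \<forall>n\<ge>N. hnorm B (amp d) (s m \<ominus>\<^bsub>amp d\<^esub> s n) < e" by blast
qed

lemma norm_complete_amplification: "norm_complete (amp d) (hnorm B (amp d))"
  unfolding norm_complete_def
proof (intro allI impI)
  fix s assume s: "norm_Cauchy (amp d) (hnorm B (amp d)) s"
  have "\<exists>l. norm_tendsto E (hnorm B E) (\<lambda>n. s n i) l" if "i < d" for i
    using norm_Cauchy_amplification[OF s that] complete unfolding norm_complete_def by blast
  then obtain l where l: "\<And>i. i < d \<Longrightarrow> norm_tendsto E (hnorm B E) (\<lambda>n. s n i) (l i)" by metis
  define l' where "l' i = (if i < d then l i else \<zero>\<^bsub>E\<^esub>)" for i
  have "l' \<in> carrier (amp d)" using l by (auto simp: l'_def norm_tendsto_def)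
  hence "norm_tendsto (amp d) (hnorm B (amp d)) s l'"
    using s l by (subst norm_tendsto_amplification) (auto simp: norm_Cauchy_def l'_def)
  thus "\<exists>l. norm_tendsto (amp d) (hnorm B (amp d)) s l" by blast
qed

lemma correspondence_amplification: "correspondence A B (amp d)"
proof (intro correspondence.intro hilbert_module.intro correspondence_axioms.intro
      hilbert_module_axioms.intro A.cstar_algebra_axioms B.cstar_algebra_axioms)
  show "Module.module complex_ring (amp d)"
    by (rule complex_moduleI[OF abelian_group_amplification])
      (auto simp: mod.smult_l_distr[simplified] mod.smult_r_distr[simplified]
          mod.smult_assoc1[simplified] mod.smult_one[simplified])
  show "norm_complete (amp d) (hnorm B (amp d))" by (rule norm_complete_amplification)
  show "x = \<zero>\<^bsub>amp d\<^esub>" if x: "x \<in> carrier (amp d)" "rinner (amp d) x x = \<zero>\<^bsub>B\<^esub>" for x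
  proof -
    have "x i = \<zero>\<^bsub>E\<^esub>" if "i < d" for i
    proof -
      \<comment> \<open>When positive terms add up to zero, the norm of each is at most the norm of
        zero.\<close>
      have "nrm B (rinner E (x i) (x i)) \<le> nrm B \<zero>\<^bsub>B\<^esub>"
        using B.nrm_le_finsum[of "{..<d}" i "\<lambda>i. rinner E (x i) (x i)"] that x
        by (simp add: rinner_positive)
      moreover have "rinner E (x i) (x i) \<in> carrier B" using x by (simp add: rinner_closed)
      ultimately have "rinner E (x i) (x i) = \<zero>\<^bsub>B\<^esub>"
        using B.nrm_eq_0[of "\<zero>\<^bsub>B\<^esub>"] B.nrm_eq_0 B.nrm_nonneg by (metis B.mod.M.zero_closed order_antisym)
      thus ?thesis using x by (intro rinner_definite) auto
    qed
    thus ?thesis using x(1) by (auto simp: fun_eq_iff not_less) (metis not_less)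
  qed
  show "is_adjoint (amp d) (lact (amp d) a) (lact (amp d) (star A a))" if "a \<in> carrier A" for a
    using that unfolding is_adjoint_def
    by (auto simp: lact_closed A.star_closed rinner_closed lact_zero rinner_lact intro!: B.mod.M.finsum_cong')
  show "rinner (amp d) x (y \<oplus>\<^bsub>amp d\<^esub> w) = rinner (amp d) x y \<oplus>\<^bsub>B\<^esub> rinner (amp d) x w"
    if "x \<in> carrier (amp d)" "y \<in> carrier (amp d)" "w \<in> carrier (amp d)" for x y w
    using that by (simp add: rinner_add_right rinner_closed B.mod.M.finsum_addf)
  show "rinner (amp d) x (z \<odot>\<^bsub>amp d\<^esub> y) = z \<odot>\<^bsub>B\<^esub> rinner (amp d) x y"
    if "x \<in> carrier (amp d)" "y \<in> carrier (amp d)" for x y z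
    using that by (simp add: rinner_smult_right rinner_closed B.mod.finsum_smult_ldistr)
  show "rinner (amp d) x (ract (amp d) y b) = rinner (amp d) x y \<otimes>\<^bsub>B\<^esub> b"
    if "x \<in> carrier (amp d)" "y \<in> carrier (amp d)" "b \<in> carrier B" for x y b
    using that by (simp add: rinner_ract rinner_closed B.mult_finsum_left)
  show "star B (rinner (amp d) x y) = rinner (amp d) y x"
    if "x \<in> carrier (amp d)" "y \<in> carrier (amp d)" for x y
    using that by (simp add: rinner_star rinner_closed B.star_finsum)
  show "cstar_positive B (rinner (amp d) x x)" if "x \<in> carrier (amp d)" for x
    using that by (auto intro!: B.positive_finsum rinner_positive)
qed (auto simp: ract_closed ract_add_left ract_add_right ract_mult ract_smult_left ract_smult_right
      ract_zero rinner_closed lact_add lact_smult lact_mult intro!: B.mod.M.finsum_closed)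

end

section \<open>Complex numbers and complex matrices\<close>

lemma a_minus_plus:
  fixes G :: "('v::ab_group_add, 'z) ring_scheme"
  assumes "carrier G = UNIV" "\<zero>\<^bsub>G\<^esub> = 0" "add G = (+)"
  shows "x \<ominus>\<^bsub>G\<^esub> y = x - y"
proof -
  interpret abelian_group G by (rule abelian_group_plus[OF assms])
  have "\<ominus>\<^bsub>G\<^esub> y = - y" by (rule minus_equality) (simp_all add: assms)
  thus ?thesis by (simp add: minus_eq assms)
qed

text \<open>Two-sided comparison with the norm of the type turns convergence on a carrier into
  topological convergence. Together with the next two lemmas this yields completeness for the
  operator norm and for both norms on column vectors.\<close>

lemma equivalent_norm_tendsto:
  fixes V :: "('v::real_normed_vector, 'z) ring_scheme"
  assumes V: "carrier V = UNIV" "\<zero>\<^bsub>V\<^esub> = 0" "add V = (+)"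
    and le: "\<And>x. norm x \<le> c * \<nu> x" "\<And>x. 0 \<le> \<nu> x" "\<And>x. \<nu> x \<le> C * norm x"
  shows "norm_tendsto V \<nu> s l \<longleftrightarrow> s \<longlonglongrightarrow> l"
proof
  assume "norm_tendsto V \<nu> s l"
  hence "(\<lambda>n. c * \<nu> (s n - l)) \<longlonglongrightarrow> c * 0"
    unfolding norm_tendsto_def a_minus_plus[OF V] by (intro tendsto_mult_left) blast
  hence "(\<lambda>n. s n - l) \<longlonglongrightarrow> 0"
    by (intro Lim_null_comparison[of "\<lambda>n. s n - l" "\<lambda>n. c * \<nu> (s n - l)"]) (simp_all add: le)
  thus "s \<longlonglongrightarrow> l" by (simp add: Lim_null[of s l])
next
  assume "s \<longlonglongrightarrow> l"
  hence "(\<lambda>n. norm (s n - l)) \<longlonglongrightarrow> 0" by (simp add: Lim_null[of s l] tendsto_norm_zero_iff)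
  hence "(\<lambda>n. C * norm (s n - l)) \<longlonglongrightarrow> C * 0" by (rule tendsto_mult_left)
  hence "(\<lambda>n. \<nu> (s n - l)) \<longlonglongrightarrow> 0"
    by (intro Lim_null_comparison[of "\<lambda>n. \<nu> (s n - l)" "\<lambda>n. C * norm (s n - l)"]) (simp_all add: le)
  thus "norm_tendsto V \<nu> s l" by (simp add: norm_tendsto_def a_minus_plus[OF V] V)
qed

lemma equivalent_norm_Cauchy:
  fixes V :: "('v::real_normed_vector, 'z) ring_scheme"
  assumes V: "carrier V = UNIV" "\<zero>\<^bsub>V\<^esub> = 0" "add V = (+)"
    and le: "\<And>x. norm x \<le> c * \<nu> x" "\<And>x. 0 \<le> \<nu> x" and s: "norm_Cauchy V \<nu> s"
  shows "Cauchy s"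
  unfolding Cauchy_iff
proof (intro allI impI)
  fix e :: real assume "e > 0"
  \<comment> \<open>\<open>c\<close> is not assumed positive; enlarging it preserves the bound and
    allows division.\<close>
  define c' where "c' = max c 1"
  have c': "c' > 0" "norm x \<le> c' * \<nu> x" for x
    using le(1)[of x] mult_right_mono[of c c' "\<nu> x"] le(2)[of x] by (auto simp: c'_def)
  obtain N where N: "\<And>m n. m \<ge> N \<Longrightarrow> n \<ge> N \<Longrightarrow> \<nu> (s m - s n) < e / c'"
    using s \<open>e > 0\<close> c'(1) unfolding norm_Cauchy_def a_minus_plus[OF V]
    by (metis divide_pos_pos)
  have "norm (s m - s n) < e" if "m \<ge> N" "n \<ge> N" for m n
    using N[OF that] c'(2)[of "s m - s n"] c'(1) by (simp add: field_simps)
  thus "\<exists>N. \<forall>m\<ge>N. \<forall>n\<ge>N. norm (s m - s n) < e" by blast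
qed

lemma equivalent_norm_complete:
  fixes V :: "('v::banach, 'z) ring_scheme"
  assumes "carrier V = UNIV" "\<zero>\<^bsub>V\<^esub> = 0" "add V = (+)"
    and "\<And>x. norm x \<le> c * \<nu> x" "\<And>x. 0 \<le> \<nu> x" "\<And>x. \<nu> x \<le> C * norm x"
  shows "norm_complete V \<nu>"
  unfolding norm_complete_def
proof (intro allI impI)
  fix s assume "norm_Cauchy V \<nu> s"
  hence "Cauchy s" by (rule equivalent_norm_Cauchy[OF assms(1-5)])
  then obtain l where "s \<longlonglongrightarrow> l" using Cauchy_convergent convergentD by blast
  hence "norm_tendsto V \<nu> s l" using equivalent_norm_tendsto[OF assms] by blast
  thus "\<exists>l. norm_tendsto V \<nu> s l" by blast
qed

section \<open>The complex numbers as a C*-algebra\<close>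

lemma complex_algebra_simps [simp]:
  "carrier complex_algebra = UNIV" "monoid.mult complex_algebra = (*)"
  "\<zero>\<^bsub>complex_algebra\<^esub> = 0" "add complex_algebra = (+)" "smult complex_algebra = (*)"
  "star complex_algebra = cnj" "nrm complex_algebra = cmod"
  by (simp_all add: complex_algebra_def)

lemma abelian_group_complex_algebra: "abelian_group complex_algebra"
  by (rule abelian_group_plus) simp_all

lemma finsum_complex_algebra [simp]: "finsum complex_algebra f I = sum f I"
  by (rule finsum_plus) (simp_all add: abelian_group.axioms abelian_group_complex_algebra)

interpretation complex_algebra: cstar_algebra complex_algebra
proof (rule cstar_algebra.intro)
  show "Module.module complex_ring complex_algebra"
    by (rule complex_moduleI[OF abelian_group_complex_algebra]) (simp_all add: algebra_simps)
  show "norm_complete complex_algebra (nrm complex_algebra)"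
    by (rule equivalent_norm_complete[of _ 1 _ 1]) simp_all
qed (simp_all add: algebra_simps norm_mult norm_triangle_ineq power2_eq_square)

lemma cstar_positive_complex: "cstar_positive complex_algebra z \<longleftrightarrow> (\<exists>t\<ge>0. z = complex_of_real t)"
proof
  assume "cstar_positive complex_algebra z"
  then obtain w where "z = cnj w * w" by (auto simp: cstar_positive_def)
  hence "z = complex_of_real ((cmod w)\<^sup>2)" by (simp only: complex_norm_square mult.commute)
  thus "\<exists>t\<ge>0. z = complex_of_real t" by (intro exI[of _ "(cmod w)\<^sup>2"]) simp
next
  assume "\<exists>t\<ge>0. z = complex_of_real t"
  then obtain t where "t \<ge> 0" "z = complex_of_real t" by blast
  hence "z = cnj (complex_of_real (sqrt t)) * complex_of_real (sqrt t)"
    by (simp flip: of_real_mult)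
  thus "cstar_positive complex_algebra z"
    unfolding cstar_positive_def by (intro bexI[of _ "complex_of_real (sqrt t)"]) simp_all
qed

interpretation complex_algebra: monotone_cstar_algebra complex_algebra
proof
  fix a b assume "cstar_positive complex_algebra a" "cstar_positive complex_algebra b"
  then obtain s t where st: "s \<ge> 0" "t \<ge> 0" "a = complex_of_real s" "b = complex_of_real t"
    by (auto simp: cstar_positive_complex)
  thus "cstar_positive complex_algebra (a \<oplus>\<^bsub>complex_algebra\<^esub> b)"
    by (auto simp: cstar_positive_complex intro!: exI[of _ "s + t"])
  show "nrm complex_algebra a \<le> nrm complex_algebra (a \<oplus>\<^bsub>complex_algebra\<^esub> b)"
    using st by (simp flip: of_real_add)
qed

section \<open>The operator norm and the C*-identity for matrices\<close>

definition cinner :: "complex^'n \<Rightarrow> complex^'n \<Rightarrow> complex" where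
  "cinner x y = (\<Sum>i\<in>UNIV. cnj (x $ i) * y $ i)"

lemma cinner_self: "cinner x x = complex_of_real ((norm x)\<^sup>2)"
proof -
  have "complex_of_real ((norm x)\<^sup>2) = complex_of_real (\<Sum>i\<in>UNIV. (cmod (x $ i))\<^sup>2)"
    by (simp add: norm_vec_def L2_set_def sum_nonneg)
  also have "\<dots> = cinner x x"
    unfolding cinner_def of_real_sum
    by (intro sum.cong refl) (simp only: complex_norm_square mult.commute)
  finally show ?thesis ..
qed

lemma cinner_adjoint: "cinner (a *v x) y = cinner x (cmat_adjoint a *v y)"
proof -
  have "cinner (a *v x) y = (\<Sum>i\<in>UNIV. \<Sum>j\<in>UNIV. cnj (x $ j) * (cnj (a $ i $ j) * y $ i))"
    by (simp add: cinner_def matrix_vector_mult_def cnj_sum sum_distrib_left sum_distrib_right mult_ac)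
  also have "\<dots> = (\<Sum>j\<in>UNIV. \<Sum>i\<in>UNIV. cnj (x $ j) * (cnj (a $ i $ j) * y $ i))"
    by (rule sum.swap)
  also have "\<dots> = cinner x (cmat_adjoint a *v y)"
    by (simp add: cinner_def matrix_vector_mult_def sum_distrib_left)
  finally show ?thesis .
qed

lemma cinner_le: "cmod (cinner x y) \<le> norm x * norm y"
proof -
  have "cmod (cinner x y) \<le> (\<Sum>i\<in>UNIV. \<bar>cmod (x $ i)\<bar> * \<bar>cmod (y $ i)\<bar>)"
    unfolding cinner_def by (rule order_trans[OF norm_sum]) (simp add: norm_mult)
  also have "\<dots> \<le> norm x * norm y" unfolding norm_vec_def by (rule L2_set_mult_ineq)
  finally show ?thesis .
qed

lemma cmat_adjoint_simps [simp]:
  "cmat_adjoint (cmat_adjoint a) = a"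
  "cmat_adjoint (a + b) = cmat_adjoint a + cmat_adjoint b"
  "cmat_adjoint (cmat_scale z a) = cmat_scale (cnj z) (cmat_adjoint a)"
  "cmat_adjoint (a ** b) = cmat_adjoint b ** cmat_adjoint a"
  by (simp_all add: vec_eq_iff matrix_matrix_mult_def cnj_sum mult.commute)

lemma bounded_linear_cmat: "bounded_linear ((*v) a)" for a :: "complex^'n^'n"
  by (rule matrix_vector_mul_bounded_linear)

lemma norm_cmat_vec_le: "norm (a *v x) \<le> onorm ((*v) a) * norm x" for a :: "complex^'n^'n"
  by (rule onorm[OF bounded_linear_cmat])

text \<open>Moving \<open>a\<close> to the other side of the inner product and applying
  Cauchy-Schwarz gives the half of the C*-identity that does not follow from
  submultiplicativity.\<close>

lemma norm_cmat_vec_sq_le: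
  fixes a :: "complex^'n^'n"
  shows "(norm (a *v x))\<^sup>2 \<le> onorm ((*v) (cmat_adjoint a ** a)) * (norm x)\<^sup>2"
proof -
  have "(norm (a *v x))\<^sup>2 = cmod (cinner x ((cmat_adjoint a ** a) *v x))"
    using cinner_self[of "a *v x"] by (simp add: cinner_adjoint matrix_vector_mul_assoc)
       (metis abs_norm_cancel norm_of_real norm_power of_real_power real_norm_def)
  also have "\<dots> \<le> norm x * norm ((cmat_adjoint a ** a) *v x)" by (rule cinner_le)
  also have "\<dots> \<le> norm x * (onorm ((*v) (cmat_adjoint a ** a)) * norm x)"
    by (intro mult_left_mono norm_cmat_vec_le) simp
  finally show ?thesis by (simp add: power2_eq_square mult_ac)
qed

lemma onorm_cmat_mult_le: "onorm ((*v) (a ** b)) \<le> onorm ((*v) a) * onorm ((*v) b)"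
  for a b :: "complex^'n^'n"
  using onorm_compose[OF bounded_linear_cmat[of a] bounded_linear_cmat[of b]]
  by (simp add: comp_def matrix_vector_mul_assoc)

lemma onorm_cmat_leI:
  fixes a :: "complex^'n^'n"
  assumes "\<And>x. (norm (a *v x))\<^sup>2 \<le> C * (norm x)\<^sup>2"
  shows "(onorm ((*v) a))\<^sup>2 \<le> C"
proof -
  have "0 \<le> C"
  proof -
    \<comment> \<open>A nonzero test vector forces \<open>C\<close> to be nonnegative;
      \<open>undefined\<close> merely names some index.\<close>
    have "0 \<le> C * (norm (axis undefined 1 :: complex^'n))\<^sup>2"
      using assms zero_le_power2 order_trans by blast
    thus ?thesis by simp
  qed
  have "norm (a *v x) \<le> sqrt C * norm x" for x
    using real_sqrt_le_mono[OF assms[of x]] by (simp add: real_sqrt_mult)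
  hence "onorm ((*v) a) \<le> sqrt C" by (rule onorm_le)
  hence "(onorm ((*v) a))\<^sup>2 \<le> (sqrt C)\<^sup>2"
    by (intro power_mono onorm_pos_le[OF bounded_linear_cmat])
  thus ?thesis using \<open>0 \<le> C\<close> by simp
qed

text \<open>From \<open>|a|^2 \<le> |a^* a| \<le> |a^*| |a|\<close> follows
  \<open>|a| \<le> |a^*|\<close>. The same for the adjoint of \<open>a\<close> bounds
  \<open>|a^* a|\<close> by \<open>|a|^2\<close>.\<close>

lemma onorm_cmat_adjoint_mult: "onorm ((*v) (cmat_adjoint a ** a)) = (onorm ((*v) a))\<^sup>2"
  for a :: "complex^'n^'n"
proof -
  have le: "(onorm ((*v) a))\<^sup>2 \<le> onorm ((*v) (cmat_adjoint a ** a))" for a :: "complex^'n^'n"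
    by (rule onorm_cmat_leI) (rule norm_cmat_vec_sq_le)
  have adj: "onorm ((*v) a) \<le> onorm ((*v) (cmat_adjoint a))" for a :: "complex^'n^'n"
  proof -
    have "onorm ((*v) a) * onorm ((*v) a) \<le> onorm ((*v) (cmat_adjoint a)) * onorm ((*v) a)"
      using le[of a] onorm_cmat_mult_le[of "cmat_adjoint a" a] by (simp add: power2_eq_square)
    thus ?thesis
      using onorm_pos_le[OF bounded_linear_cmat, of a] onorm_pos_le[OF bounded_linear_cmat, of "cmat_adjoint a"]
      by (cases "onorm ((*v) a) = 0") (auto simp: mult_le_cancel_right)
  qed
  have "onorm ((*v) (cmat_adjoint a ** a)) \<le> onorm ((*v) (cmat_adjoint a)) * onorm ((*v) a)"
    by (rule onorm_cmat_mult_le)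
  also have "\<dots> \<le> (onorm ((*v) a))\<^sup>2"
    using adj[of "cmat_adjoint a"] onorm_pos_le[OF bounded_linear_cmat, of a]
    by (simp add: power2_eq_square mult_right_mono)
  finally show ?thesis using le[of a] by linarith
qed

lemma norm_entry_le_onorm: "cmod (a $ i $ j) \<le> onorm ((*v) a)" for a :: "complex^'n^'n"
proof -
  have "cmod ((a *v axis j 1) $ i) \<le> norm (a *v axis j 1)" by (rule Finite_Cartesian_Product.norm_nth_le)
  also have "\<dots> \<le> onorm ((*v) a) * norm (axis j 1 :: complex^'n)" by (rule norm_cmat_vec_le)
  also have "norm (axis j 1 :: complex^'n) = 1"
    by (simp add: norm_vec_def L2_set_def axis_def if_distrib[of cmod] if_distrib[of "\<lambda>x. x\<^sup>2"] cong: if_cong)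
  finally have "cmod ((a *v axis j 1) $ i) \<le> onorm ((*v) a)" by simp
  moreover have "(a *v axis j 1) $ i = a $ i $ j"
    by (simp add: matrix_vector_mult_def axis_def if_distrib cong: if_cong)
  ultimately show ?thesis by simp
qed

text \<open>The constants here and in \<open>onorm_cmat_le_norm\<close> are crude; completeness asks
  only for some two-sided comparison.\<close>

lemma norm_le_onorm_cmat: "norm a \<le> real (CARD('n) * CARD('n)) * onorm ((*v) a)" for a :: "complex^'n^'n"
proof -
  have "norm a \<le> (\<Sum>i\<in>UNIV. norm (a $ i))" unfolding norm_vec_def[of a] by (rule L2_set_le_sum) simp
  also have "\<dots> \<le> (\<Sum>i\<in>(UNIV::'n set). \<Sum>j\<in>(UNIV::'n set). onorm ((*v) a))"
  proof (rule sum_mono)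
    fix i
    have "norm (a $ i) \<le> (\<Sum>j\<in>UNIV. cmod (a $ i $ j))" unfolding norm_vec_def by (rule L2_set_le_sum) simp
    also have "\<dots> \<le> (\<Sum>j\<in>(UNIV::'n set). onorm ((*v) a))" by (intro sum_mono norm_entry_le_onorm)
    finally show "norm (a $ i) \<le> (\<Sum>j\<in>(UNIV::'n set). onorm ((*v) a))" .
  qed
  finally show ?thesis by simp
qed

lemma onorm_cmat_le_norm: "onorm ((*v) a) \<le> real (CARD('n)) * norm a" for a :: "complex^'n^'n"
proof (rule onorm_le)
  fix x
  have "norm (a *v x) \<le> (\<Sum>i\<in>UNIV. cmod ((a *v x) $ i))" unfolding norm_vec_def by (rule L2_set_le_sum) simp
  also have "\<dots> \<le> (\<Sum>i\<in>(UNIV::'n set). norm a * norm x)"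
  proof (rule sum_mono)
    fix i
    have "cmod ((a *v x) $ i) \<le> (\<Sum>j\<in>UNIV. \<bar>cmod (a $ i $ j)\<bar> * \<bar>cmod (x $ j)\<bar>)"
      unfolding matrix_vector_mult_def by (simp, rule order_trans[OF norm_sum]) (simp add: norm_mult)
    also have "\<dots> \<le> norm (a $ i) * norm x" unfolding norm_vec_def by (rule L2_set_mult_ineq)
    also have "\<dots> \<le> norm a * norm x" by (intro mult_right_mono Finite_Cartesian_Product.norm_nth_le) simp
    finally show "cmod ((a *v x) $ i) \<le> norm a * norm x" .
  qed
  finally show "norm (a *v x) \<le> real (CARD('n)) * norm a * norm x" by simp
qed

lemma cmat_scale_vec: "cmat_scale z a *v x = z *s (a *v x)"
  by (simp add: vec_eq_iff matrix_vector_mult_def sum_distrib_left mult_ac)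

lemma norm_vector_scalar_mult: "norm (z *s x) = cmod z * norm x" for x :: "complex^'n"
  unfolding norm_vec_def by (simp add: norm_mult L2_set_right_distrib)

lemma onorm_cmat_scale: "onorm ((*v) (cmat_scale z a)) = cmod z * onorm ((*v) a)" for a :: "complex^'n^'n"
proof -
  have le: "onorm ((*v) (cmat_scale z a)) \<le> cmod z * onorm ((*v) a)" for z and a :: "complex^'n^'n"
    by (rule onorm_le) (simp add: cmat_scale_vec norm_vector_scalar_mult mult.assoc mult_left_mono norm_cmat_vec_le)
  show ?thesis
  proof (cases "z = 0")
    case True
    hence "(*v) (cmat_scale z a) = (\<lambda>x. 0)" by (simp add: fun_eq_iff cmat_scale_vec)
    thus ?thesis using True by (simp add: onorm_zero)
  next
    case False
    \<comment> \<open>The inequality already proved, applied to the factor \<open>1 / z\<close> and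
      the scaled matrix, supplies the reverse one.\<close>
    have "onorm ((*v) a) \<le> cmod (1 / z) * onorm ((*v) (cmat_scale z a))"
      using le[of "1 / z" "cmat_scale z a"] False by simp
    hence "cmod z * onorm ((*v) a) \<le> onorm ((*v) (cmat_scale z a))"
      using False by (simp add: norm_divide field_simps)
    thus ?thesis using le[of z a] by linarith
  qed
qed

interpretation matrix_algebra: cstar_algebra "matrix_algebra :: (complex^'n^'n) star_alg"
proof (rule cstar_algebra.intro)
  show "Module.module complex_ring (matrix_algebra :: (complex^'n^'n) star_alg)"
    by (rule complex_moduleI[OF abelian_group_matrix_algebra]) (simp_all add: vec_eq_iff algebra_simps)
  show "norm_complete (matrix_algebra :: (complex^'n^'n) star_alg) (nrm matrix_algebra)"
    by (rule equivalent_norm_complete[of _ "real (CARD('n) * CARD('n))" _ "real (CARD('n))"])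
      (simp_all only: matrix_algebra_simps norm_le_onorm_cmat onorm_cmat_le_norm
        onorm_pos_le[OF bounded_linear_cmat])
next
  fix a b :: "complex^'n^'n" and z
  show "nrm matrix_algebra a = 0 \<longleftrightarrow> a = \<zero>\<^bsub>matrix_algebra\<^esub>"
  proof
    assume "nrm matrix_algebra a = 0"
    thus "a = \<zero>\<^bsub>matrix_algebra\<^esub>" using norm_le_onorm_cmat[of a] by simp
  next
    assume "a = \<zero>\<^bsub>matrix_algebra\<^esub>"
    hence "(*v) a = (\<lambda>x. 0)" by (simp add: fun_eq_iff)
    thus "nrm matrix_algebra a = 0" by (simp only: matrix_algebra_simps onorm_zero)
  qed
  show "nrm matrix_algebra (a \<oplus>\<^bsub>matrix_algebra\<^esub> b) \<le> nrm matrix_algebra a + nrm matrix_algebra b"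
  proof -
    have "(*v) (a + b) = (\<lambda>x. a *v x + b *v x)"
      by (simp add: fun_eq_iff matrix_vector_mult_add_rdistrib)
    thus ?thesis using onorm_triangle[OF bounded_linear_cmat bounded_linear_cmat, of a b] by simp
  qed
  show "nrm matrix_algebra (a \<otimes>\<^bsub>matrix_algebra\<^esub> b) \<le> nrm matrix_algebra a * nrm matrix_algebra b"
    by (simp add: onorm_cmat_mult_le)
  show "nrm matrix_algebra (star matrix_algebra a \<otimes>\<^bsub>matrix_algebra\<^esub> a) = (nrm matrix_algebra a)\<^sup>2"
    by (simp add: onorm_cmat_adjoint_mult)
  show "nrm matrix_algebra (z \<odot>\<^bsub>matrix_algebra\<^esub> a) = cmod z * nrm matrix_algebra a"
    by (simp add: onorm_cmat_scale)
  show "0 \<le> nrm matrix_algebra a" by (simp add: onorm_pos_le[OF bounded_linear_cmat])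
  show "(z \<odot>\<^bsub>matrix_algebra\<^esub> a) \<otimes>\<^bsub>matrix_algebra\<^esub> b = z \<odot>\<^bsub>matrix_algebra\<^esub> (a \<otimes>\<^bsub>matrix_algebra\<^esub> b)"
    "a \<otimes>\<^bsub>matrix_algebra\<^esub> (z \<odot>\<^bsub>matrix_algebra\<^esub> b) = z \<odot>\<^bsub>matrix_algebra\<^esub> (a \<otimes>\<^bsub>matrix_algebra\<^esub> b)"
    by (simp_all add: vec_eq_iff matrix_matrix_mult_def sum_distrib_left mult_ac)
  show "(a \<oplus>\<^bsub>matrix_algebra\<^esub> b) \<otimes>\<^bsub>matrix_algebra\<^esub> c =
      a \<otimes>\<^bsub>matrix_algebra\<^esub> c \<oplus>\<^bsub>matrix_algebra\<^esub> b \<otimes>\<^bsub>matrix_algebra\<^esub> c" for c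
    by (simp add: vec_eq_iff matrix_matrix_mult_def distrib_right sum.distrib)
qed (simp_all add: matrix_mul_assoc matrix_add_ldistrib)

text \<open>The rows of \<open>u\<close> and \<open>v\<close> together have the same Gram matrix as a linearly independent
  family, and such a family fits into the rows of a single square matrix.\<close>

lemma cmat_positive_add:
  fixes u v :: "complex^'n^'n"
  shows "\<exists>b. cmat_adjoint u ** u + cmat_adjoint v ** v = cmat_adjoint b ** b"
proof -
  \<comment> \<open>The entries are conjugated so that \<open>u^* u\<close> and \<open>v^* v\<close>
    become sums of \<open>f r i * cnj (f r j)\<close>, the form of the Gram lemmas.\<close>
  define f where "f = case_sum (\<lambda>k i. cnj (u $ k $ i)) (\<lambda>k i. cnj (v $ k $ i))"
  obtain N :: nat and w where w: "indep_family {..<N} w"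
    "\<And>i j. (\<Sum>r<N. w r i * cnj (w r j)) = (\<Sum>r\<in>UNIV <+> UNIV. f r i * cnj (f r j))"
    using gram_indep_family[of "(UNIV :: 'n set) <+> (UNIV :: 'n set)" f] by auto
  have N: "N \<le> CARD('n)" by (rule indep_family_card_le[OF w(1)])
  obtain g :: "'n \<Rightarrow> nat" where g: "bij_betw g UNIV {..<CARD('n)}"
    using ex_bij_betw_finite_nat[of "UNIV :: 'n set"] by (auto simp: atLeast0LessThan)
  \<comment> \<open>Rows numbered from \<open>N\<close> on are filled with zeros, which leaves the
    Gram sum unchanged.\<close>
  define b :: "complex^'n^'n" where "b = (\<chi> k j. if g k < N then cnj (w (g k) j) else 0)"
  have "(cmat_adjoint u ** u + cmat_adjoint v ** v) $ i $ j = (cmat_adjoint b ** b) $ i $ j" for i j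
  proof -
    have "(cmat_adjoint b ** b) $ i $ j = (\<Sum>k\<in>UNIV. if g k < N then w (g k) i * cnj (w (g k) j) else 0)"
      unfolding matrix_matrix_mult_def by (simp add: b_def) (rule sum.cong, auto)
    also have "\<dots> = (\<Sum>r<CARD('n). if r < N then w r i * cnj (w r j) else 0)"
      by (rule sum.reindex_bij_betw[OF g])
    also have "\<dots> = (\<Sum>r<N. w r i * cnj (w r j))"
      using N by (intro sum.mono_neutral_cong_right) auto
    also have "\<dots> = (cmat_adjoint u ** u + cmat_adjoint v ** v) $ i $ j"
      unfolding w(2) by (simp add: sum.Plus f_def matrix_matrix_mult_def del: UNIV_Plus_UNIV)
    finally show ?thesis ..
  qed
  thus ?thesis by (auto simp: vec_eq_iff)
qed

interpretation matrix_algebra: monotone_cstar_algebra "matrix_algebra :: (complex^'n^'n) star_alg"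
proof
  fix a b :: "complex^'n^'n"
  assume "cstar_positive matrix_algebra a" "cstar_positive matrix_algebra b"
  then obtain u v where uv: "a = cmat_adjoint u ** u" "b = cmat_adjoint v ** v"
    by (auto simp: cstar_positive_def)
  show "cstar_positive matrix_algebra (a \<oplus>\<^bsub>matrix_algebra\<^esub> b)"
    using cmat_positive_add[of u v] by (simp add: cstar_positive_def uv)
  \<comment> \<open>The form of \<open>a + b\<close> at \<open>x\<close> is
    \<open>|u x|^2 + |v x|^2\<close>; dropping the second term leaves the bound on \<open>u\<close>,
    and the C*-identity turns it into a bound on \<open>a\<close>.\<close>
  have "(norm (u *v x))\<^sup>2 \<le> onorm ((*v) (a + b)) * (norm x)\<^sup>2" for x
  proof -
    have "complex_of_real ((norm (u *v x))\<^sup>2 + (norm (v *v x))\<^sup>2) = cinner x ((a + b) *v x)"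
      by (simp only: of_real_add cinner_self[symmetric] cinner_adjoint matrix_vector_mul_assoc uv)
        (simp add: cinner_def matrix_vector_mult_add_rdistrib algebra_simps sum.distrib)
    hence "cmod (complex_of_real ((norm (u *v x))\<^sup>2 + (norm (v *v x))\<^sup>2)) \<le> norm x * norm ((a + b) *v x)"
      using cinner_le by metis
    hence "(norm (u *v x))\<^sup>2 + (norm (v *v x))\<^sup>2 \<le> norm x * norm ((a + b) *v x)"
      unfolding norm_of_real by simp
    also have "\<dots> \<le> norm x * (onorm ((*v) (a + b)) * norm x)"
      by (intro mult_left_mono norm_cmat_vec_le) simp
    finally have "(norm (u *v x))\<^sup>2 + (norm (v *v x))\<^sup>2 \<le> onorm ((*v) (a + b)) * (norm x)\<^sup>2"
      by (simp add: power2_eq_square mult_ac)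
    thus ?thesis using zero_le_power2[of "norm (v *v x)"] by linarith
  qed
  hence "(onorm ((*v) u))\<^sup>2 \<le> onorm ((*v) (a + b))" by (rule onorm_cmat_leI)
  hence "onorm ((*v) a) \<le> onorm ((*v) (a + b))" by (metis onorm_cmat_adjoint_mult uv(1))
  thus "nrm matrix_algebra a \<le> nrm matrix_algebra (a \<oplus>\<^bsub>matrix_algebra\<^esub> b)"
    by (simp only: matrix_algebra_simps)
qed

section \<open>The bimodule of column vectors\<close>

text \<open>This is the standard Morita equivalence between matrices and scalars:
  \<open>linner\<close> is the rank-one operator of \<open>x\<close> and \<open>y\<close>, so the
  matrices appear as the compact operators on the columns.\<close>

definition column_bimodule :: "(complex^'n^'n, complex, complex^'n) eq_bimod" where
  "column_bimodule =
    \<lparr>carrier = UNIV, monoid.mult = undefined, one = undefined, ring.zero = 0, add = (+),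
     smult = (*s), ract = (\<lambda>x z. z *s x), rinner = cinner, lact = (*v),
     linner = (\<lambda>x y. \<chi> i j. x $ i * cnj (y $ j))\<rparr>"

lemma column_bimodule_simps [simp]:
  "carrier column_bimodule = UNIV" "\<zero>\<^bsub>column_bimodule\<^esub> = 0" "add column_bimodule = (+)"
  "smult column_bimodule = (*s)" "ract column_bimodule x z = z *s x" "rinner column_bimodule = cinner"
  "lact column_bimodule = (*v)" "linner column_bimodule x y = (\<chi> i j. x $ i * cnj (y $ j))"
  by (simp_all add: column_bimodule_def)

lemma hnorm_column_bimodule: "hnorm complex_algebra column_bimodule = norm"
  by (simp add: fun_eq_iff hnorm_def cinner_self norm_power)

lemma outer_mult_vec: "(\<chi> i j. x $ i * cnj (y $ j)) *v w = cinner y w *s x"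
  by (simp add: vec_eq_iff matrix_vector_mult_def cinner_def sum_distrib_left mult_ac)

lemma cinner_simps:
  "cinner x (y + w) = cinner x y + cinner x w"
  "cinner x (z *s y) = z * cinner x y"
  "cnj (cinner x y) = cinner y x"
  by (simp_all add: cinner_def distrib_left sum.distrib sum_distrib_left cnj_sum mult_ac)

lemma cinner_eq_0_iff: "cinner x x = 0 \<longleftrightarrow> x = 0"
  by (simp add: cinner_self)

interpretation column: correspondence "matrix_algebra :: (complex^'n^'n) star_alg" complex_algebra
    "column_bimodule :: (complex^'n^'n, complex, complex^'n) eq_bimod"
proof (intro correspondence.intro hilbert_module.intro correspondence_axioms.intro
      hilbert_module_axioms.intro matrix_algebra.cstar_algebra_axioms complex_algebra.cstar_algebra_axioms)
  show "Module.module complex_ring (column_bimodule :: (complex^'n^'n, complex, complex^'n) eq_bimod)"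
    by (rule complex_moduleI, rule abelian_group_plus) (simp_all add: vec_eq_iff algebra_simps)
  show "norm_complete (column_bimodule :: (complex^'n^'n, complex, complex^'n) eq_bimod)
      (hnorm complex_algebra column_bimodule)"
    unfolding hnorm_column_bimodule by (rule equivalent_norm_complete[of _ 1 _ 1]) simp_all
  show "cstar_positive complex_algebra (rinner column_bimodule x x)" for x :: "complex^'n"
    by (auto simp: cinner_self cstar_positive_complex intro!: exI[of _ "(norm x)\<^sup>2"])
  show "is_adjoint column_bimodule (lact column_bimodule a) (lact column_bimodule (star matrix_algebra a))"
    for a :: "complex^'n^'n"
    by (simp add: is_adjoint_def cinner_adjoint)
  show "lact column_bimodule (z \<odot>\<^bsub>matrix_algebra\<^esub> a) x = z \<odot>\<^bsub>column_bimodule\<^esub> lact column_bimodule a x"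
    for a :: "complex^'n^'n" and x z
    by (simp add: cmat_scale_vec)
  show "lact column_bimodule (a \<oplus>\<^bsub>matrix_algebra\<^esub> b) x = lact column_bimodule a x \<oplus>\<^bsub>column_bimodule\<^esub> lact column_bimodule b x"
    for a b :: "complex^'n^'n" and x
    by (simp add: matrix_vector_mult_add_rdistrib)
  show "lact column_bimodule (a \<otimes>\<^bsub>matrix_algebra\<^esub> b) x = lact column_bimodule a (lact column_bimodule b x)"
    for a b :: "complex^'n^'n" and x
    by (simp add: matrix_vector_mul_assoc)
qed (simp_all add: cinner_simps cinner_eq_0_iff vec_eq_iff algebra_simps)

interpretation column: amplifiable "matrix_algebra :: (complex^'n^'n) star_alg" complex_algebra
    "column_bimodule :: (complex^'n^'n, complex, complex^'n) eq_bimod" ..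

lemma lin_span_matrix_algebra:
  "lin_span (matrix_algebra :: (complex^'n^'n) star_alg) {a. \<exists>x y. a = (\<chi> i j. x $ i * cnj (y $ j))} = UNIV"
proof -
  obtain h :: "nat \<Rightarrow> 'n" where h: "bij_betw h {..<CARD('n)} UNIV"
    using ex_bij_betw_nat_finite[of "UNIV :: 'n set"] by (auto simp: atLeast0LessThan)
  have "a \<in> lin_span matrix_algebra {a. \<exists>x y. a = (\<chi> i j. x $ i * cnj (y $ j))}" for a :: "complex^'n^'n"
  proof -
    \<comment> \<open>The \<open>l\<close>-th term is the rank-one matrix built from column
      \<open>h l\<close> of \<open>a\<close> and the basis vector at \<open>h l\<close>; these terms
      add up to \<open>a\<close>.\<close>
    let ?s = "\<lambda>l. \<chi> i j. (\<chi> i. a $ i $ h l) $ i * cnj (axis (h l) 1 $ j) :: complex^'n^'n"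
    have "(\<Sum>l<CARD('n). cmat_scale 1 (?s l)) $ i $ j = a $ i $ j" for i j
    proof -
      have "(\<Sum>l<CARD('n). cmat_scale 1 (?s l)) $ i $ j = (\<Sum>l<CARD('n). if j = h l then a $ i $ h l else 0)"
        by (simp add: axis_def) (rule sum.cong, auto)
      also have "\<dots> = (\<Sum>k\<in>UNIV. if j = k then a $ i $ k else 0)"
        by (rule sum.reindex_bij_betw[OF h])
      finally show ?thesis by simp
    qed
    hence "(\<Sum>l<CARD('n). cmat_scale 1 (?s l)) = a" unfolding vec_eq_iff by blast
    hence "(\<Oplus>\<^bsub>matrix_algebra\<^esub> l \<in> {..<CARD('n)}. 1 \<odot>\<^bsub>matrix_algebra\<^esub> ?s l) = a"
      by (simp only: finsum_matrix_algebra matrix_algebra_simps)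
    note eq = this[symmetric]
    show ?thesis
      unfolding lin_span_def
      by (rule CollectI, rule exI[of _ "CARD('n)"], rule exI[of _ "\<lambda>_. 1"], rule exI[of _ ?s], rule conjI, rule eq) blast
  qed
  thus ?thesis by blast
qed

lemma lin_span_complex_algebra:
  "lin_span complex_algebra {z. \<exists>x y :: complex^'n. z = cinner x y} = UNIV"
proof -
  have "z \<in> lin_span complex_algebra {z. \<exists>x y :: complex^'n. z = cinner x y}" for z
  proof -
    \<comment> \<open>A unit vector paired with itself puts 1 into the spanning set, and its
      multiples are all scalars.\<close>
    have "cinner (axis undefined 1) (axis undefined 1 :: complex^'n) = 1"
      by (simp add: cinner_def axis_def if_distrib cong: if_cong)
    hence one: "1 \<in> {z. \<exists>x y :: complex^'n. z = cinner x y}" by (metis (mono_tags, lifting) mem_Collect_eq)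
    have eq: "z = (\<Oplus>\<^bsub>complex_algebra\<^esub> i \<in> {..<1::nat}. z \<odot>\<^bsub>complex_algebra\<^esub> 1)" by simp
    show ?thesis
      unfolding lin_span_def
      by (rule CollectI, rule exI[of _ 1], rule exI[of _ "\<lambda>_. z"], rule exI[of _ "\<lambda>_. 1"],
          rule conjI, rule eq) (rule Pi_I, rule one)
  qed
  thus ?thesis by blast
qed

lemma norm_dense_UNIV:
  assumes "carrier V = UNIV" "\<And>x. \<nu> (x \<ominus>\<^bsub>V\<^esub> x) = 0"
  shows "norm_dense V \<nu> UNIV"
  unfolding norm_dense_def
proof (intro conjI ballI allI impI)
  show "\<exists>y\<in>UNIV. \<nu> (x \<ominus>\<^bsub>V\<^esub> y) < e" if "e > 0" for x and e :: real
    using that assms(2) by (intro bexI[of _ x]) simp_all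
qed (simp add: assms(1))

lemma equivalence_bimodule_column:
  "equivalence_bimodule (matrix_algebra :: (complex^'n^'n) star_alg) complex_algebra column_bimodule"
proof (rule equivalence_bimodule.intro[OF column.correspondence_axioms],
    rule equivalence_bimodule_axioms.intro)
  show "cstar_positive matrix_algebra (linner column_bimodule x x)" for x :: "complex^'n"
    unfolding cstar_positive_def
  proof
    \<comment> \<open>One nonzero row holding the conjugate of \<open>x\<close> factors the rank-one
      matrix as \<open>?b^* ?b\<close>; the choice of the row is immaterial.\<close>
    let ?b = "\<chi> i j. if i = undefined then cnj (x $ j) else 0 :: complex^'n^'n"
    show "linner column_bimodule x x = star matrix_algebra ?b \<otimes>\<^bsub>matrix_algebra\<^esub> ?b"
      by (simp add: vec_eq_iff matrix_matrix_mult_def if_distrib cong: if_cong)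
    show "?b \<in> carrier matrix_algebra" by simp
  qed
  \<comment> \<open>With this, the norm from the left inner product is the Euclidean norm, just like
    the one from the right, and left completeness follows.\<close>
  have norm: "onorm ((*v) (\<chi> i j. x $ i * cnj (x $ j))) = (norm x)\<^sup>2" for x :: "complex^'n"
  proof (rule antisym)
    show "onorm ((*v) (\<chi> i j. x $ i * cnj (x $ j))) \<le> (norm x)\<^sup>2"
    proof (rule onorm_le)
      fix w
      show "norm ((\<chi> i j. x $ i * cnj (x $ j)) *v w) \<le> (norm x)\<^sup>2 * norm w"
        using mult_right_mono[OF cinner_le[of x w], of "norm x"]
        by (simp add: outer_mult_vec norm_vector_scalar_mult power2_eq_square mult_ac)
    qed
    \<comment> \<open>The lower bound comes from applying the operator to \<open>x\<close> itself,
      which it multiplies by \<open>|x|^2\<close>.\<close>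
    have "norm x * (norm x)\<^sup>2 \<le> onorm ((*v) (\<chi> i j. x $ i * cnj (x $ j))) * norm x"
      using norm_cmat_vec_le[of "\<chi> i j. x $ i * cnj (x $ j)" x]
      by (simp add: outer_mult_vec norm_vector_scalar_mult cinner_self norm_power mult_ac)
    thus "(norm x)\<^sup>2 \<le> onorm ((*v) (\<chi> i j. x $ i * cnj (x $ j)))"
      using onorm_pos_le[OF bounded_linear_cmat, of "\<chi> i j. x $ i * cnj (x $ j)"]
      by (cases "x = 0") (auto simp: mult.commute[of "norm x"])
  qed
  show "x = \<zero>\<^bsub>column_bimodule\<^esub>" if "linner column_bimodule x x = \<zero>\<^bsub>matrix_algebra\<^esub>" for x :: "complex^'n"
    using that by (simp add: vec_eq_iff)
  show "norm_complete column_bimodule (\<lambda>x :: complex^'n. sqrt (nrm matrix_algebra (linner column_bimodule x x)))"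
    by (rule equivalent_norm_complete[of _ 1 _ 1]) (simp_all add: norm)
  show "norm_dense matrix_algebra (nrm matrix_algebra)
     (lin_span (matrix_algebra :: (complex^'n^'n) star_alg) {linner column_bimodule x y |x y. x \<in> carrier column_bimodule \<and> y \<in> carrier column_bimodule})"
  proof -
    have "nrm (matrix_algebra :: (complex^'n^'n) star_alg) (a \<ominus>\<^bsub>matrix_algebra\<^esub> a) = 0" for a
      using matrix_algebra.nrm_eq_0[of 0] by (simp add: a_minus_plus)
    hence "norm_dense (matrix_algebra :: (complex^'n^'n) star_alg) (nrm matrix_algebra) UNIV"
      by (intro norm_dense_UNIV) (simp only: matrix_algebra_simps)
    thus ?thesis by (simp add: lin_span_matrix_algebra)
  qed
  show "norm_dense complex_algebra (nrm complex_algebra)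
     (lin_span complex_algebra {rinner column_bimodule x y |x y :: complex^'n. x \<in> carrier column_bimodule \<and> y \<in> carrier column_bimodule})"
    using norm_dense_UNIV[of complex_algebra cmod]
    by (simp add: lin_span_complex_algebra a_minus_plus)
  show "lact column_bimodule (linner column_bimodule x y) w = ract column_bimodule x (rinner column_bimodule y w)"
    for x y w :: "complex^'n"
    by (simp add: outer_mult_vec)
  show "linner column_bimodule (lact column_bimodule a x) y = a \<otimes>\<^bsub>matrix_algebra\<^esub> linner column_bimodule x y"
    for a and x y :: "complex^'n"
    by (simp add: vec_eq_iff matrix_vector_mult_def matrix_matrix_mult_def sum_distrib_left mult_ac)
  show "linner column_bimodule (x \<oplus>\<^bsub>column_bimodule\<^esub> y) w =
      linner column_bimodule x w \<oplus>\<^bsub>matrix_algebra\<^esub> linner column_bimodule y w" for x y w :: "complex^'n"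
    by (simp add: vec_eq_iff distrib_right)
  show "linner column_bimodule (z \<odot>\<^bsub>column_bimodule\<^esub> x) y = z \<odot>\<^bsub>matrix_algebra\<^esub> linner column_bimodule x y"
    for x y :: "complex^'n" and z
    by (simp add: vec_eq_iff)
  show "star matrix_algebra (linner column_bimodule x y) = linner column_bimodule y x" for x y :: "complex^'n"
    by (simp add: vec_eq_iff)
  show "linner column_bimodule (ract column_bimodule x b) y =
      linner column_bimodule x (ract column_bimodule y (star complex_algebra b))" for x y :: "complex^'n" and b
    by (simp add: vec_eq_iff)
  show "linner column_bimodule x y \<in> carrier matrix_algebra" for x y :: "complex^'n"
    by (simp only: matrix_algebra_simps UNIV_I)
qed

text \<open>The coordinatewise limit realises the completion, since the target is already complete.\<close>

locale column_quotient = isometric_quotient matrix_algebra complex_algebra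
    "amplification d complex_algebra column_bimodule" V T
  for d :: nat and V :: "(complex^'n^'n, complex, 'v) corr" and T :: "'v \<Rightarrow> nat \<Rightarrow> complex^'n"
begin

definition T_lim :: "(nat \<Rightarrow> 'v) \<Rightarrow> nat \<Rightarrow> complex^'n" where
  "T_lim s i = (if i < d then lim (\<lambda>n. T (s n) i) else 0)"

text \<open>\<open>T\<close> preserves the norms of differences, so a sequence is Cauchy exactly
  when its image is. In the image this is convergence of each coordinate below \<open>d\<close>, and
  the remaining coordinates vanish.\<close>

lemma norm_Cauchy_iff:
  "norm_Cauchy V (hnorm complex_algebra V) s \<longleftrightarrow>
    (\<forall>n. s n \<in> carrier V) \<and> (\<forall>i<d. convergent (\<lambda>n. T (s n) i))"
proof (cases "\<forall>n. s n \<in> carrier V")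
  case True
  let ?H = "amplification d complex_algebra (column_bimodule :: (complex^'n^'n, complex, complex^'n) eq_bimod)"
  have Ts: "T (s n) \<in> carrier ?H" for n using True by (intro T_closed) blast
  have "norm_Cauchy V (hnorm complex_algebra V) s \<longleftrightarrow> norm_Cauchy ?H (hnorm complex_algebra ?H) (\<lambda>n. T (s n))"
    using True Ts unfolding norm_Cauchy_def
    by (simp add: hnorm_def T_rinner T_minus del: amplification_simps)
  also have "\<dots> \<longleftrightarrow> (\<forall>i<d. norm_Cauchy (column_bimodule :: (complex^'n^'n, complex, complex^'n) eq_bimod)
      (hnorm complex_algebra (column_bimodule :: (complex^'n^'n, complex, complex^'n) eq_bimod)) (\<lambda>n. T (s n) i))"
    using column.norm_Cauchy_amplification[of d "\<lambda>n. T (s n)"]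
      column.norm_Cauchy_amplificationI[of "\<lambda>n. T (s n)" d] Ts by blast
  also have "\<dots> \<longleftrightarrow> (\<forall>i<d. convergent (\<lambda>n. T (s n) i))"
    by (simp add: hnorm_column_bimodule norm_Cauchy_def a_minus_plus Cauchy_iff Cauchy_convergent_iff[symmetric])
  finally show ?thesis using True by simp
next
  case False
  thus ?thesis unfolding norm_Cauchy_def by blast
qed

lemma T_lim_eqI:
  assumes "\<And>i. i < d \<Longrightarrow> (\<lambda>n. T (s n) i) \<longlonglongrightarrow> l i" "\<And>i. i \<ge> d \<Longrightarrow> l i = 0"
  shows "T_lim s = l"
proof
  fix i
  show "T_lim s i = l i"
    using limI[OF assms(1)] assms(2) by (cases "i < d") (simp_all add: T_lim_def)
qed

lemma tendsto_T_lim: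
  assumes "norm_Cauchy V (hnorm complex_algebra V) s" "i < d"
  shows "(\<lambda>n. T (s n) i) \<longlonglongrightarrow> T_lim s i"
proof -
  have "convergent (\<lambda>n. T (s n) i)" using assms norm_Cauchy_iff by blast
  thus ?thesis using assms(2) by (simp add: T_lim_def convergent_LIMSEQ_iff)
qed

lemma T_lim_outside: "i \<ge> d \<Longrightarrow> T_lim s i = 0"
  by (simp add: T_lim_def)

lemma norm_CauchyI:
  assumes "\<And>n. s n \<in> carrier V" "\<And>i. i < d \<Longrightarrow> (\<lambda>n. T (s n) i) \<longlonglongrightarrow> l i"
  shows "norm_Cauchy V (hnorm complex_algebra V) s"
  unfolding norm_Cauchy_iff using assms by (auto intro: convergentI)

lemma tendsto_scalar: "f \<longlonglongrightarrow> l \<Longrightarrow> (\<lambda>n. z *s f n) \<longlonglongrightarrow> z *s l"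
  for f :: "nat \<Rightarrow> complex^'n"
  by (rule vec_tendstoI) (simp, intro tendsto_intros)

lemma tendsto_lact: "f \<longlonglongrightarrow> l \<Longrightarrow> (\<lambda>n. a *v f n) \<longlonglongrightarrow> a *v l"
  for f :: "nat \<Rightarrow> complex^'n" and a :: "complex^'n^'n"
  by (rule bounded_linear.tendsto[OF bounded_linear_cmat])

lemma tendsto_cinner: "f \<longlonglongrightarrow> l \<Longrightarrow> g \<longlonglongrightarrow> m \<Longrightarrow> (\<lambda>n. cinner (f n) (g n)) \<longlonglongrightarrow> cinner l m"
  for f g :: "nat \<Rightarrow> complex^'n"
  unfolding cinner_def by (intro tendsto_intros)

text \<open>Continuity of the operations lets \<open>T_lim\<close> inherit the compatibilities of
  \<open>T\<close>. It is onto already on constant sequences, and the limit defining the inner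
  product of two Cauchy sequences is the inner product of their limits.\<close>

lemma cauchy_sequences_quotient:
  "isometric_quotient matrix_algebra complex_algebra (amplification d complex_algebra column_bimodule)
     (cauchy_sequences complex_algebra V) T_lim"
proof -
  let ?C = "\<lambda>s. norm_Cauchy V (hnorm complex_algebra V) s"
  let ?W = "cauchy_sequences complex_algebra V"
  have W [simp]: "carrier ?W = {s. ?C s}" "\<zero>\<^bsub>?W\<^esub> = (\<lambda>n. \<zero>\<^bsub>V\<^esub>)" "s \<oplus>\<^bsub>?W\<^esub> t = (\<lambda>n. s n \<oplus>\<^bsub>V\<^esub> t n)"
    "z \<odot>\<^bsub>?W\<^esub> s = (\<lambda>n. z \<odot>\<^bsub>V\<^esub> s n)" "ract ?W s b = (\<lambda>n. ract V (s n) b)"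
    "lact ?W a s = (\<lambda>n. lact V a (s n))"
    "rinner ?W s t = (THE l. norm_tendsto complex_algebra cmod (\<lambda>n. rinner V (s n) (t n)) l)" for s t z a b
    by (simp_all add: cauchy_sequences_def)
  have closed: "s n \<in> carrier V" if "?C s" for s n using that norm_Cauchy_iff by blast
  \<comment> \<open>Coordinatewise limits with a zero tail give at once the Cauchy property and the
    value of \<open>T_lim\<close>, so each operation needs only its limit law.\<close>
  have op: "?C u \<and> T_lim u = l"
    if "\<And>n. u n \<in> carrier V" "\<And>i. i < d \<Longrightarrow> (\<lambda>n. T (u n) i) \<longlonglongrightarrow> l i" "\<And>i. i \<ge> d \<Longrightarrow> l i = 0" for u l
    using norm_CauchyI[of u l] T_lim_eqI[of u l] that by blast
  have add: "?C (\<lambda>n. s n \<oplus>\<^bsub>V\<^esub> t n) \<and> T_lim (\<lambda>n. s n \<oplus>\<^bsub>V\<^esub> t n) = (\<lambda>i. T_lim s i + T_lim t i)"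
    if "?C s" "?C t" for s t
    using that by (intro op)
      (simp_all add: closed T_add T_lim_outside tendsto_add tendsto_T_lim)
  have smult: "?C (\<lambda>n. z \<odot>\<^bsub>V\<^esub> s n) \<and> T_lim (\<lambda>n. z \<odot>\<^bsub>V\<^esub> s n) = (\<lambda>i. z *s T_lim s i)"
    if "?C s" for s z
    using that by (intro op)
      (simp_all add: closed V_smult_closed T_smult T_lim_outside tendsto_scalar tendsto_T_lim)
  have lact: "?C (\<lambda>n. lact V a (s n)) \<and> T_lim (\<lambda>n. lact V a (s n)) = (\<lambda>i. a *v T_lim s i)"
    if "?C s" for s a
    using that by (intro op)
      (simp_all add: closed V_lact_closed T_lact T_lim_outside tendsto_lact tendsto_T_lim)
  have ract: "?C (\<lambda>n. ract V (s n) b) \<and> T_lim (\<lambda>n. ract V (s n) b) = (\<lambda>i. b *s T_lim s i)"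
    if "?C s" for s b
    using that by (intro op)
      (simp_all add: closed V_ract_closed T_ract T_lim_outside tendsto_scalar tendsto_T_lim)
  have const: "?C (\<lambda>n. x) \<and> T_lim (\<lambda>n. x) = T x" if "x \<in> carrier V" for x
    using that T_closed[OF that] by (intro op) simp_all
  show ?thesis
  proof (intro isometric_quotient.intro correspondence_axioms isometric_quotient_axioms.intro)
    show "abelian_group ?W"
    proof (rule abelian_groupI)
      show "\<exists>t\<in>carrier ?W. t \<oplus>\<^bsub>?W\<^esub> s = \<zero>\<^bsub>?W\<^esub>" if "s \<in> carrier ?W" for s
      proof (intro bexI)
        have s: "?C s" using that by simp
        have "T (\<ominus>\<^bsub>V\<^esub> x) = (\<lambda>i. - T x i)" if "x \<in> carrier V" for x
        proof
          have "T (\<ominus>\<^bsub>V\<^esub> x) i + T x i = 0" for i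
            using that T_add[of "\<ominus>\<^bsub>V\<^esub> x" x] by (simp add: V.l_neg T_zero fun_eq_iff)
          thus "T (\<ominus>\<^bsub>V\<^esub> x) i = - T x i" for i by (simp add: eq_neg_iff_add_eq_0)
        qed
        hence "?C (\<lambda>n. \<ominus>\<^bsub>V\<^esub> s n) \<and> T_lim (\<lambda>n. \<ominus>\<^bsub>V\<^esub> s n) = (\<lambda>i. - T_lim s i)"
          using s by (intro op) (simp_all add: closed T_lim_outside tendsto_minus tendsto_T_lim)
        thus "(\<lambda>n. \<ominus>\<^bsub>V\<^esub> s n) \<in> carrier ?W" by simp
        show "(\<lambda>n. \<ominus>\<^bsub>V\<^esub> s n) \<oplus>\<^bsub>?W\<^esub> s = \<zero>\<^bsub>?W\<^esub>" using closed[OF s] by (simp add: V.l_neg)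
      qed
    qed (simp_all add: add const closed V.a_ac)
    show "\<exists>s\<in>carrier ?W. T_lim s = h" if h: "h \<in> carrier (amplification d complex_algebra column_bimodule)" for h
    proof -
      obtain x where "x \<in> carrier V" "T x = h" using T_surj[OF h] by blast
      thus ?thesis using const[of x] by (intro bexI[of _ "\<lambda>n. x"]) simp_all
    qed
    show "rinner ?W s t = rinner (amplification d complex_algebra column_bimodule) (T_lim s) (T_lim t)"
      if "s \<in> carrier ?W" "t \<in> carrier ?W" for s t
    proof -
      have st: "?C s" "?C t" using that by simp_all
      have iff: "norm_tendsto complex_algebra cmod u l \<longleftrightarrow> u \<longlonglongrightarrow> l" for u l
        by (rule equivalent_norm_tendsto[of _ 1 _ 1]) simp_all
      have "(\<lambda>n. \<Sum>i<d. cinner (T (s n) i) (T (t n) i)) \<longlonglongrightarrow> (\<Sum>i<d. cinner (T_lim s i) (T_lim t i))"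
        using st by (intro tendsto_sum tendsto_cinner tendsto_T_lim) auto
      hence lim: "(\<lambda>n. rinner V (s n) (t n)) \<longlonglongrightarrow> (\<Sum>i<d. cinner (T_lim s i) (T_lim t i))"
        using st by (simp add: T_rinner closed)
      hence "(THE l. norm_tendsto complex_algebra cmod (\<lambda>n. rinner V (s n) (t n)) l)
          = (\<Sum>i<d. cinner (T_lim s i) (T_lim t i))"
        unfolding iff by (intro the_equality) (auto intro: LIMSEQ_unique)
      thus ?thesis by simp
    qed
    show "T_lim s \<in> carrier (amplification d complex_algebra column_bimodule)" for s
      by (simp add: T_lim_outside)
  qed (simp_all add: add smult lact ract)
qed

lemma completion_isomorphic:
  "corr_isomorphic matrix_algebra complex_algebra (completion complex_algebra V)
     (amplification d complex_algebra column_bimodule)"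
  "correspondence matrix_algebra complex_algebra (completion complex_algebra V)"
proof -
  interpret W: isometric_quotient matrix_algebra complex_algebra
    "amplification d complex_algebra column_bimodule" "cauchy_sequences complex_algebra V" T_lim
    by (rule cauchy_sequences_quotient)
  show "corr_isomorphic matrix_algebra complex_algebra (completion complex_algebra V)
      (amplification d complex_algebra column_bimodule)"
    "correspondence matrix_algebra complex_algebra (completion complex_algebra V)"
    unfolding completion_def by (rule W.mod_null_isomorphic, rule W.correspondence_mod_null)
qed

end

section \<open>The tensor products\<close>

text \<open>Both tensor products in the definition of strong Morita equivalence are handled here;
  each has only to supply its \<open>\<rho>\<close>. The second conclusion is recorded because
  inverting an isomorphism requires its source to be a correspondence.\<close>

lemma interior_tensor_isomorphic:
  fixes X :: "(complex^'n^'n, 'b, 'x, 'u) corr_scheme" and F :: "('b, complex, 'f, 'v) corr_scheme"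
    and \<rho> :: "'x \<times> 'f \<Rightarrow> nat \<Rightarrow> complex^'n"
  assumes "tensor_realization matrix_algebra complex_algebra (amplification d complex_algebra column_bimodule)
     (carrier X \<times> carrier F) (\<lambda>a (x, f). (lact X a x, f)) (\<lambda>(x, f) c. (x, ract F f c))
     (\<lambda>(x, f) (x', f'). rinner F f (lact F (rinner X x x') f')) \<rho>"
  shows "corr_isomorphic matrix_algebra complex_algebra (interior_tensor complex_algebra X F)
      (amplification d complex_algebra column_bimodule)"
    and "correspondence matrix_algebra complex_algebra (interior_tensor complex_algebra X F)"
proof -
  interpret R: tensor_realization matrix_algebra complex_algebra "amplification d complex_algebra column_bimodule"
     "carrier X \<times> carrier F" "\<lambda>a (x, f). (lact X a x, f)" "\<lambda>(x, f) c. (x, ract F f c)"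
     "\<lambda>(x, f) (x', f'). rinner F f (lact F (rinner X x x') f')" \<rho> by fact
  interpret Q: column_quotient d R.V R.T
    by (rule column_quotient.intro[OF R.isometric_quotient_axioms])
  show "corr_isomorphic matrix_algebra complex_algebra (interior_tensor complex_algebra X F)
      (amplification d complex_algebra column_bimodule)"
    "correspondence matrix_algebra complex_algebra (interior_tensor complex_algebra X F)"
    unfolding interior_tensor_def by (rule Q.completion_isomorphic)+
qed

lemma fun_sum_mem:
  fixes f :: "'i \<Rightarrow> 'r \<Rightarrow> 'v::ab_group_add"
  assumes "\<And>x y. \<lbrakk>x \<in> D; y \<in> D\<rbrakk> \<Longrightarrow> (\<lambda>r. x r + y r) \<in> D" "(\<lambda>r. 0) \<in> D" "\<And>i. i \<in> I \<Longrightarrow> f i \<in> D"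
  shows "(\<lambda>r. \<Sum>i\<in>I. f i r) \<in> D"
  using assms(3) by (induction I rule: infinite_finite_induct) (simp_all add: assms(1,2))

lemma cinner_scale_left: "cinner (z *s x) y = cnj z * cinner x y"
  by (simp add: cinner_def sum_distrib_left mult_ac)

lemma hilbert_space_eq_amplification:
  "hilbert_space d = amplification d complex_algebra (identity_corr complex_algebra)"
  by (simp add: hilbert_space_def amplification_def)

lemma correspondence_hilbert_space: "correspondence complex_algebra complex_algebra (hilbert_space d)"
  unfolding hilbert_space_eq_amplification
  by (rule amplifiable.correspondence_amplification, rule amplifiable.intro)
    (rule complex_algebra.correspondence_identity complex_algebra.monotone_cstar_algebra_axioms)+

interpretation matrix_id: amplifiable "matrix_algebra :: (complex^'n^'n) star_alg" matrix_algebra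
    "identity_corr matrix_algebra"
  by (rule amplifiable.intro)
    (rule matrix_algebra.correspondence_identity matrix_algebra.monotone_cstar_algebra_axioms)+

lemma column_tensor_hilbert_space:
  "tensor_realization matrix_algebra complex_algebra
     (amplification d complex_algebra (column_bimodule :: (complex^'n^'n, complex, complex^'n) eq_bimod))
     (carrier (column_bimodule :: (complex^'n^'n, complex, complex^'n) eq_bimod) \<times> carrier (hilbert_space d))
     (\<lambda>a (x, f). (lact column_bimodule a x, f))
     (\<lambda>(x, f) c. (x, ract (hilbert_space d) f c))
     (\<lambda>(x, f) (x', f'). rinner (hilbert_space d) f (lact (hilbert_space d) (rinner column_bimodule x x') f'))
     (\<lambda>(x, f) r. f r *s x)"
proof (rule tensor_realization.intro[OF column.correspondence_amplification], rule tensor_realization_axioms.intro)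
  fix D :: "(nat \<Rightarrow> complex^'n) set"
  let ?X = "column_bimodule :: (complex^'n^'n, complex, complex^'n) eq_bimod"
  assume \<rho>: "\<And>s. s \<in> carrier ?X \<times> carrier (hilbert_space d) \<Longrightarrow> (case s of (x, f) \<Rightarrow> \<lambda>r. f r *s x) \<in> D"
    and add: "\<And>x y. \<lbrakk>x \<in> D; y \<in> D\<rbrakk> \<Longrightarrow> x \<oplus>\<^bsub>amplification d complex_algebra ?X\<^esub> y \<in> D"
    and zero: "\<zero>\<^bsub>amplification d complex_algebra ?X\<^esub> \<in> D"
  show "carrier (amplification d complex_algebra ?X) \<subseteq> D"
  proof
    fix h assume h: "h \<in> carrier (amplification d complex_algebra ?X)"
    \<comment> \<open>The tensor of \<open>h r\<close> with the \<open>r\<close>-th standard basis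
      vector is \<open>h r\<close> placed in coordinate \<open>r\<close>; summing over
      \<open>r\<close> rebuilds \<open>h\<close>.\<close>
    have "(\<lambda>i. (if i = r then 1 else 0) *s h r) \<in> D" if "r < d" for r
      using \<rho>[of "(h r, \<lambda>i. if i = r then 1 else 0)"] that by (simp add: hilbert_space_def)
    hence "(\<lambda>i. \<Sum>r<d. (if i = r then 1 else 0) *s h r) \<in> D"
      using add zero by (intro fun_sum_mem) auto
    also have "(\<lambda>i. \<Sum>r<d. (if i = r then 1 else 0) *s h r) = h"
    proof
      fix i
      have "(\<Sum>r<d. (if i = r then 1 else 0) *s h r) = (\<Sum>r<d. if i = r then h r else 0)"
        by (rule sum.cong) auto
      also have "\<dots> = h i" using h by simp
      finally show "(\<Sum>r<d. (if i = r then 1 else 0) *s h r) = h i" .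
    qed
    finally show "h \<in> D" .
  qed
next
  fix s t assume "s \<in> carrier (column_bimodule :: (complex^'n^'n, complex, complex^'n) eq_bimod) \<times> carrier (hilbert_space d)"
    "t \<in> carrier (column_bimodule :: (complex^'n^'n, complex, complex^'n) eq_bimod) \<times> carrier (hilbert_space d)"
  show "(case s of (x, f) \<Rightarrow> \<lambda>(x', f'). rinner (hilbert_space d) f (lact (hilbert_space d) (rinner column_bimodule x x') f')) t
    = rinner (amplification d complex_algebra (column_bimodule :: (complex^'n^'n, complex, complex^'n) eq_bimod))
        (case s of (x, f) \<Rightarrow> \<lambda>r. f r *s x) (case t of (x, f) \<Rightarrow> \<lambda>r. f r *s x)"
    by (simp add: hilbert_space_def case_prod_unfold cinner_scale_left cinner_simps(2) mult_ac)
qed (auto simp: hilbert_space_def vec_eq_iff matrix_vector_mult_def sum_distrib_left mult_ac)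

lemma sum_cmat_vec: "(\<Sum>i\<in>I. f i) *v x = (\<Sum>i\<in>I. f i *v x)" for f :: "'i \<Rightarrow> complex^'n^'n"
  by (induction I rule: infinite_finite_induct) (simp_all add: matrix_vector_mult_add_rdistrib)

lemma cinner_sum_right: "cinner x (\<Sum>i\<in>I. f i) = (\<Sum>i\<in>I. cinner x (f i))"
  by (induction I rule: infinite_finite_induct) (simp_all add: cinner_simps, simp_all add: cinner_def)

lemma cmat_mult_sum_right: "a ** (\<Sum>i\<in>I. f i) = (\<Sum>i\<in>I. a ** f i)" for a :: "complex^'n^'n"
  by (induction I rule: infinite_finite_induct) (simp_all add: matrix_add_ldistrib)

lemma cmat_mult_sum_left: "(\<Sum>i\<in>I. f i) ** a = (\<Sum>i\<in>I. f i ** a)"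
  for a :: "complex^'n^'n" and f :: "'i \<Rightarrow> complex^'n^'n"
  using matrix_algebra.mult_finsum_left[of a f I] by simp

text \<open>\<open>\<phi>\<close> turns a vector of \<open>E\<close> into \<open>d\<close> matrices,
  which act on a column one coordinate at a time. Moving adjoints across \<open>cinner\<close> then
  matches the two inner products.\<close>

lemma tensor_column_realization:
  fixes E :: "(complex^'n^'n, complex^'n^'n, 'e, 'u) corr_scheme"
  assumes E: "correspondence matrix_algebra matrix_algebra E"
    and iso: "corr_isomorphic matrix_algebra matrix_algebra E (amplification d matrix_algebra (identity_corr matrix_algebra))"
  shows "\<exists>\<rho>. tensor_realization matrix_algebra complex_algebra
     (amplification d complex_algebra (column_bimodule :: (complex^'n^'n, complex, complex^'n) eq_bimod))
     (carrier E \<times> carrier (column_bimodule :: (complex^'n^'n, complex, complex^'n) eq_bimod))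
     (\<lambda>a (x, f). (lact E a x, f))
     (\<lambda>(x, f) c. (x, ract column_bimodule f c))
     (\<lambda>(x, f) (x', f'). rinner column_bimodule f (lact column_bimodule (rinner E x x') f')) \<rho>"
proof -
  let ?X = "column_bimodule :: (complex^'n^'n, complex, complex^'n) eq_bimod"
  let ?M = "amplification d matrix_algebra (identity_corr (matrix_algebra :: (complex^'n^'n) star_alg))"
  interpret E: correspondence matrix_algebra matrix_algebra E by fact
  obtain \<phi> where bij: "bij_betw \<phi> (carrier E) (carrier ?M)"
    and hom: "\<forall>a\<in>carrier matrix_algebra. \<forall>x\<in>carrier E. \<phi> (lact E a x) = lact ?M a (\<phi> x)"
      "\<forall>x\<in>carrier E. \<forall>y\<in>carrier E. rinner ?M (\<phi> x) (\<phi> y) = rinner E x y"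
    using iso unfolding corr_isomorphic_def by (elim exE conjE)
  have \<phi>_outside: "\<phi> e r = 0" if "e \<in> carrier E" "r \<ge> d" for e r
    using bij_betwE[OF bij] that by simp
  have \<phi>_surj: "\<exists>e\<in>carrier E. \<phi> e = m" if "m \<in> carrier ?M" for m
    using bij that unfolding bij_betw_def by (metis imageE)
  have \<phi>_lact: "\<phi> (lact E a e) = (\<lambda>r. a ** \<phi> e r)" if "e \<in> carrier E" for a e
    using hom(1) that by simp
  have \<phi>_rinner: "rinner E e e' = (\<Sum>r<d. cmat_adjoint (\<phi> e r) ** \<phi> e' r)" if "e \<in> carrier E" "e' \<in> carrier E" for e e'
    using hom(2) that by force
  have "tensor_realization matrix_algebra complex_algebra (amplification d complex_algebra ?X)
     (carrier E \<times> carrier ?X) (\<lambda>a (x, f). (lact E a x, f)) (\<lambda>(x, f) c. (x, ract ?X f c))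
     (\<lambda>(x, f) (x', f'). rinner ?X f (lact ?X (rinner E x x') f'))
     (\<lambda>(e, x) r. \<phi> e r *v x)"
  proof (rule tensor_realization.intro[OF column.correspondence_amplification], rule tensor_realization_axioms.intro)
    fix D :: "(nat \<Rightarrow> complex^'n) set"
    assume \<rho>: "\<And>s. s \<in> carrier E \<times> carrier ?X \<Longrightarrow> (case s of (e, x) \<Rightarrow> \<lambda>r. \<phi> e r *v x) \<in> D"
      and add: "\<And>x y. \<lbrakk>x \<in> D; y \<in> D\<rbrakk> \<Longrightarrow> x \<oplus>\<^bsub>amplification d complex_algebra ?X\<^esub> y \<in> D"
      and zero: "\<zero>\<^bsub>amplification d complex_algebra ?X\<^esub> \<in> D"
    show "carrier (amplification d complex_algebra ?X) \<subseteq> D"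
    proof
      fix h assume h: "h \<in> carrier (amplification d complex_algebra ?X)"
      \<comment> \<open>Each \<open>h r\<close> becomes a column of a matrix \<open>m r\<close> and
        is recovered by applying that matrix to a basis vector, so \<open>h\<close> is the value of
        a single elementary tensor.\<close>
      define m :: "nat \<Rightarrow> complex^'n^'n" where "m r = (\<chi> i j. if j = undefined then h r $ i else 0)" for r
      have m: "m r *v axis undefined 1 = h r" for r
        by (simp add: m_def vec_eq_iff matrix_vector_mult_def axis_def if_distrib cong: if_cong)
      have "m \<in> carrier ?M" using h by (simp add: m_def vec_eq_iff)
      then obtain e where "e \<in> carrier E" "\<phi> e = m" using \<phi>_surj by blast
      thus "h \<in> D" using \<rho>[of "(e, axis undefined 1)"] by (simp add: m)
    qed
  next
    fix s t assume "s \<in> carrier E \<times> carrier ?X" "t \<in> carrier E \<times> carrier ?X"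
    thus "(case s of (x, f) \<Rightarrow> \<lambda>(x', f'). rinner ?X f (lact ?X (rinner E x x') f')) t
      = rinner (amplification d complex_algebra ?X) (case s of (e, x) \<Rightarrow> \<lambda>r. \<phi> e r *v x) (case t of (e, x) \<Rightarrow> \<lambda>r. \<phi> e r *v x)"
      by (auto simp: \<phi>_rinner sum_cmat_vec cinner_sum_right cinner_adjoint matrix_vector_mul_assoc)
  qed (auto simp: \<phi>_outside E.lact_closed \<phi>_lact matrix_vector_mul_assoc vector_scalar_commute)
  thus ?thesis by blast
qed

text \<open>By the Kraus formula \<open>b1^* P(a1^* a2) b2\<close> is the sum over \<open>r\<close>
  of \<open>(a1 t_r^* b1)^* (a2 t_r^* b2)\<close>, which explains the map on elementary tensors.
  Independence of \<open>t\<close> enters in showing that its values span all \<open>d\<close>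
  summands.\<close>

lemma gns_realization:
  fixes P :: "complex^'n^'n \<Rightarrow> complex^'n^'n" and t :: "nat \<Rightarrow> complex^'n^'n"
  assumes kraus: "kraus_decomposition P d t" and indep: "indep_family {..<d} (\<lambda>r. cmat_entries (t r))"
  shows "tensor_realization matrix_algebra matrix_algebra
    (amplification d matrix_algebra (identity_corr (matrix_algebra :: (complex^'n^'n) star_alg)))
    (carrier matrix_algebra \<times> carrier matrix_algebra)
     (\<lambda>c (a, b). (c \<otimes>\<^bsub>matrix_algebra\<^esub> a, b))
     (\<lambda>(a, b) d. (a, b \<otimes>\<^bsub>matrix_algebra\<^esub> d))
     (\<lambda>(a1, b1) (a2, b2). star matrix_algebra b1 \<otimes>\<^bsub>matrix_algebra\<^esub> P (star matrix_algebra a1 \<otimes>\<^bsub>matrix_algebra\<^esub> a2) \<otimes>\<^bsub>matrix_algebra\<^esub> b2)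
     (\<lambda>(a, b) r. if r < d then a ** cmat_adjoint (t r) ** b else 0)"
proof (rule tensor_realization.intro[OF matrix_id.correspondence_amplification], rule tensor_realization_axioms.intro)
  let ?A = "matrix_algebra :: (complex^'n^'n) star_alg"
  let ?M = "amplification d ?A (identity_corr ?A)"
  let ?\<rho> = "\<lambda>(a, b) r. if r < d then a ** cmat_adjoint (t r) ** b else 0"
  fix D :: "(nat \<Rightarrow> complex^'n^'n) set"
  assume \<rho>: "\<And>s. s \<in> carrier ?A \<times> carrier ?A \<Longrightarrow> ?\<rho> s \<in> D"
    and add0: "\<And>x y. \<lbrakk>x \<in> D; y \<in> D\<rbrakk> \<Longrightarrow> x \<oplus>\<^bsub>?M\<^esub> y \<in> D"
    and zero0: "\<zero>\<^bsub>?M\<^esub> \<in> D" and smult0: "\<And>z x. x \<in> D \<Longrightarrow> z \<odot>\<^bsub>?M\<^esub> x \<in> D"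
  have add: "(\<lambda>r. x r + y r) \<in> D" if "x \<in> D" "y \<in> D" for x y using add0[OF that] by simp
  have zero: "(\<lambda>r. 0) \<in> D" using zero0 by simp
  have smult: "(\<lambda>r. cmat_scale z (x r)) \<in> D" if "x \<in> D" for x z using smult0[OF that, of z] by simp
  note sum_mem = fun_sum_mem[of D, OF add zero]
  \<comment> \<open>Sandwiching between units extracts one entry of \<open>a\<close>; for
    \<open>a\<close> the adjoint of \<open>t s\<close> this is a conjugated entry of
    \<open>t s\<close>.\<close>
  have unit_mult: "cmat_unit i j ** a ** cmat_unit k l = cmat_scale (a $ j $ k) (cmat_unit i l)" for i j k l and a :: "complex^'n^'n"
  proof -
    have "(cmat_unit i j ** a ** cmat_unit k l) $ p $ q = (cmat_scale (a $ j $ k) (cmat_unit i l)) $ p $ q" for p q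
    proof -
      have "(cmat_unit i j ** a) $ p $ m = (if p = i then a $ j $ m else 0)" for m
        by (cases "p = i") (simp_all add: matrix_matrix_mult_def mult_delta_left)
      hence "(cmat_unit i j ** a ** cmat_unit k l) $ p $ q = (\<Sum>m\<in>UNIV. (if p = i then a $ j $ m else 0) * (if m = k \<and> q = l then 1 else 0))"
        by (simp add: matrix_matrix_mult_def[of _ "cmat_unit k l"])
      also have "\<dots> = (cmat_scale (a $ j $ k) (cmat_unit i l)) $ p $ q"
        by (cases "p = i"; cases "q = l") (simp_all add: mult_delta_right)
      finally show ?thesis .
    qed
    thus ?thesis by (simp add: vec_eq_iff)
  qed
  have unit_mem: "(\<lambda>s. if s = r then cmat_unit i l else 0) \<in> D" if r: "r < d" for r i l
  proof -
    obtain c where c: "\<And>s. s < d \<Longrightarrow> (\<Sum>p\<in>UNIV. \<Sum>q\<in>UNIV. c p q * t s $ p $ q) = (if s = r then 1 else 0)"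
      using indep_family_dual[OF indep r] by blast
    \<comment> \<open>Below \<open>d\<close>, coordinate \<open>s\<close> of the value at
      \<open>(cmat_unit i q, cmat_unit p l)\<close> is \<open>cnj (t s $ p $ q)\<close> times
      \<open>cmat_unit i l\<close>. Weighting with the conjugate of the dual functional
      \<open>c\<close> leaves only coordinate \<open>r\<close>.\<close>
    have "(\<lambda>s. \<Sum>p\<in>UNIV. \<Sum>q\<in>UNIV. cmat_scale (cnj (c p q)) (?\<rho> (cmat_unit i q, cmat_unit p l) s)) \<in> D"
      by (intro sum_mem smult \<rho>) simp_all
    also have "(\<lambda>s. \<Sum>p\<in>UNIV. \<Sum>q\<in>UNIV. cmat_scale (cnj (c p q)) (?\<rho> (cmat_unit i q, cmat_unit p l) s))
      = (\<lambda>s. if s = r then cmat_unit i l else 0)"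
    proof
      fix s
      show "(\<Sum>p\<in>UNIV. \<Sum>q\<in>UNIV. cmat_scale (cnj (c p q)) (?\<rho> (cmat_unit i q, cmat_unit p l) s))
        = (if s = r then cmat_unit i l else 0)"
      proof (cases "s < d")
        case True
        have "(\<Sum>p\<in>UNIV. \<Sum>q\<in>UNIV. cmat_scale (cnj (c p q)) (?\<rho> (cmat_unit i q, cmat_unit p l) s))
          = (\<Sum>p\<in>UNIV. \<Sum>q\<in>UNIV. cmat_scale (cnj (c p q * t s $ p $ q)) (cmat_unit i l))"
          using True by (simp add: unit_mult)
        also have "\<dots> = cmat_scale (cnj (\<Sum>p\<in>UNIV. \<Sum>q\<in>UNIV. c p q * t s $ p $ q)) (cmat_unit i l)"
          by (simp only: cmat.scale_sum_left cnj_sum)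
        also have "\<dots> = (if s = r then cmat_unit i l else 0)" by (simp add: c[OF True])
        finally show ?thesis .
      next
        case False
        thus ?thesis using r by simp
      qed
    qed
    finally show ?thesis .
  qed
  show "carrier ?M \<subseteq> D"
  proof
    fix h assume h: "h \<in> carrier ?M"
    have "(\<lambda>s. \<Sum>r<d. \<Sum>i\<in>UNIV. \<Sum>l\<in>UNIV. cmat_scale (h r $ i $ l) (if s = r then cmat_unit i l else 0)) \<in> D"
      by (intro sum_mem smult unit_mem) simp_all
    also have "(\<lambda>s. \<Sum>r<d. \<Sum>i\<in>UNIV. \<Sum>l\<in>UNIV. cmat_scale (h r $ i $ l) (if s = r then cmat_unit i l else 0)) = h"
    proof
      fix s
      have "(\<Sum>r<d. \<Sum>i\<in>UNIV. \<Sum>l\<in>UNIV. cmat_scale (h r $ i $ l) (if s = r then cmat_unit i l else 0))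
        = (\<Sum>r<d. if s = r then h r else 0)"
        by (intro sum.cong refl) (simp flip: cmat_expand)
      also have "\<dots> = h s" using h by simp
      finally show "(\<Sum>r<d. \<Sum>i\<in>UNIV. \<Sum>l\<in>UNIV. cmat_scale (h r $ i $ l) (if s = r then cmat_unit i l else 0)) = h s" .
    qed
    finally show "h \<in> D" .
  qed
next
  let ?A = "matrix_algebra :: (complex^'n^'n) star_alg"
  let ?M = "amplification d ?A (identity_corr ?A)"
  let ?\<rho> = "\<lambda>(a, b) r. if r < d then a ** cmat_adjoint (t r) ** b else 0"
  have P: "P a = (\<Sum>r<d. t r ** a ** cmat_adjoint (t r))" for a
    using kraus by (simp add: kraus_decomposition_def)
  show "(case s of (a1, b1) \<Rightarrow> \<lambda>(a2, b2). star ?A b1 \<otimes>\<^bsub>?A\<^esub> P (star ?A a1 \<otimes>\<^bsub>?A\<^esub> a2) \<otimes>\<^bsub>?A\<^esub> b2) u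
    = rinner ?M (?\<rho> s) (?\<rho> u)" for s u
    by (auto simp: P cmat_mult_sum_left cmat_mult_sum_right matrix_mul_assoc split: prod.splits)
qed (auto simp: matrix_mul_assoc)

theorem theorem1:
  fixes P :: "complex^'n^'n \<Rightarrow> complex^'n^'n"
  assumes "completely_positive matrix_algebra matrix_algebra P"
  shows "strongly_morita_equivalent TYPE(complex^'n)
           matrix_algebra (gns_correspondence matrix_algebra P)
           complex_algebra (hilbert_space (cp_index P))"
proof -
  let ?A = "matrix_algebra :: (complex^'n^'n) star_alg"
  let ?X = "column_bimodule :: (complex^'n^'n, complex, complex^'n) eq_bimod"
  let ?E = "gns_correspondence ?A P"
  obtain d t where t: "kraus_decomposition P d t" "indep_family {..<d} (\<lambda>r. cmat_entries (t r))"
    using indep_kraus_decomposition_exists[OF assms] by blast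
  \<comment> \<open>Independence makes the number of summands equal to the index.\<close>
  have d: "cp_index P = d" by (rule cp_index_indep[OF t])
  interpret G: tensor_realization ?A ?A "amplification d ?A (identity_corr ?A)"
    "carrier ?A \<times> carrier ?A" "\<lambda>c (a, b). (c \<otimes>\<^bsub>?A\<^esub> a, b)" "\<lambda>(a, b) d. (a, b \<otimes>\<^bsub>?A\<^esub> d)"
    "\<lambda>(a1, b1) (a2, b2). star ?A b1 \<otimes>\<^bsub>?A\<^esub> P (star ?A a1 \<otimes>\<^bsub>?A\<^esub> a2) \<otimes>\<^bsub>?A\<^esub> b2"
    "\<lambda>(a, b) r. if r < d then a ** cmat_adjoint (t r) ** b else 0"
    by (rule gns_realization[OF t])
  have E: "correspondence ?A ?A ?E"
    and iso: "corr_isomorphic ?A ?A ?E (amplification d ?A (identity_corr ?A))"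
    unfolding gns_correspondence_def by (rule G.correspondence_mod_null, rule G.mod_null_isomorphic)
  obtain \<rho> where "tensor_realization ?A complex_algebra (amplification d complex_algebra ?X)
     (carrier ?E \<times> carrier ?X) (\<lambda>a (x, f). (lact ?E a x, f)) (\<lambda>(x, f) c. (x, ract ?X f c))
     (\<lambda>(x, f) (x', f'). rinner ?X f (lact ?X (rinner ?E x x') f')) \<rho>"
    using tensor_column_realization[OF E iso] by blast
  note EX = interior_tensor_isomorphic[OF this]
  note XH = interior_tensor_isomorphic[OF column_tensor_hilbert_space]
  \<comment> \<open>Both tensor products are isomorphic to the \<open>d\<close>-fold sum of the
    column vectors; one isomorphism is composed with the inverse of the other.\<close>
  have "corr_isomorphic ?A complex_algebra (interior_tensor complex_algebra ?X (hilbert_space d))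
      (interior_tensor complex_algebra ?E ?X)"
    by (rule corr_isomorphic_trans[OF XH(1) corr_isomorphic_sym[OF EX(2) EX(1)]])
  thus ?thesis
    unfolding strongly_morita_equivalent_def d
    using E correspondence_hilbert_space equivalence_bimodule_column by blast
qed

end
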